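(* Let $\pi:(M,\varphi,\xi,\eta,g)\to(M',J,g')$ be a contact-complex Riemannian submersion with $\dim M=2m+1\ge5$ and $\dim M'=2n\ge2$. Let $\omega$ be the Lee form of $M$, $B=\omega^\sharp$, and assume $d\phi=-2\omega\wedge\phi$. Then for every $X\in\chi^h(M)$ and $U\in\chi^v(M)$, \[v\big((\nabla_X\varphi)U\big)=-\eta(U)\varphi(T_\xi X)-g(T_\xi X,\varphi U)\xi,\] \[v\big((\nabla_U\varphi)X\big)=\eta(U)\big(T_\xi\varphi X-\varphi(T_\xi X)\big)+\omega(X)\varphi U+\omega(\varphi X)\varphi^2U+\tfrac12N_\varphi(X,\varphi U).\] Moreover, the O'Neill invariant $T$ satisfies, for all $U,V\in\chi^v(M)$, \[T_U\varphi V-T_{\varphi U}V=\eta(U)T_{\varphi V}\xi-\eta(V)T_{\varphi U}\xi+2\phi(U,V)\,h(B).\]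
   Context: All objects are smooth. An almost contact metric (ACM) manifold $(M,\varphi,\xi,\eta,g)$ is a $(2m+1)$-dimensional Riemannian manifold with a $(1,1)$-tensor field $\varphi$, a vector field $\xi$ and a 1-form $\eta$ such that $\varphi^2=-I+\eta\otimes\xi$, $\eta(\xi)=1$, $g(\varphi X,\varphi Y)=g(X,Y)-\eta(X)\eta(Y)$. Its fundamental form is $\phi(X,Y)=g(X,\varphi Y)$. The Nijenhuis tensor of $\varphi$ is $N_\varphi(X,Y)=\varphi^2[X,Y]+[\varphi X,\varphi Y]-\varphi[X,\varphi Y]-\varphi[\varphi X,Y]$. $\nabla$ is the Levi-Civita connection and $\delta$ the codifferential: for a local orthonormal frame $\{e_i\}$, $\delta\eta=-\sum_i(\nabla_{e_i}\eta)(e_i)$ and $\delta\phi(X)=-\sum_i(\nabla_{e_i}\phi)(e_i,X)$. For $m\ge2$ the Lee form of $M$ is \[\omega=-\tfrac{1}{2(m-1)}\big(\delta\phi\circ\varphi+\nabla_\xi\eta\big)+\tfrac{\delta\eta}{2m}\,\eta ,\] and $B=\omega^\sharp$ is its $g$-dual. A contact-complex Riemannian submersion $\pi:(M,\varphi,\xi,\eta,g)\to(M',J,g')$ is a Riemannian submersion from an ACM manifold onto an almost Hermitian manifold ($J^2=-I$, $g'(J\cdot,J\cdot)=g'$) with $J\circ\pi_*=\pi_*\circ\varphi$. Let $\mathcal V=\ker\pi_*$, $\mathcal H=\mathcal V^\perp$, $v,h$ the orthogonal projections on $\mathcal V,\mathcal H$, and $\chi^v(M),\chi^h(M)$ the vertical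 and horizontal vector fields. ($\xi$ is vertical and $\varphi$ preserves $\mathcal V$ and $\mathcal H$.) The O'Neill invariant $T$ is $T_EF=h(\nabla_{vE}vF)+v(\nabla_{vE}hF)$. *)

theory Defs
  imports "HOL-Analysis.Analysis" "HOL-Library.Function_Algebras"
begin

text \<open>Pointwise real vector space structure on functions; tangent vectors and vector fields
  below are functions, and their sums and multiples are the pointwise ones.\<close>

instantiation "fun" :: (type, real_vector) real_vector
begin

definition scaleR_fun :: "real \<Rightarrow> ('a \<Rightarrow> 'b) \<Rightarrow> 'a \<Rightarrow> 'b" where
  "scaleR_fun c f = (\<lambda>x. c *\<^sub>R f x)"

instance
  by standard (simp_all add: scaleR_fun_def fun_eq_iff scaleR_add_right scaleR_add_left)

end

lemma scaleR_fun_apply [simp]: "(c *\<^sub>R f) x = c *\<^sub>R f x"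
  by (simp add: scaleR_fun_def)


section \<open>Smooth manifolds\<close>

text \<open>For open \<open>S\<close>: all iterated directional derivatives up to order \<open>k\<close> exist and are continuous.\<close>

primrec Ck_on :: "nat \<Rightarrow> 'e::real_normed_vector set \<Rightarrow> ('e \<Rightarrow> 'f::real_normed_vector) \<Rightarrow> bool" where
  "Ck_on 0 S f \<longleftrightarrow> continuous_on S f"
| "Ck_on (Suc k) S f \<longleftrightarrow> (\<forall>x\<in>S. f differentiable (at x)) \<and>
     (\<forall>v. Ck_on k S (\<lambda>x. frechet_derivative f (at x) v))"

definition smooth_on :: "'e::real_normed_vector set \<Rightarrow> ('e \<Rightarrow> 'f::real_normed_vector) \<Rightarrow> bool" where
  "smooth_on S f \<longleftrightarrow> (\<forall>k. Ck_on k S f)"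

type_synonym ('a, 'e) chart = "'a set \<times> ('a \<Rightarrow> 'e)"

text \<open>The manifold is the whole type \<open>'a\<close> (Hausdorff and second countable through its type classes),
  with a smooth atlas modelled on the Euclidean space \<open>'e\<close>; its dimension is \<open>DIM('e)\<close>.
  The atlas need not be maximal.\<close>

definition smooth_manifold ::
  "('a::{t2_space,second_countable_topology}, 'e::euclidean_space) chart set \<Rightarrow> bool" where
  "smooth_manifold A \<longleftrightarrow>
     (\<Union>(U, \<kappa>)\<in>A. U) = UNIV \<and>
     (\<forall>(U, \<kappa>)\<in>A. open U \<and> open (\<kappa> ` U) \<and> homeomorphism U (\<kappa> ` U) \<kappa> (inv_into U \<kappa>)) \<and>
     (\<forall>(U, \<kappa>)\<in>A. \<forall>(V, \<psi>)\<in>A. smooth_on (\<kappa> ` (U \<inter> V)) (\<psi> \<circ> inv_into U \<kappa>))"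

definition smooth_fun :: "('a, 'e::euclidean_space) chart set \<Rightarrow> ('a \<Rightarrow> real) set" where
  "smooth_fun A = {f. \<forall>(U, \<kappa>)\<in>A. smooth_on (\<kappa> ` U) (f \<circ> inv_into U \<kappa>)}"

definition smooth_map ::
  "('a::topological_space, 'e::euclidean_space) chart set \<Rightarrow>
   ('b::topological_space, 'f::euclidean_space) chart set \<Rightarrow> ('a \<Rightarrow> 'b) \<Rightarrow> bool" where
  "smooth_map A A' \<pi> \<longleftrightarrow> continuous_on UNIV \<pi> \<and>
     (\<forall>(U, \<kappa>)\<in>A. \<forall>(V, \<psi>)\<in>A'. smooth_on (\<kappa> ` (U \<inter> \<pi> -` V)) (\<psi> \<circ> \<pi> \<circ> inv_into U \<kappa>))"


subsection \<open>Tangent vectors and vector fields\<close>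

type_synonym 'a tvec = "('a \<Rightarrow> real) \<Rightarrow> real"
type_synonym 'a vfield = "'a \<Rightarrow> 'a tvec"

text \<open>Tangent vectors at \<open>p\<close> are the derivations at \<open>p\<close> of the algebra of smooth functions. They are
  set to \<open>0\<close> on non-smooth functions, so that equality of tangent vectors is equality in HOL.\<close>

definition tangent_space :: "('a, 'e::euclidean_space) chart set \<Rightarrow> 'a \<Rightarrow> 'a tvec set" where
  "tangent_space A p = {v.
     (\<forall>f\<in>smooth_fun A. \<forall>h\<in>smooth_fun A. v (\<lambda>q. f q + h q) = v f + v h) \<and>
     (\<forall>c. \<forall>f\<in>smooth_fun A. v (\<lambda>q. c * f q) = c * v f) \<and>
     (\<forall>f\<in>smooth_fun A. \<forall>h\<in>smooth_fun A. v (\<lambda>q. f q * h q) = f p * v h + h p * v f) \<and>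
     (\<forall>f. f \<notin> smooth_fun A \<longrightarrow> v f = 0)}"

definition vfields :: "('a, 'e::euclidean_space) chart set \<Rightarrow> 'a vfield set" where
  "vfields A = {X. (\<forall>p. X p \<in> tangent_space A p) \<and> (\<forall>f\<in>smooth_fun A. (\<lambda>p. X p f) \<in> smooth_fun A)}"

definition fscale :: "('a \<Rightarrow> real) \<Rightarrow> 'a vfield \<Rightarrow> 'a vfield" where
  "fscale f X = (\<lambda>p. f p *\<^sub>R X p)"

text \<open>If \<open>f\<close> is not smooth then \<open>q \<mapsto> Y q f\<close> is the zero function, so the bracket vanishes on \<open>f\<close>,
  as the convention for tangent vectors requires.\<close>

definition bracket :: "'a vfield \<Rightarrow> 'a vfield \<Rightarrow> 'a vfield" where
  "bracket X Y = (\<lambda>p f. X p (\<lambda>q. Y q f) - Y p (\<lambda>q. X q f))"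

text \<open>The differential at any point of a map into the manifold with atlas \<open>A'\<close>.\<close>

definition push :: "('b, 'f::euclidean_space) chart set \<Rightarrow> ('a \<Rightarrow> 'b) \<Rightarrow> 'a tvec \<Rightarrow> 'b tvec" where
  "push A' \<pi> x = (\<lambda>f. if f \<in> smooth_fun A' then x (f \<circ> \<pi>) else 0)"


subsection \<open>Tensor fields\<close>

text \<open>Tensor fields are families of multilinear maps on the tangent spaces. Smoothness is tested on
  smooth vector fields.\<close>

definition lin_on :: "'v::real_vector set \<Rightarrow> ('v \<Rightarrow> 'w::real_vector) \<Rightarrow> bool" where
  "lin_on S f \<longleftrightarrow> (\<forall>x\<in>S. \<forall>y\<in>S. f (x + y) = f x + f y) \<and> (\<forall>c. \<forall>x\<in>S. f (c *\<^sub>R x) = c *\<^sub>R f x)"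

definition one_form ::
  "('a, 'e::euclidean_space) chart set \<Rightarrow> ('a \<Rightarrow> 'a tvec \<Rightarrow> real) \<Rightarrow> bool" where
  "one_form A \<eta> \<longleftrightarrow> (\<forall>p. lin_on (tangent_space A p) (\<eta> p)) \<and>
     (\<forall>X\<in>vfields A. (\<lambda>p. \<eta> p (X p)) \<in> smooth_fun A)"

definition endo_field ::
  "('a, 'e::euclidean_space) chart set \<Rightarrow> ('a \<Rightarrow> 'a tvec \<Rightarrow> 'a tvec) \<Rightarrow> bool" where
  "endo_field A \<phi> \<longleftrightarrow>
     (\<forall>p. lin_on (tangent_space A p) (\<phi> p) \<and> \<phi> p ` tangent_space A p \<subseteq> tangent_space A p) \<and>
     (\<forall>X\<in>vfields A. (\<lambda>p. \<phi> p (X p)) \<in> vfields A)"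

definition app :: "('a \<Rightarrow> 'a tvec \<Rightarrow> 'a tvec) \<Rightarrow> 'a vfield \<Rightarrow> 'a vfield" where
  "app \<phi> X = (\<lambda>p. \<phi> p (X p))"

definition riemannian_metric ::
  "('a, 'e::euclidean_space) chart set \<Rightarrow> ('a \<Rightarrow> 'a tvec \<Rightarrow> 'a tvec \<Rightarrow> real) \<Rightarrow> bool" where
  "riemannian_metric A g \<longleftrightarrow>
     (\<forall>p. (\<forall>x\<in>tangent_space A p. lin_on (tangent_space A p) (g p x)) \<and>
          (\<forall>x\<in>tangent_space A p. \<forall>y\<in>tangent_space A p. g p x y = g p y x) \<and>
          (\<forall>x\<in>tangent_space A p. x \<noteq> 0 \<longrightarrow> g p x x > 0)) \<and>
     (\<forall>X\<in>vfields A. \<forall>Y\<in>vfields A. (\<lambda>p. g p (X p) (Y p)) \<in> smooth_fun A)"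

text \<open>Exterior derivative of a 2-form, and wedge product of a 1-form with a 2-form, evaluated on
  vector fields, in the normalisation without the factor 1/3. If both carry that factor, an equation
  such as \<open>d\<beta> = - 2 \<omega> \<and> \<beta>\<close> is unchanged. The 1-form is given by its values on vector fields.\<close>

definition ext_deriv2 ::
  "('a \<Rightarrow> 'a tvec \<Rightarrow> 'a tvec \<Rightarrow> real) \<Rightarrow> 'a vfield \<Rightarrow> 'a vfield \<Rightarrow> 'a vfield \<Rightarrow> 'a \<Rightarrow> real" where
  "ext_deriv2 \<beta> X Y Z p =
     X p (\<lambda>q. \<beta> q (Y q) (Z q)) + Y p (\<lambda>q. \<beta> q (Z q) (X q)) + Z p (\<lambda>q. \<beta> q (X q) (Y q))
     - \<beta> p (bracket X Y p) (Z p) - \<beta> p (bracket Y Z p) (X p) - \<beta> p (bracket Z X p) (Y p)"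

definition wedge12 ::
  "('a vfield \<Rightarrow> 'a \<Rightarrow> real) \<Rightarrow> ('a \<Rightarrow> 'a tvec \<Rightarrow> 'a tvec \<Rightarrow> real) \<Rightarrow>
   'a vfield \<Rightarrow> 'a vfield \<Rightarrow> 'a vfield \<Rightarrow> 'a \<Rightarrow> real" where
  "wedge12 \<omega> \<beta> X Y Z p =
     \<omega> X p * \<beta> p (Y p) (Z p) + \<omega> Y p * \<beta> p (Z p) (X p) + \<omega> Z p * \<beta> p (X p) (Y p)"


section \<open>Levi-Civita connection, covariant derivatives, codifferentials\<close>

definition connection ::
  "('a, 'e::euclidean_space) chart set \<Rightarrow> ('a vfield \<Rightarrow> 'a vfield \<Rightarrow> 'a vfield) \<Rightarrow> bool" where
  "connection A D \<longleftrightarrow>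
     (\<forall>X\<in>vfields A. \<forall>Y\<in>vfields A. D X Y \<in> vfields A) \<and>
     (\<forall>X\<in>vfields A. \<forall>X'\<in>vfields A. \<forall>Y\<in>vfields A. D (X + X') Y = D X Y + D X' Y) \<and>
     (\<forall>f\<in>smooth_fun A. \<forall>X\<in>vfields A. \<forall>Y\<in>vfields A. D (fscale f X) Y = fscale f (D X Y)) \<and>
     (\<forall>X\<in>vfields A. \<forall>Y\<in>vfields A. \<forall>Y'\<in>vfields A. D X (Y + Y') = D X Y + D X Y') \<and>
     (\<forall>f\<in>smooth_fun A. \<forall>X\<in>vfields A. \<forall>Y\<in>vfields A.
        D X (fscale f Y) = fscale f (D X Y) + fscale (\<lambda>p. X p f) Y)"

definition levi_civita ::
  "('a, 'e::euclidean_space) chart set \<Rightarrow> ('a \<Rightarrow> 'a tvec \<Rightarrow> 'a tvec \<Rightarrow> real) \<Rightarrow>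
   ('a vfield \<Rightarrow> 'a vfield \<Rightarrow> 'a vfield) \<Rightarrow> bool" where
  "levi_civita A g D \<longleftrightarrow> connection A D \<and>
     (\<forall>X\<in>vfields A. \<forall>Y\<in>vfields A. D X Y - D Y X = bracket X Y) \<and>
     (\<forall>X\<in>vfields A. \<forall>Y\<in>vfields A. \<forall>Z\<in>vfields A. \<forall>p.
        X p (\<lambda>q. g q (Y q) (Z q)) = g p (D X Y p) (Z p) + g p (Y p) (D X Z p))"

definition cov_endo ::
  "('a vfield \<Rightarrow> 'a vfield \<Rightarrow> 'a vfield) \<Rightarrow> ('a \<Rightarrow> 'a tvec \<Rightarrow> 'a tvec) \<Rightarrow>
   'a vfield \<Rightarrow> 'a vfield \<Rightarrow> 'a vfield" where
  "cov_endo D \<phi> X Y = D X (app \<phi> Y) - app \<phi> (D X Y)"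

definition cov_form1 ::
  "('a vfield \<Rightarrow> 'a vfield \<Rightarrow> 'a vfield) \<Rightarrow> ('a \<Rightarrow> 'a tvec \<Rightarrow> real) \<Rightarrow>
   'a vfield \<Rightarrow> 'a vfield \<Rightarrow> 'a \<Rightarrow> real" where
  "cov_form1 D \<eta> X Y p = X p (\<lambda>q. \<eta> q (Y q)) - \<eta> p (D X Y p)"

definition cov_form2 ::
  "('a vfield \<Rightarrow> 'a vfield \<Rightarrow> 'a vfield) \<Rightarrow> ('a \<Rightarrow> 'a tvec \<Rightarrow> 'a tvec \<Rightarrow> real) \<Rightarrow>
   'a vfield \<Rightarrow> 'a vfield \<Rightarrow> 'a vfield \<Rightarrow> 'a \<Rightarrow> real" where
  "cov_form2 D \<beta> X Y Z p =
     X p (\<lambda>q. \<beta> q (Y q) (Z q)) - \<beta> p (D X Y p) (Z p) - \<beta> p (Y p) (D X Z p)"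

text \<open>A local orthonormal frame near \<open>p\<close>, represented by global vector fields that are orthonormal on
  a neighbourhood of \<open>p\<close>; any local orthonormal frame agrees near \<open>p\<close> with such a family.
  The codifferentials do not depend on the frame.\<close>

definition local_orthonormal_frame ::
  "('a::topological_space, 'e::euclidean_space) chart set \<Rightarrow> ('a \<Rightarrow> 'a tvec \<Rightarrow> 'a tvec \<Rightarrow> real) \<Rightarrow>
   'a \<Rightarrow> (nat \<Rightarrow> 'a vfield) \<Rightarrow> bool" where
  "local_orthonormal_frame A g p E \<longleftrightarrow> (\<forall>i<DIM('e). E i \<in> vfields A) \<and>
     (\<exists>W. open W \<and> p \<in> W \<and>
        (\<forall>q\<in>W. \<forall>i<DIM('e). \<forall>j<DIM('e). g q (E i q) (E j q) = (if i = j then 1 else 0)))"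

definition some_frame ::
  "('a::topological_space, 'e::euclidean_space) chart set \<Rightarrow> ('a \<Rightarrow> 'a tvec \<Rightarrow> 'a tvec \<Rightarrow> real) \<Rightarrow>
   'a \<Rightarrow> nat \<Rightarrow> 'a vfield" where
  "some_frame A g p = (SOME E. local_orthonormal_frame A g p E)"

definition codiff1 ::
  "('a::topological_space, 'e::euclidean_space) chart set \<Rightarrow> ('a \<Rightarrow> 'a tvec \<Rightarrow> 'a tvec \<Rightarrow> real) \<Rightarrow>
   ('a vfield \<Rightarrow> 'a vfield \<Rightarrow> 'a vfield) \<Rightarrow> ('a \<Rightarrow> 'a tvec \<Rightarrow> real) \<Rightarrow> 'a \<Rightarrow> real" where
  "codiff1 A g D \<eta> p =
     - (\<Sum>i<DIM('e). cov_form1 D \<eta> (some_frame A g p i) (some_frame A g p i) p)"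

definition codiff2 ::
  "('a::topological_space, 'e::euclidean_space) chart set \<Rightarrow> ('a \<Rightarrow> 'a tvec \<Rightarrow> 'a tvec \<Rightarrow> real) \<Rightarrow>
   ('a vfield \<Rightarrow> 'a vfield \<Rightarrow> 'a vfield) \<Rightarrow> ('a \<Rightarrow> 'a tvec \<Rightarrow> 'a tvec \<Rightarrow> real) \<Rightarrow>
   'a vfield \<Rightarrow> 'a \<Rightarrow> real" where
  "codiff2 A g D \<beta> X p =
     - (\<Sum>i<DIM('e). cov_form2 D \<beta> (some_frame A g p i) (some_frame A g p i) X p)"


section \<open>Almost contact metric and almost Hermitian manifolds\<close>

definition almost_contact_metric ::
  "('a::{t2_space,second_countable_topology}, 'e::euclidean_space) chart set \<Rightarrow>
   ('a \<Rightarrow> 'a tvec \<Rightarrow> 'a tvec) \<Rightarrow> 'a vfield \<Rightarrow> ('a \<Rightarrow> 'a tvec \<Rightarrow> real) \<Rightarrow>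
   ('a \<Rightarrow> 'a tvec \<Rightarrow> 'a tvec \<Rightarrow> real) \<Rightarrow> bool" where
  "almost_contact_metric A \<phi> \<xi> \<eta> g \<longleftrightarrow>
     smooth_manifold A \<and> odd DIM('e) \<and> riemannian_metric A g \<and>
     endo_field A \<phi> \<and> \<xi> \<in> vfields A \<and> one_form A \<eta> \<and>
     (\<forall>p. \<forall>x\<in>tangent_space A p. \<phi> p (\<phi> p x) = - x + \<eta> p x *\<^sub>R \<xi> p) \<and>
     (\<forall>p. \<eta> p (\<xi> p) = 1) \<and>
     (\<forall>p. \<forall>x\<in>tangent_space A p. \<forall>y\<in>tangent_space A p.
        g p (\<phi> p x) (\<phi> p y) = g p x y - \<eta> p x * \<eta> p y)"

definition almost_hermitian ::
  "('b::{t2_space,second_countable_topology}, 'f::euclidean_space) chart set \<Rightarrow>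
   ('b \<Rightarrow> 'b tvec \<Rightarrow> 'b tvec) \<Rightarrow> ('b \<Rightarrow> 'b tvec \<Rightarrow> 'b tvec \<Rightarrow> real) \<Rightarrow> bool" where
  "almost_hermitian A' J g' \<longleftrightarrow>
     smooth_manifold A' \<and> riemannian_metric A' g' \<and> endo_field A' J \<and>
     (\<forall>p. \<forall>x\<in>tangent_space A' p. J p (J p x) = - x) \<and>
     (\<forall>p. \<forall>x\<in>tangent_space A' p. \<forall>y\<in>tangent_space A' p. g' p (J p x) (J p y) = g' p x y)"

definition fundamental_form ::
  "('a \<Rightarrow> 'a tvec \<Rightarrow> 'a tvec \<Rightarrow> real) \<Rightarrow> ('a \<Rightarrow> 'a tvec \<Rightarrow> 'a tvec) \<Rightarrow>
   'a \<Rightarrow> 'a tvec \<Rightarrow> 'a tvec \<Rightarrow> real" where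
  "fundamental_form g \<phi> p x y = g p x (\<phi> p y)"

definition nijenhuis ::
  "('a \<Rightarrow> 'a tvec \<Rightarrow> 'a tvec) \<Rightarrow> 'a vfield \<Rightarrow> 'a vfield \<Rightarrow> 'a vfield" where
  "nijenhuis \<phi> X Y =
     app \<phi> (app \<phi> (bracket X Y)) + bracket (app \<phi> X) (app \<phi> Y)
     - app \<phi> (bracket X (app \<phi> Y)) - app \<phi> (bracket (app \<phi> X) Y)"

text \<open>The Lee form of an almost contact metric manifold of dimension \<open>2 * m + 1\<close> with \<open>m \<ge> 2\<close>, by its
  values on vector fields.\<close>

definition lee_form ::
  "nat \<Rightarrow> ('a::topological_space, 'e::euclidean_space) chart set \<Rightarrow>
   ('a \<Rightarrow> 'a tvec \<Rightarrow> 'a tvec) \<Rightarrow> 'a vfield \<Rightarrow> ('a \<Rightarrow> 'a tvec \<Rightarrow> real) \<Rightarrow>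
   ('a \<Rightarrow> 'a tvec \<Rightarrow> 'a tvec \<Rightarrow> real) \<Rightarrow> ('a vfield \<Rightarrow> 'a vfield \<Rightarrow> 'a vfield) \<Rightarrow>
   'a vfield \<Rightarrow> 'a \<Rightarrow> real" where
  "lee_form m A \<phi> \<xi> \<eta> g D X p =
     - (1 / (2 * (real m - 1))) *
         (codiff2 A g D (fundamental_form g \<phi>) (app \<phi> X) p + cov_form1 D \<eta> \<xi> X p)
     + codiff1 A g D \<eta> p / (2 * real m) * \<eta> p (X p)"

definition metric_dual ::
  "('a, 'e::euclidean_space) chart set \<Rightarrow> ('a \<Rightarrow> 'a tvec \<Rightarrow> 'a tvec \<Rightarrow> real) \<Rightarrow>
   ('a vfield \<Rightarrow> 'a \<Rightarrow> real) \<Rightarrow> 'a vfield \<Rightarrow> bool" where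
  "metric_dual A g \<omega> B \<longleftrightarrow> B \<in> vfields A \<and> (\<forall>X\<in>vfields A. \<forall>p. g p (B p) (X p) = \<omega> X p)"


section \<open>Riemannian submersions\<close>

definition vert ::
  "('a, 'e::euclidean_space) chart set \<Rightarrow> ('b, 'f::euclidean_space) chart set \<Rightarrow> ('a \<Rightarrow> 'b) \<Rightarrow>
   'a \<Rightarrow> 'a tvec set" where
  "vert A A' \<pi> p = {x \<in> tangent_space A p. push A' \<pi> x = 0}"

definition horiz ::
  "('a, 'e::euclidean_space) chart set \<Rightarrow> ('b, 'f::euclidean_space) chart set \<Rightarrow>
   ('a \<Rightarrow> 'a tvec \<Rightarrow> 'a tvec \<Rightarrow> real) \<Rightarrow> ('a \<Rightarrow> 'b) \<Rightarrow> 'a \<Rightarrow> 'a tvec set" where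
  "horiz A A' g \<pi> p = {x \<in> tangent_space A p. \<forall>u\<in>vert A A' \<pi> p. g p x u = 0}"

definition vertical_fields ::
  "('a, 'e::euclidean_space) chart set \<Rightarrow> ('b, 'f::euclidean_space) chart set \<Rightarrow> ('a \<Rightarrow> 'b) \<Rightarrow>
   'a vfield set" where
  "vertical_fields A A' \<pi> = {U \<in> vfields A. \<forall>p. U p \<in> vert A A' \<pi> p}"

definition horizontal_fields ::
  "('a, 'e::euclidean_space) chart set \<Rightarrow> ('b, 'f::euclidean_space) chart set \<Rightarrow>
   ('a \<Rightarrow> 'a tvec \<Rightarrow> 'a tvec \<Rightarrow> real) \<Rightarrow> ('a \<Rightarrow> 'b) \<Rightarrow> 'a vfield set" where
  "horizontal_fields A A' g \<pi> = {X \<in> vfields A. \<forall>p. X p \<in> horiz A A' g \<pi> p}"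

definition vproj ::
  "('a, 'e::euclidean_space) chart set \<Rightarrow> ('b, 'f::euclidean_space) chart set \<Rightarrow>
   ('a \<Rightarrow> 'a tvec \<Rightarrow> 'a tvec \<Rightarrow> real) \<Rightarrow> ('a \<Rightarrow> 'b) \<Rightarrow> 'a vfield \<Rightarrow> 'a vfield" where
  "vproj A A' g \<pi> X = (\<lambda>p. THE u. u \<in> vert A A' \<pi> p \<and> X p - u \<in> horiz A A' g \<pi> p)"

definition hproj ::
  "('a, 'e::euclidean_space) chart set \<Rightarrow> ('b, 'f::euclidean_space) chart set \<Rightarrow>
   ('a \<Rightarrow> 'a tvec \<Rightarrow> 'a tvec \<Rightarrow> real) \<Rightarrow> ('a \<Rightarrow> 'b) \<Rightarrow> 'a vfield \<Rightarrow> 'a vfield" where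
  "hproj A A' g \<pi> X = (\<lambda>p. THE x. x \<in> horiz A A' g \<pi> p \<and> X p - x \<in> vert A A' \<pi> p)"

definition riemannian_submersion ::
  "('a::topological_space, 'e::euclidean_space) chart set \<Rightarrow>
   ('a \<Rightarrow> 'a tvec \<Rightarrow> 'a tvec \<Rightarrow> real) \<Rightarrow>
   ('b::topological_space, 'f::euclidean_space) chart set \<Rightarrow>
   ('b \<Rightarrow> 'b tvec \<Rightarrow> 'b tvec \<Rightarrow> real) \<Rightarrow> ('a \<Rightarrow> 'b) \<Rightarrow> bool" where
  "riemannian_submersion A g A' g' \<pi> \<longleftrightarrow>
     smooth_map A A' \<pi> \<and> surj \<pi> \<and>
     (\<forall>p. push A' \<pi> ` tangent_space A p = tangent_space A' (\<pi> p)) \<and>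
     (\<forall>p. \<forall>x\<in>horiz A A' g \<pi> p. \<forall>y\<in>horiz A A' g \<pi> p.
        g' (\<pi> p) (push A' \<pi> x) (push A' \<pi> y) = g p x y)"

definition contact_complex_submersion ::
  "('a::{t2_space,second_countable_topology}, 'e::euclidean_space) chart set \<Rightarrow>
   ('a \<Rightarrow> 'a tvec \<Rightarrow> 'a tvec) \<Rightarrow> 'a vfield \<Rightarrow> ('a \<Rightarrow> 'a tvec \<Rightarrow> real) \<Rightarrow>
   ('a \<Rightarrow> 'a tvec \<Rightarrow> 'a tvec \<Rightarrow> real) \<Rightarrow>
   ('b::{t2_space,second_countable_topology}, 'f::euclidean_space) chart set \<Rightarrow>
   ('b \<Rightarrow> 'b tvec \<Rightarrow> 'b tvec) \<Rightarrow> ('b \<Rightarrow> 'b tvec \<Rightarrow> 'b tvec \<Rightarrow> real) \<Rightarrow> ('a \<Rightarrow> 'b) \<Rightarrow> bool" where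
  "contact_complex_submersion A \<phi> \<xi> \<eta> g A' J g' \<pi> \<longleftrightarrow>
     almost_contact_metric A \<phi> \<xi> \<eta> g \<and> almost_hermitian A' J g' \<and>
     riemannian_submersion A g A' g' \<pi> \<and>
     (\<forall>p. \<forall>x\<in>tangent_space A p. J (\<pi> p) (push A' \<pi> x) = push A' \<pi> (\<phi> p x))"

definition oneill_T ::
  "('a, 'e::euclidean_space) chart set \<Rightarrow> ('b, 'f::euclidean_space) chart set \<Rightarrow>
   ('a \<Rightarrow> 'a tvec \<Rightarrow> 'a tvec \<Rightarrow> real) \<Rightarrow> ('a \<Rightarrow> 'b) \<Rightarrow>
   ('a vfield \<Rightarrow> 'a vfield \<Rightarrow> 'a vfield) \<Rightarrow> 'a vfield \<Rightarrow> 'a vfield \<Rightarrow> 'a vfield" where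
  "oneill_T A A' g \<pi> D E F =
     hproj A A' g \<pi> (D (vproj A A' g \<pi> E) (vproj A A' g \<pi> F)) +
     vproj A A' g \<pi> (D (vproj A A' g \<pi> E) (hproj A A' g \<pi> F))"

end

theory Submission
  imports Defs
begin

text \<open>
  Write \<open>\<Phi>\<close> for the fundamental form. All three identities are consequences of \<open>d\<Phi> = - 2 \<omega> \<and> \<Phi>\<close> and of the
  geometry of the fibres. Each side of the first two is vertical and each side of the third is
  horizontal, so they may be tested against vertical, respectively horizontal, vectors.

  For \<open>X\<close> horizontal and \<open>U\<close>, \<open>V\<close> vertical, \<open>S(U, V) = - g(X, \<nabla>\<^sub>V U)\<close> is the second fundamental form
  of the fibres in direction \<open>X\<close>; it is symmetric because the vertical distribution is integrable. As
  \<open>\<nabla>\<close> is torsion free, \<open>d\<Phi>(X, U, V)\<close> is the cyclic sum of the values of \<open>\<nabla>\<phi>\<close>, and this sum equals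
  \<open>g(U, (\<nabla>\<^sub>X \<phi>) V) + S(U, \<phi>V) - S(\<phi>U, V)\<close>, whereas the hypothesis evaluates it to
  \<open>- 2 \<omega>(X) g(U, \<phi>V)\<close> (\<open>ext_deriv_adapted\<close>).

  The right-hand side is unchanged when \<open>U\<close>, \<open>V\<close> are replaced by \<open>\<phi>U\<close>, \<open>\<phi>V\<close>. Together with
  \<open>\<phi>\<^sup>2 = - I + \<eta> \<otimes> \<xi>\<close> this determines \<open>g(U, (\<nabla>\<^sub>X \<phi>) V)\<close> in terms of \<open>S\<close> with one argument \<open>\<xi>\<close>, that
  is, of \<open>T\<^sub>\<xi> X\<close> (\<open>cov_endo_Hor_Ver\<close>). This is the first identity. Inserted in the formula above it
  gives \<open>S(U, \<phi>V) - S(\<phi>U, V)\<close>, which is the third identity paired with \<open>X\<close> (\<open>D_app_swap\<close>). The second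
  one follows by expanding the brackets in \<open>N\<^sub>\<phi>(X, \<phi>U)\<close> with these two results (\<open>g_nijenhuis\<close>).

  That \<open>N\<^sub>\<phi>(X, \<phi>U)\<close> is vertical is a statement about the submersion: the Lie derivative of \<open>\<phi>\<close> along
  a vertical field projects to zero, because \<open>\<phi>\<close> projects to \<open>J\<close> (\<open>phi_bracket_Ver\<close>). This and the
  symmetry of \<open>S\<close> at a single point are computed in local coordinates of the base. Tangent vectors
  being derivations, this requires that derivations are combinations of partial derivatives
  (\<open>local_frame\<close>), hence plateau functions and Hadamard's lemma. The same fact makes tangent spaces
  finite-dimensional, so that the vertical and horizontal projections exist (\<open>orth_proj\<close>).
\<close>

section \<open>Calculus of smooth functions\<close>

lemma Ck_on_imp_continuous_on: "Ck_on k S f \<Longrightarrow> continuous_on S f"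
  by (cases k) (auto simp: continuous_at_imp_continuous_on differentiable_imp_continuous_within)

lemma Ck_on_SucD: "Ck_on (Suc k) S f \<Longrightarrow> Ck_on k S f"
proof (induction k arbitrary: f)
  case 0
  then show ?case using Ck_on_imp_continuous_on by (metis Ck_on.simps(1))
next
  case (Suc k)
  have "Ck_on (Suc k) S (\<lambda>x. frechet_derivative f (at x) v)" for v
    using Suc.prems by (subst (asm) Ck_on.simps(2)) blast
  then have "Ck_on k S (\<lambda>x. frechet_derivative f (at x) v)" for v by (rule Suc.IH)
  then show ?case using Suc.prems by simp
qed

lemma Ck_on_subset: "Ck_on k S f \<Longrightarrow> T \<subseteq> S \<Longrightarrow> Ck_on k T f"
  by (induction k arbitrary: f) (auto intro: continuous_on_subset)

text \<open>The derivatives in \<open>Ck_on\<close> are taken at points of the whole space, so a function may be replaced by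
  another one that agrees with it only on an open set.\<close>

lemma frechet_derivative_cong_open:
  assumes "open S" "x \<in> S" "\<And>y. y \<in> S \<Longrightarrow> f y = g y" "f differentiable (at x)"
  shows "g differentiable (at x)" "frechet_derivative g (at x) = frechet_derivative f (at x)"
proof -
  have "(f has_derivative frechet_derivative f (at x)) (at x)"
    using assms(4) frechet_derivative_works by blast
  then have *: "(g has_derivative frechet_derivative f (at x)) (at x)"
    by (rule has_derivative_transform_within_open[OF _ assms(1,2,3)])
  then show "g differentiable (at x)" by (auto simp: differentiable_def)
  show "frechet_derivative g (at x) = frechet_derivative f (at x)"
    using frechet_derivative_at[OF *] by simp
qed

lemma Ck_on_cong:
  assumes "open S" "\<And>x. x \<in> S \<Longrightarrow> f x = g x" "Ck_on k S f"
  shows "Ck_on k S g"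
  using assms(2,3)
proof (induction k arbitrary: f g)
  case 0
  then show ?case by (simp cong: continuous_on_cong)
next
  case (Suc k)
  have d: "f differentiable (at x)" if "x \<in> S" for x using Suc.prems(2) that by simp
  note c = frechet_derivative_cong_open[OF assms(1) _ Suc.prems(1) d]
  have "Ck_on k S (\<lambda>x. frechet_derivative g (at x) v)" for v
    by (rule Suc.IH[of "\<lambda>x. frechet_derivative f (at x) v"]) (use c(2) Suc.prems(2) in auto)
  then show ?case using c(1) by auto
qed

lemma Ck_on_local:
  assumes "\<And>x. x \<in> S \<Longrightarrow> \<exists>T. open T \<and> x \<in> T \<and> Ck_on k T f"
  shows "Ck_on k S f"
  using assms
proof (induction k arbitrary: f)
  case 0
  have "isCont f x" if x: "x \<in> S" for x
    using 0[OF x] by (auto simp: continuous_on_eq_continuous_at)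
  then show ?case by (simp add: continuous_at_imp_continuous_on)
next
  case (Suc k)
  have "f differentiable (at x)" if "x \<in> S" for x using Suc.prems[OF that] by auto
  moreover have "Ck_on k S (\<lambda>x. frechet_derivative f (at x) v)" for v
  proof (rule Suc.IH)
    fix x assume "x \<in> S"
    then obtain T where "open T" "x \<in> T" "Ck_on (Suc k) T f" using Suc.prems by blast
    then show "\<exists>T. open T \<and> x \<in> T \<and> Ck_on k T (\<lambda>x. frechet_derivative f (at x) v)" by auto
  qed
  ultimately show ?case by simp
qed

lemma Ck_on_SucI:
  assumes "open S" "\<And>x. x \<in> S \<Longrightarrow> (f has_derivative f' x) (at x)"
    and "\<And>v. Ck_on k S (\<lambda>x. f' x v)"
  shows "Ck_on (Suc k) S f"
proof -
  have "frechet_derivative f (at x) = f' x" if "x \<in> S" for x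
    using frechet_derivative_at[OF assms(2)[OF that]] by simp
  then have "Ck_on k S (\<lambda>x. frechet_derivative f (at x) v)" for v
    using Ck_on_cong[OF assms(1) _ assms(3)[of v]] by simp
  then show ?thesis using assms(2) by (auto simp: differentiable_def)
qed

lemma Ck_on_SucE:
  assumes "Ck_on (Suc k) S f" "x \<in> S"
  shows "(f has_derivative frechet_derivative f (at x)) (at x)"
  using assms frechet_derivative_works by auto

lemma Ck_on_const: "open S \<Longrightarrow> Ck_on k S (\<lambda>x. c)"
  by (induction k arbitrary: c) (auto intro: Ck_on_SucI[where f' = "\<lambda>_ _. 0"])

lemma Ck_on_bounded_linear:
  assumes "open S" "bounded_linear L" shows "Ck_on k S L"
proof (cases k)
  case 0
  then show ?thesis using assms(2) by (simp add: linear_continuous_on)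
next
  case (Suc j)
  have "Ck_on (Suc j) S L"
    by (rule Ck_on_SucI[where f' = "\<lambda>_. L"])
      (use assms in \<open>auto intro: bounded_linear_imp_has_derivative Ck_on_const\<close>)
  then show ?thesis using Suc by simp
qed

lemma Ck_on_linear_comp:
  assumes "open S" "bounded_linear L" "Ck_on k S f"
  shows "Ck_on k S (\<lambda>x. L (f x))"
  using assms(3)
proof (induction k arbitrary: f)
  case 0
  then show ?case using assms(2) by (auto intro: bounded_linear.continuous_on)
next
  case (Suc k)
  show ?case
  proof (rule Ck_on_SucI[OF assms(1)])
    show "((\<lambda>x. L (f x)) has_derivative (\<lambda>v. L (frechet_derivative f (at x) v))) (at x)"
      if "x \<in> S" for x
      using bounded_linear.has_derivative[OF assms(2) Ck_on_SucE[OF Suc.prems that]] .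
    show "Ck_on k S (\<lambda>x. L (frechet_derivative f (at x) v))" for v
      using Suc by auto
  qed
qed

lemma Ck_on_add:
  assumes "open S" "Ck_on k S f" "Ck_on k S g"
  shows "Ck_on k S (\<lambda>x. f x + g x)"
  using assms(2,3)
proof (induction k arbitrary: f g)
  case 0
  then show ?case by (auto intro: continuous_on_add)
next
  case (Suc k)
  show ?case
    by (rule Ck_on_SucI[OF assms(1) has_derivative_add[OF Ck_on_SucE[OF Suc.prems(1)] Ck_on_SucE[OF Suc.prems(2)]]])
       (use Suc in auto)
qed

lemma Ck_on_mult:
  fixes f g :: "_ \<Rightarrow> real"
  assumes "open S" "Ck_on k S f" "Ck_on k S g"
  shows "Ck_on k S (\<lambda>x. f x * g x)"
  using assms(2,3)
proof (induction k arbitrary: f g)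
  case 0
  then show ?case by (auto intro: continuous_on_mult)
next
  case (Suc k)
  have fg: "Ck_on k S f" "Ck_on k S g" using Suc.prems Ck_on_SucD by blast+
  show ?case
    by (rule Ck_on_SucI[OF assms(1) has_derivative_mult[OF Ck_on_SucE[OF Suc.prems(1)] Ck_on_SucE[OF Suc.prems(2)]]])
       (use Suc fg in \<open>auto intro!: Ck_on_add[OF assms(1)]\<close>)
qed

lemma Ck_on_sum:
  assumes "open S" "\<And>i. i \<in> I \<Longrightarrow> Ck_on k S (f i)"
  shows "Ck_on k S (\<lambda>x. \<Sum>i\<in>I. f i x)"
proof (cases "finite I")
  case True
  then show ?thesis
    using assms(2) by induction (auto intro: Ck_on_const Ck_on_add assms(1))
qed (use assms(1) in \<open>simp add: Ck_on_const\<close>)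

text \<open>The chain rule is written in coordinates, \<open>D(f \<circ> g) v = \<Sum>b. (Dg v \<bullet> b) (\<partial>\<^sub>b f \<circ> g)\<close>: each
  \<open>\<partial>\<^sub>b f \<circ> g\<close> is again a composition, to which the induction hypothesis applies.\<close>

lemma Ck_on_compose:
  fixes f :: "'f::euclidean_space \<Rightarrow> real"
  assumes "open S" "open T" "g ` S \<subseteq> T" "Ck_on k T f" "Ck_on k S g"
  shows "Ck_on k S (\<lambda>x. f (g x))"
  using assms(4,5)
proof (induction k arbitrary: f)
  case 0
  then show ?case using assms(3) continuous_on_compose2 by auto
next
  case (Suc k)
  let ?f' = "\<lambda>y. frechet_derivative f (at y)" and ?g' = "\<lambda>x. frechet_derivative g (at x)"
  have gS: "g x \<in> T" if "x \<in> S" for x using assms(3) that by blast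
  have f': "(f has_derivative ?f' (g x)) (at (g x))" if "x \<in> S" for x
    using Ck_on_SucE[OF Suc.prems(1) gS[OF that]] .
  have "?f' (g x) (?g' x v) = (\<Sum>b\<in>Basis. (?g' x v \<bullet> b) * ?f' (g x) b)" if "x \<in> S" for x v
  proof -
    interpret F: bounded_linear "?f' (g x)" using f'[OF that] has_derivative_bounded_linear by blast
    have "?f' (g x) (\<Sum>b\<in>Basis. (?g' x v \<bullet> b) *\<^sub>R b) = (\<Sum>b\<in>Basis. (?g' x v \<bullet> b) * ?f' (g x) b)"
      by (simp add: F.sum F.scaleR)
    then show ?thesis by (simp add: euclidean_representation)
  qed
  moreover have "Ck_on k S (\<lambda>x. \<Sum>b\<in>Basis. (?g' x v \<bullet> b) * ?f' (g x) b)" for v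
  proof (intro Ck_on_sum Ck_on_mult assms(1))
    show "Ck_on k S (\<lambda>x. ?g' x v \<bullet> b)" for b
      by (rule Ck_on_linear_comp[OF assms(1) bounded_linear_inner_left]) (use Suc.prems(2) in simp)
    show "Ck_on k S (\<lambda>x. ?f' (g x) b)" for b
      by (rule Suc.IH) (use Suc.prems Ck_on_SucD in auto)
  qed
  ultimately have "Ck_on k S (\<lambda>x. ?f' (g x) (?g' x v))" for v
    using Ck_on_cong[OF assms(1), of "\<lambda>x. \<Sum>b\<in>Basis. (?g' x v \<bullet> b) * ?f' (g x) b"
        "\<lambda>x. ?f' (g x) (?g' x v)" k] by simp
  moreover have "((\<lambda>x. f (g x)) has_derivative (\<lambda>v. ?f' (g x) (?g' x v))) (at x)" if "x \<in> S" for x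
    using has_derivative_compose[OF Ck_on_SucE[OF Suc.prems(2) that] f'[OF that]] .
  ultimately show ?case
    by (intro Ck_on_SucI[OF assms(1), where f' = "\<lambda>x v. ?f' (g x) (?g' x v)"]) auto
qed

lemma smooth_on_imp_continuous_on: "smooth_on S f \<Longrightarrow> continuous_on S f"
  using Ck_on_imp_continuous_on by (auto simp: smooth_on_def)

lemma smooth_on_subset: "smooth_on S f \<Longrightarrow> T \<subseteq> S \<Longrightarrow> smooth_on T f"
  unfolding smooth_on_def using Ck_on_subset by blast

lemma smooth_on_cong: "open S \<Longrightarrow> (\<And>x. x \<in> S \<Longrightarrow> f x = g x) \<Longrightarrow> smooth_on S f \<Longrightarrow> smooth_on S g"
  unfolding smooth_on_def using Ck_on_cong by blast

lemma smooth_on_local: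
  assumes "\<And>x. x \<in> S \<Longrightarrow> \<exists>T. open T \<and> x \<in> T \<and> smooth_on T f"
  shows "smooth_on S f"
  unfolding smooth_on_def
proof (intro allI Ck_on_local)
  show "\<exists>T. open T \<and> x \<in> T \<and> Ck_on k T f" if "x \<in> S" for x k
    using assms[OF that] by (auto simp: smooth_on_def)
qed

lemma smooth_on_const: "open S \<Longrightarrow> smooth_on S (\<lambda>x. c)"
  by (simp add: smooth_on_def Ck_on_const)

lemma smooth_on_bounded_linear: "open S \<Longrightarrow> bounded_linear L \<Longrightarrow> smooth_on S L"
  by (simp add: smooth_on_def Ck_on_bounded_linear)

lemma smooth_on_add:
  "open S \<Longrightarrow> smooth_on S f \<Longrightarrow> smooth_on S g \<Longrightarrow> smooth_on S (\<lambda>x. f x + g x)"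
  by (simp add: smooth_on_def Ck_on_add)

lemma smooth_on_mult:
  fixes f g :: "_ \<Rightarrow> real"
  shows "open S \<Longrightarrow> smooth_on S f \<Longrightarrow> smooth_on S g \<Longrightarrow> smooth_on S (\<lambda>x. f x * g x)"
  by (simp add: smooth_on_def Ck_on_mult)

lemma smooth_on_sum:
  "open S \<Longrightarrow> (\<And>i. i \<in> I \<Longrightarrow> smooth_on S (f i)) \<Longrightarrow> smooth_on S (\<lambda>x. \<Sum>i\<in>I. f i x)"
  by (simp add: smooth_on_def Ck_on_sum)

lemma smooth_on_compose:
  fixes f :: "'f::euclidean_space \<Rightarrow> real"
  assumes "open S" "open T" "g ` S \<subseteq> T" "smooth_on T f" "smooth_on S g"
  shows "smooth_on S (\<lambda>x. f (g x))"
  unfolding smooth_on_def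
  using assms(4,5) by (auto simp: smooth_on_def intro: Ck_on_compose[OF assms(1-3)])

lemma smooth_on_derivative:
  assumes "smooth_on S f" shows "smooth_on S (\<lambda>x. frechet_derivative f (at x) v)"
  unfolding smooth_on_def
proof
  show "Ck_on k S (\<lambda>x. frechet_derivative f (at x) v)" for k
    using assms[unfolded smooth_on_def, rule_format, of "Suc k"] by simp
qed

lemma smooth_on_has_derivative:
  assumes "smooth_on S f" "x \<in> S"
  shows "(f has_derivative frechet_derivative f (at x)) (at x)"
  using Ck_on_SucE[OF assms(1)[unfolded smooth_on_def, rule_format] assms(2)] .

section \<open>Plateau functions\<close>

text \<open>The derivative of a member of this family is a combination of two members, so that the smoothness
  at \<open>0\<close> of \<open>exp (- 1 / t)\<close> becomes an induction over the order of differentiability.\<close>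

definition flat_exp :: "nat \<Rightarrow> real \<Rightarrow> real" where
  "flat_exp k t = (if t > 0 then inverse t ^ k * exp (- inverse t) else 0)"

text \<open>With \<open>s = 1 / t\<close>, a single term of the exponential series gives \<open>s ^ (k + 2) \<le> (k + 2)! exp s\<close>. The
  quadratic decay makes the difference quotients at \<open>0\<close> tend to \<open>0\<close>.\<close>

lemma flat_exp_bound:
  assumes "t > 0" shows "flat_exp k t \<le> fact (k + 2) * t\<^sup>2"
proof -
  define s where "s = inverse t"
  have s: "s > 0" "t = inverse s" using assms by (auto simp: s_def)
  have "s ^ (k + 2) / fact (k + 2) \<le> exp s"
    using sum_le_suminf[OF summable_exp_generic[of s], of "{k+2}"] s(1)
    unfolding exp_def by (simp add: divide_inverse mult.commute del: fact_Suc)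
  then have "s ^ (k + 2) \<le> fact (k + 2) * exp s"
    by (subst (asm) pos_divide_le_eq) (simp_all add: mult.commute del: fact_Suc)
  then have "s ^ (k + 2) * (t\<^sup>2 * exp (- s)) \<le> fact (k + 2) * exp s * (t\<^sup>2 * exp (- s))"
    by (rule mult_right_mono) simp
  also have "s ^ (k + 2) * (t\<^sup>2 * exp (- s)) = s ^ k * exp (- s)"
    using s(1) unfolding s(2) by (simp add: power_add power2_eq_square field_simps)
  also have "fact (k + 2) * exp s * (t\<^sup>2 * exp (- s)) = fact (k + 2) * t\<^sup>2"
    by (simp add: exp_minus)
  finally have "s ^ k * exp (- s) \<le> fact (k + 2) * t\<^sup>2" .
  then show ?thesis using assms by (simp add: flat_exp_def s_def)
qed

lemma flat_exp_nonneg: "flat_exp k t \<ge> 0"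
  by (simp add: flat_exp_def)

lemma flat_exp_has_derivative:
  "(flat_exp k has_real_derivative (flat_exp (k + 2) t - k * flat_exp (k + 1) t)) (at t)"
proof -
  consider "t > 0" | "t < 0" | "t = 0" by linarith
  then show ?thesis
  proof cases
    case 1
    have "((\<lambda>t. inverse t ^ k * exp (- inverse t)) has_real_derivative
        (k * inverse t ^ (k - 1) * - (inverse t)\<^sup>2) * exp (- inverse t)
          + inverse t ^ k * (exp (- inverse t) * (inverse t)\<^sup>2)) (at t)"
      using 1 by (auto intro!: derivative_eq_intros simp: power2_eq_square)
    also have "(k * inverse t ^ (k - 1) * - (inverse t)\<^sup>2) * exp (- inverse t)
          + inverse t ^ k * (exp (- inverse t) * (inverse t)\<^sup>2)
        = flat_exp (k + 2) t - k * flat_exp (k + 1) t"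
      using 1 by (cases k) (simp_all add: flat_exp_def power2_eq_square)
    finally have "((\<lambda>t. inverse t ^ k * exp (- inverse t)) has_real_derivative
        (flat_exp (k + 2) t - k * flat_exp (k + 1) t)) (at t)" .
    then show ?thesis
      by (rule has_field_derivative_transform_within_open[where S = "{0<..}"])
        (use 1 in \<open>auto simp: flat_exp_def\<close>)
  next
    case 2
    have "((\<lambda>t. 0) has_real_derivative 0) (at t)" by simp
    then have "(flat_exp k has_real_derivative 0) (at t)"
      by (rule has_field_derivative_transform_within_open[where S = "{..<0}"])
        (use 2 in \<open>auto simp: flat_exp_def\<close>)
    then show ?thesis using 2 by (simp add: flat_exp_def)
  next
    case 3
    have "\<bar>flat_exp k t / t\<bar> \<le> fact (k + 2) * \<bar>t\<bar>" for t
    proof (cases "t > 0")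
      case True
      then have "flat_exp k t / t \<le> fact (k + 2) * t"
        using flat_exp_bound[OF True, of k]
        by (simp add: pos_divide_le_eq power2_eq_square mult.assoc del: fact_Suc)
      then show ?thesis using True flat_exp_nonneg[of k t] by (simp del: fact_Suc)
    next
      case False
      then have "flat_exp k t = 0" by (simp add: flat_exp_def)
      moreover have "0 \<le> fact (k + 2) * \<bar>t\<bar>" by (intro mult_nonneg_nonneg) auto
      ultimately show ?thesis by (simp only: div_0 abs_zero)
    qed
    then have "\<forall>\<^sub>F t in at 0. norm (flat_exp k t / t) \<le> fact (k + 2) * \<bar>t\<bar>"
      by (simp only: real_norm_def eventually_True)
    moreover have "((\<lambda>t::real. fact (k + 2) * \<bar>t\<bar>) \<longlongrightarrow> fact (k + 2) * \<bar>0\<bar>) (at 0)"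
      by (intro tendsto_intros)
    then have "((\<lambda>t::real. fact (k + 2) * \<bar>t\<bar>) \<longlongrightarrow> 0) (at 0)"
      by (simp only: abs_zero mult_zero_right)
    ultimately have "((\<lambda>t. flat_exp k t / t) \<longlongrightarrow> 0) (at 0)"
      by (rule Lim_null_comparison)
    then have "(flat_exp k has_real_derivative 0) (at 0)"
      by (simp add: has_field_derivative_iff flat_exp_def)
    then show ?thesis using 3 by (simp add: flat_exp_def)
  qed
qed

lemma smooth_on_flat_exp: "smooth_on UNIV (flat_exp k)"
  unfolding smooth_on_def
proof
  fix n
  show "Ck_on n UNIV (flat_exp k)"
  proof (induction n arbitrary: k)
    case 0
    have "isCont (flat_exp k) t" for t
      using DERIV_isCont[OF flat_exp_has_derivative] .
    then show ?case by (simp add: continuous_on_eq_continuous_within)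
  next
    case (Suc n)
    show ?case
    proof (rule Ck_on_SucI[where f' = "\<lambda>t v. (flat_exp (k + 2) t - k * flat_exp (k + 1) t) * v"])
      show "(flat_exp k has_derivative (*) (flat_exp (k + 2) t - k * flat_exp (k + 1) t)) (at t)" for t
        using flat_exp_has_derivative by (rule has_field_derivative_imp_has_derivative)
      have "Ck_on n UNIV (\<lambda>t. v * flat_exp (k + 2) t + (- v * k) * flat_exp (k + 1) t)" for v
        by (intro Ck_on_add Ck_on_mult Ck_on_const Suc open_UNIV)
      then show "Ck_on n UNIV (\<lambda>t. (flat_exp (k + 2) t - k * flat_exp (k + 1) t) * v)" for v
        by (simp add: algebra_simps)
    qed simp
  qed
qed

text \<open>As \<open>flat_exp 0\<close> vanishes for \<open>s \<le> 0\<close> and is at least \<open>c = flat_exp 0 1\<close> for \<open>s \<ge> 1\<close>, the function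
  \<open>flat_exp 0 (c - flat_exp 0 s)\<close> of \<open>s\<close> is a positive constant for \<open>s \<le> 0\<close> and zero for \<open>s \<ge> 1\<close>. This
  gives an exactly constant plateau without integrals or quotients. Here \<open>s = |x - a|\<^sup>2 / r\<^sup>2 - 1\<close>.\<close>

lemma exists_plateau:
  fixes a :: "'e::euclidean_space"
  assumes "r > 0"
  shows "\<exists>\<rho>::'e \<Rightarrow> real. smooth_on UNIV \<rho> \<and> (\<forall>x\<in>ball a r. \<rho> x = 1) \<and> (\<forall>x. x \<notin> ball a (2 * r) \<longrightarrow> \<rho> x = 0)"
proof -
  let ?f = "flat_exp 0"
  define s where "s x = (1 / r\<^sup>2) * ((x - a) \<bullet> (x - a)) + - 1" for x :: 'e
  define c where "c = exp (- 1 :: real)"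
  define \<rho> where "\<rho> x = (1 / ?f c) * ?f (c + (- 1) * ?f (s x))" for x
  have c: "c > 0" "?f c > 0" "?f 1 = c" by (simp_all add: c_def flat_exp_def)
  have *: "smooth_on UNIV (\<lambda>x::'e. (x - a) \<bullet> b)" for b
    using smooth_on_add[OF open_UNIV smooth_on_bounded_linear[OF open_UNIV bounded_linear_inner_left[of b]]
      smooth_on_const[OF open_UNIV, of "- (a \<bullet> b)"]] by (simp add: inner_diff_left)
  have "smooth_on UNIV (\<lambda>x::'e. \<Sum>b\<in>Basis. ((x - a) \<bullet> b) * ((x - a) \<bullet> b))"
    by (rule smooth_on_sum[OF open_UNIV smooth_on_mult[OF open_UNIV * *]])
  then have "smooth_on UNIV (\<lambda>x::'e. (x - a) \<bullet> (x - a))"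
    by (subst euclidean_inner)
  from smooth_on_add[OF open_UNIV smooth_on_mult[OF open_UNIV smooth_on_const[OF open_UNIV] this]
    smooth_on_const[OF open_UNIV]]
  have s: "smooth_on UNIV s" unfolding s_def .
  have flat: "smooth_on UNIV (\<lambda>x::'e. ?f (h x))" if "smooth_on UNIV h" for h
    by (rule smooth_on_compose[OF open_UNIV open_UNIV subset_UNIV smooth_on_flat_exp that])
  have "smooth_on UNIV \<rho>"
    unfolding \<rho>_def
    by (rule smooth_on_mult[OF open_UNIV smooth_on_const[OF open_UNIV]
        flat[OF smooth_on_add[OF open_UNIV smooth_on_const[OF open_UNIV]
          smooth_on_mult[OF open_UNIV smooth_on_const[OF open_UNIV] flat[OF s]]]]])
  moreover have "\<rho> x = 1" if "x \<in> ball a r" for x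
  proof -
    have "norm (x - a) \<le> r" using that by (simp add: dist_norm norm_minus_commute)
    then have "(norm (x - a))\<^sup>2 / r\<^sup>2 \<le> 1"
      using assms by (subst divide_le_eq_1_pos) (auto intro: power_mono)
    then have "s x \<le> 0" by (simp add: s_def dot_square_norm)
    then show ?thesis using c by (simp add: \<rho>_def) (simp add: flat_exp_def)
  qed
  moreover have "\<rho> x = 0" if "x \<notin> ball a (2 * r)" for x
  proof -
    have "(2 * r)\<^sup>2 \<le> (norm (x - a))\<^sup>2"
      using that assms by (intro power_mono) (auto simp: dist_norm norm_minus_commute)
    then have "4 * r\<^sup>2 \<le> (norm (x - a))\<^sup>2" by (simp add: power_mult_distrib)
    then have "2 * r\<^sup>2 \<le> (norm (x - a))\<^sup>2" using zero_le_power2[of r] by linarith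
    then have "2 \<le> (norm (x - a))\<^sup>2 / r\<^sup>2"
      using assms by (subst pos_le_divide_eq) auto
    then have "s x \<ge> 1" by (simp add: s_def dot_square_norm)
    then have "?f (s x) \<ge> c"
      using le_imp_inverse_le[of 1 "s x"] by (simp add: flat_exp_def c_def)
    then show ?thesis by (simp add: \<rho>_def flat_exp_def)
  qed
  ultimately show ?thesis by blast
qed

section \<open>Hadamard's lemma\<close>

text \<open>The remainder terms in Hadamard's lemma are the case \<open>j = 0\<close>. Differentiation under the integral
  sends the moment of order \<open>j\<close> of \<open>H\<close> to moments of order \<open>j + 1\<close> of derivatives of \<open>H\<close>; allowing all
  \<open>j\<close> makes their smoothness an induction.\<close>

definition ray_moment :: "'e::euclidean_space \<Rightarrow> nat \<Rightarrow> ('e \<Rightarrow> real) \<Rightarrow> 'e \<Rightarrow> real" where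
  "ray_moment a j H x = integral {0..1} (\<lambda>t. t ^ j * H (a + t *\<^sub>R (x - a)))"

lemma ray_in_ball:
  fixes a :: "'e::euclidean_space"
  assumes "x \<in> ball a r" "t \<in> {0..1}"
  shows "a + t *\<^sub>R (x - a) \<in> ball a r"
proof -
  have "t * norm (x - a) \<le> norm (x - a)" using assms(2) by (simp add: mult_left_le_one_le)
  then show ?thesis using assms by (simp add: dist_norm norm_minus_commute)
qed

lemma continuous_on_ray:
  fixes a :: "'e::euclidean_space"
  assumes "continuous_on (ball a r) H"
  shows "continuous_on (ball a r \<times> cbox 0 1) (\<lambda>(x, t::real). t ^ j * (H (a + t *\<^sub>R (x - a)) :: real))"
proof -
  have "continuous_on (ball a r \<times> cbox 0 1) (\<lambda>z. H (a + snd z *\<^sub>R (fst z - a)))"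
    by (rule continuous_on_compose2[OF assms])
      (use ray_in_ball[of _ a r] in \<open>auto intro!: continuous_intros simp del: mem_ball\<close>)
  then show ?thesis by (auto simp: split_beta intro!: continuous_intros)
qed

lemma ray_moment_has_derivative:
  fixes a :: "'e::euclidean_space"
  assumes H: "Ck_on 1 (ball a r) H" and x: "x \<in> ball a r"
  shows "(ray_moment a j H has_derivative
    (\<lambda>v. ray_moment a (Suc j) (\<lambda>y. frechet_derivative H (at y) v) x)) (at x)"
proof -
  let ?B = "ball a r"
  let ?D = "\<lambda>y. frechet_derivative H (at y)"
  let ?F = "\<lambda>x t. t ^ Suc j *\<^sub>R Blinfun (?D (a + t *\<^sub>R (x - a)))"
  have HD: "(H has_derivative ?D y) (at y)" if "y \<in> ?B" for y
    using H that Ck_on_SucE by (metis One_nat_def)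
  have bl: "bounded_linear (?D y)" if "y \<in> ?B" for y
    using HD[OF that] has_derivative_bounded_linear by blast
  have contD: "continuous_on ?B (\<lambda>y. ?D y v)" for v
    using H by simp
  have Fv: "blinfun_apply (?F x t) v = t ^ Suc j * ?D (a + t *\<^sub>R (x - a)) v"
    if "x \<in> ?B" "t \<in> cbox 0 1" for x t v
    using bounded_linear_Blinfun_apply[OF bl[OF ray_in_ball[OF that(1), of t]]] that(2)
    by (simp add: blinfun.scaleR_left)
  have contF: "continuous_on (?B \<times> cbox 0 1) (\<lambda>(x, t). ?F x t)"
  proof (rule continuous_on_blinfun_componentwise)
    fix i :: 'e
    have "continuous_on (?B \<times> cbox 0 1) (\<lambda>(x, t). t ^ Suc j * ?D (a + t *\<^sub>R (x - a)) i)"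
      by (rule continuous_on_ray[OF contD])
    then show "continuous_on (?B \<times> cbox 0 1) (\<lambda>z. blinfun_apply (case z of (x, t) \<Rightarrow> ?F x t) i)"
      by (rule continuous_on_eq) (use Fv in \<open>auto simp del: mem_ball\<close>)
  qed
  have int: "(\<lambda>t. t ^ j * H (a + t *\<^sub>R (y - a))) integrable_on cbox 0 1" if "y \<in> ?B" for y
  proof (rule integrable_continuous)
    have "continuous_on (cbox 0 1) (\<lambda>t::real. (y, t))" by (intro continuous_intros)
    moreover have "(\<lambda>t. (y, t)) ` cbox 0 1 \<subseteq> ?B \<times> cbox (0::real) 1"
      using that by (auto simp del: mem_ball)
    ultimately show "continuous_on (cbox 0 1) (\<lambda>t. t ^ j * H (a + t *\<^sub>R (y - a)))"
      using continuous_on_compose2[OF continuous_on_ray[OF Ck_on_imp_continuous_on[OF H], of j],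
          of "cbox 0 1" "\<lambda>t. (y, t)"] by simp
  qed
  have "((\<lambda>x. integral (cbox 0 1) (\<lambda>t. t ^ j * H (a + t *\<^sub>R (x - a)))) has_derivative
      blinfun_apply (integral (cbox 0 1) (?F x))) (at x within ?B)"
  proof (rule leibniz_rule[OF _ int contF x convex_ball])
    fix y and t :: real assume yt: "y \<in> ?B" "t \<in> cbox 0 1"
    let ?z = "a + t *\<^sub>R (y - a)"
    have z: "?z \<in> ?B" using ray_in_ball yt by auto
    have "((\<lambda>y. H (a + t *\<^sub>R (y - a))) has_derivative (\<lambda>v. ?D ?z (t *\<^sub>R v))) (at y within ?B)"
      by (rule has_derivative_compose[where g = H and f = "\<lambda>y. a + t *\<^sub>R (y - a)", OF _ HD[OF z]]) (auto intro!: derivative_eq_intros)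
    then have "((\<lambda>y. t ^ j * H (a + t *\<^sub>R (y - a))) has_derivative (\<lambda>v. t ^ j * ?D ?z (t *\<^sub>R v)))
        (at y within ?B)"
      by (rule has_derivative_mult_right)
    moreover have "blinfun_apply (?F y t) = (\<lambda>v. t ^ j * ?D ?z (t *\<^sub>R v))"
    proof
      show "blinfun_apply (?F y t) v = t ^ j * ?D ?z (t *\<^sub>R v)" for v
        unfolding Fv[OF yt] using linear_scale[OF bounded_linear.linear[OF bl[OF z]], of t v] by simp
    qed
    ultimately show "((\<lambda>y. t ^ j * H (a + t *\<^sub>R (y - a))) has_derivative blinfun_apply (?F y t)) (at y within ?B)"
      by (simp only:)
  qed
  moreover have "blinfun_apply (integral (cbox 0 1) (?F x)) v
      = ray_moment a (Suc j) (\<lambda>y. ?D y v) x" for v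
  proof -
    have "continuous_on (cbox 0 1) (\<lambda>t::real. (x, t))" by (intro continuous_intros)
    moreover have "(\<lambda>t. (x, t)) ` cbox 0 1 \<subseteq> ?B \<times> cbox (0::real) 1"
      using x by (auto simp del: mem_ball)
    ultimately have "continuous_on (cbox 0 1) (\<lambda>t. case (x, t) of (x, t) \<Rightarrow> ?F x t)"
      by (rule continuous_on_compose2[OF contF])
    then have "continuous_on (cbox 0 1) (?F x)" by (simp only: prod.case)
    then have "?F x integrable_on cbox 0 1" by (rule integrable_continuous)
    then have "blinfun_apply (integral (cbox 0 1) (?F x)) v = integral (cbox 0 1) (\<lambda>t. blinfun_apply (?F x t) v)"
      by (rule blinfun_apply_integral)
    also have "\<dots> = integral (cbox 0 1) (\<lambda>t. t ^ Suc j * ?D (a + t *\<^sub>R (x - a)) v)"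
      by (rule integral_cong) (use Fv x in auto)
    finally show ?thesis by (simp add: ray_moment_def)
  qed
  then have "blinfun_apply (integral (cbox 0 1) (?F x)) = (\<lambda>v. ray_moment a (Suc j) (\<lambda>y. ?D y v) x)"
    by (rule ext)
  moreover have "ray_moment a j H = (\<lambda>x. integral (cbox 0 1) (\<lambda>t. t ^ j * H (a + t *\<^sub>R (x - a))))"
    by (simp add: ray_moment_def fun_eq_iff)
  ultimately show ?thesis
    using at_within_open[OF x open_ball] by (simp only:)
qed

lemma Ck_on_ray_moment: "Ck_on k (ball a r) H \<Longrightarrow> Ck_on k (ball a r) (ray_moment a j H)"
proof (induction k arbitrary: j H)
  case 0
  then show ?case
    using integral_continuous_on_param[OF continuous_on_ray[of a r H j]]
    by (simp add: ray_moment_def[abs_def])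
next
  case (Suc k)
  have 1: "Ck_on 1 (ball a r) H"
    using Suc.prems by (auto intro: Ck_on_imp_continuous_on)
  show ?case
    by (rule Ck_on_SucI[OF open_ball ray_moment_has_derivative[OF 1]])
      (use Suc in auto)
qed

text \<open>The fundamental theorem of calculus along the segment from \<open>a\<close> to \<open>x\<close>, with the derivative of \<open>F\<close>
  in direction \<open>x - a\<close> expanded in coordinates. The point is that the factors \<open>G b\<close> are again smooth.\<close>

lemma hadamard:
  fixes F :: "'e::euclidean_space \<Rightarrow> real"
  assumes F: "smooth_on (ball a r) F"
  obtains G where "\<And>b. smooth_on (ball a r) (G b)"
    and "\<And>b. G b a = frechet_derivative F (at a) b"
    and "\<And>x. x \<in> ball a r \<Longrightarrow> F x = F a + (\<Sum>b\<in>Basis. ((x - a) \<bullet> b) * G b x)"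
proof
  let ?D = "\<lambda>y. frechet_derivative F (at y)"
  let ?G = "\<lambda>b. ray_moment a 0 (\<lambda>y. ?D y b)"
  show "smooth_on (ball a r) (?G b)" for b
    using smooth_on_derivative[OF F] by (simp add: smooth_on_def Ck_on_ray_moment)
  show "?G b a = ?D a b" for b by (simp add: ray_moment_def)
  fix x assume x: "x \<in> ball a r"
  have D: "(F has_derivative ?D y) (at y)" if "y \<in> ball a r" for y
    by (rule smooth_on_has_derivative[OF F that])
  let ?p = "\<lambda>t::real. a + t *\<^sub>R (x - a)"
  have "((\<lambda>t. F (?p t)) has_vector_derivative ?D (?p t) (x - a)) (at t within {0..1})"
    if t: "t \<in> {0..1}" for t
  proof -
    note d = D[OF ray_in_ball[OF x t]]
    have "((\<lambda>t. F (?p t)) has_derivative (\<lambda>s. ?D (?p t) (s *\<^sub>R (x - a)))) (at t within {0..1})"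
      by (rule has_derivative_compose[where g = F and f = ?p, OF _ d]) (auto intro!: derivative_eq_intros)
    then show ?thesis
      using linear_scale[OF has_derivative_linear[OF d]] by (simp add: has_vector_derivative_def)
  qed
  then have "((\<lambda>t. ?D (?p t) (x - a)) has_integral (F (?p 1) - F (?p 0))) {0..1}"
    by (intro fundamental_theorem_of_calculus) auto
  then have "F x - F a = integral {0..1} (\<lambda>t. ?D (?p t) (x - a))"
    by (simp add: integral_unique)
  also have "\<dots> = integral {0..1} (\<lambda>t. \<Sum>b\<in>Basis. ((x - a) \<bullet> b) * ?D (?p t) b)"
  proof (rule integral_cong)
    fix t :: real assume t: "t \<in> {0..1}"
    interpret L: linear "?D (?p t)" using has_derivative_linear[OF D[OF ray_in_ball[OF x t]]] .
    have "?D (?p t) (\<Sum>b\<in>Basis. ((x - a) \<bullet> b) *\<^sub>R b) = (\<Sum>b\<in>Basis. ((x - a) \<bullet> b) * ?D (?p t) b)"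
      by (simp add: L.sum L.scale)
    then show "?D (?p t) (x - a) = (\<Sum>b\<in>Basis. ((x - a) \<bullet> b) * ?D (?p t) b)"
      by (simp add: euclidean_representation)
  qed
  also have "\<dots> = (\<Sum>b\<in>Basis. integral {0..1} (\<lambda>t. ((x - a) \<bullet> b) * ?D (?p t) b))"
  proof (rule integral_sum)
    fix b :: 'e
    have "continuous_on (ball a r) (\<lambda>y. ?D y b)"
      using smooth_on_imp_continuous_on[OF smooth_on_derivative[OF F]] .
    then have "continuous_on {0..1} (\<lambda>t. ?D (?p t) b)"
      by (rule continuous_on_compose2) (use ray_in_ball[OF x] in \<open>auto intro!: continuous_intros\<close>)
    then show "(\<lambda>t. ((x - a) \<bullet> b) * ?D (?p t) b) integrable_on {0..1}"
      by (intro integrable_continuous_interval continuous_intros)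
  qed simp
  also have "\<dots> = (\<Sum>b\<in>Basis. ((x - a) \<bullet> b) * ?G b x)"
    by (simp add: ray_moment_def)
  finally show "F x = F a + (\<Sum>b\<in>Basis. ((x - a) \<bullet> b) * ?G b x)" by simp
qed

section \<open>Smooth functions and tangent vectors on a manifold\<close>

lemma sum_apply: "sum f I x = (\<Sum>i\<in>I. f i x)"
  by (induction I rule: infinite_finite_induct) (simp_all add: zero_fun_def)

locale manifold =
  fixes A :: "('a::{t2_space,second_countable_topology}, 'e::euclidean_space) chart set"
  assumes smooth_manifold: "smooth_manifold A"
begin

abbreviation "T \<equiv> tangent_space A"

lemma chart_at: obtains U \<kappa> where "(U, \<kappa>) \<in> A" "p \<in> U"
proof -
  have "p \<in> (\<Union>(U, \<kappa>)\<in>A. U)"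
    using smooth_manifold[unfolded smooth_manifold_def, THEN conjunct1] by (simp only: UNIV_I)
  then show thesis using that by auto
qed

context
  fixes U \<kappa> assumes chart: "(U, \<kappa>) \<in> A"
begin

lemma chart_homeo:
  "open U" "open (\<kappa> ` U)" "homeomorphism U (\<kappa> ` U) \<kappa> (inv_into U \<kappa>)"
  using bspec[OF smooth_manifold[unfolded smooth_manifold_def, THEN conjunct2, THEN conjunct1] chart]
  by simp_all

lemma chart_continuous:
  "continuous_on U \<kappa>" "continuous_on (\<kappa> ` U) (inv_into U \<kappa>)"
  using chart_homeo(3) unfolding homeomorphism_def by auto

lemma chart_inv: "q \<in> U \<Longrightarrow> inv_into U \<kappa> (\<kappa> q) = q"
  using chart_homeo(3) unfolding homeomorphism_def by auto

lemma chart_open_image: assumes "open W" "W \<subseteq> U" shows "open (\<kappa> ` W)"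
proof -
  have "\<kappa> ` W = \<kappa> ` U \<inter> inv_into U \<kappa> -` W" using assms(2) chart_inv by force
  then show ?thesis
    using continuous_open_preimage[OF chart_continuous(2) chart_homeo(2) assms(1)] by simp
qed

lemma chart_open_preimage: "open V \<Longrightarrow> open (U \<inter> \<kappa> -` V)"
  using continuous_open_preimage[OF chart_continuous(1) chart_homeo(1)] .

lemma smooth_funD: "f \<in> smooth_fun A \<Longrightarrow> smooth_on (\<kappa> ` U) (f \<circ> inv_into U \<kappa>)"
  using chart unfolding smooth_fun_def by auto

end

lemma smooth_funI:
  "(\<And>U \<kappa>. (U, \<kappa>) \<in> A \<Longrightarrow> smooth_on (\<kappa> ` U) (\<lambda>x. f (inv_into U \<kappa> x))) \<Longrightarrow> f \<in> smooth_fun A"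
  unfolding smooth_fun_def comp_def by auto

text \<open>One chart around each point suffices, because the changes of charts are smooth.\<close>

lemma smooth_fun_local_chart:
  assumes "\<And>p. \<exists>(U, \<kappa>)\<in>A. \<exists>W. open W \<and> p \<in> W \<and> W \<subseteq> U \<and> smooth_on (\<kappa> ` W) (f \<circ> inv_into U \<kappa>)"
  shows "f \<in> smooth_fun A"
  unfolding smooth_fun_def
proof (clarify, rule smooth_on_local)
  fix V \<psi> x assume V: "(V, \<psi>) \<in> A" and "x \<in> \<psi> ` V"
  then obtain p where p: "p \<in> V" "x = \<psi> p" by blast
  obtain U \<kappa> W where U: "(U, \<kappa>) \<in> A" and W: "open W" "p \<in> W" "W \<subseteq> U"
    and f: "smooth_on (\<kappa> ` W) (f \<circ> inv_into U \<kappa>)"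
    using assms[of p] by auto
  let ?S = "\<psi> ` (V \<inter> W)"
  have oS: "open ?S" using chart_open_image[OF V] W(1) chart_homeo(1)[OF V] by blast
  have "\<forall>(W, \<kappa>)\<in>A. smooth_on (\<psi> ` (V \<inter> W)) (\<kappa> \<circ> inv_into V \<psi>)"
    using bspec[OF smooth_manifold[unfolded smooth_manifold_def, THEN conjunct2, THEN conjunct2] V]
    by (simp only: prod.case)
  from bspec[OF this U] have "smooth_on (\<psi> ` (V \<inter> U)) (\<kappa> \<circ> inv_into V \<psi>)"
    by (simp only: prod.case)
  then have t: "smooth_on ?S (\<kappa> \<circ> inv_into V \<psi>)"
    by (rule smooth_on_subset) (use W(3) in blast)
  have "(\<kappa> \<circ> inv_into V \<psi>) ` ?S \<subseteq> \<kappa> ` W" using chart_inv[OF V] by auto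
  from smooth_on_compose[OF oS chart_open_image[OF U W(1,3)] this f t]
  have "smooth_on ?S (\<lambda>x. (f \<circ> inv_into U \<kappa>) ((\<kappa> \<circ> inv_into V \<psi>) x))" .
  then have "smooth_on ?S (f \<circ> inv_into V \<psi>)"
    by (rule smooth_on_cong[OF oS, rotated])
      (use chart_inv[OF V] chart_inv[OF U] W(3) in auto)
  then show "\<exists>T. open T \<and> x \<in> T \<and> smooth_on T (f \<circ> inv_into V \<psi>)"
    using oS p W(2) by (intro exI[of _ ?S] conjI) auto
qed

lemma smooth_fun_const [simp]: "(\<lambda>q. c) \<in> smooth_fun A"
  by (intro smooth_funI smooth_on_const chart_homeo(2))

lemma smooth_fun_add:
  "f \<in> smooth_fun A \<Longrightarrow> h \<in> smooth_fun A \<Longrightarrow> (\<lambda>q. f q + h q) \<in> smooth_fun A"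
  by (intro smooth_funI) (rule smooth_on_add[OF chart_homeo(2) smooth_funD[unfolded comp_def] smooth_funD[unfolded comp_def]])

lemma smooth_fun_mult:
  "f \<in> smooth_fun A \<Longrightarrow> h \<in> smooth_fun A \<Longrightarrow> (\<lambda>q. f q * h q) \<in> smooth_fun A"
  by (intro smooth_funI) (rule smooth_on_mult[OF chart_homeo(2) smooth_funD[unfolded comp_def] smooth_funD[unfolded comp_def]])

lemma smooth_fun_minus: "f \<in> smooth_fun A \<Longrightarrow> (\<lambda>q. - f q) \<in> smooth_fun A"
  using smooth_fun_mult[OF smooth_fun_const[of "-1"]] by simp

lemma smooth_fun_diff:
  "f \<in> smooth_fun A \<Longrightarrow> h \<in> smooth_fun A \<Longrightarrow> (\<lambda>q. f q - h q) \<in> smooth_fun A"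
  using smooth_fun_add[OF _ smooth_fun_minus] by simp

lemma smooth_fun_sum:
  "(\<And>i. i \<in> I \<Longrightarrow> f i \<in> smooth_fun A) \<Longrightarrow> (\<lambda>q. \<Sum>i\<in>I. f i q) \<in> smooth_fun A"
  by (induction I rule: infinite_finite_induct) (simp_all add: smooth_fun_add)

text \<open>Away from the domain of the chart the extension vanishes on a neighbourhood: the compact set that
  carries \<open>b\<close> is closed in the manifold, which is a Hausdorff space.\<close>

lemma smooth_fun_extend:
  assumes U: "(U, \<kappa>) \<in> A" and K: "compact K" "K \<subseteq> \<kappa> ` U"
    and b: "smooth_on (\<kappa> ` U) b" "\<And>x. x \<in> \<kappa> ` U - K \<Longrightarrow> b x = 0"
  shows "(\<lambda>q. if q \<in> U then b (\<kappa> q) else 0) \<in> smooth_fun A" (is "?f \<in> _")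
proof (rule smooth_fun_local_chart)
  fix p
  show "\<exists>(U, \<kappa>)\<in>A. \<exists>W. open W \<and> p \<in> W \<and> W \<subseteq> U \<and> smooth_on (\<kappa> ` W) (?f \<circ> inv_into U \<kappa>)"
  proof (cases "p \<in> U")
    case True
    have "smooth_on (\<kappa> ` U) (?f \<circ> inv_into U \<kappa>)"
      by (rule smooth_on_cong[OF chart_homeo(2)[OF U] _ b(1)]) (use chart_inv[OF U] in auto)
    then show ?thesis using True chart_homeo(1)[OF U] by (intro bexI[OF _ U]) auto
  next
    case False
    let ?N = "- (inv_into U \<kappa> ` K)"
    have "compact (inv_into U \<kappa> ` K)"
      using compact_continuous_image[OF continuous_on_subset[OF chart_continuous(2)[OF U] K(2)] K(1)] .
    then have N: "open ?N" using compact_imp_closed by blast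
    have pN: "p \<in> ?N" using False K(2) chart_inv[OF U] by auto
    obtain V \<psi> where V: "(V, \<psi>) \<in> A" "p \<in> V" by (rule chart_at)
    have o: "open (V \<inter> ?N)" using N chart_homeo(1)[OF V(1)] by blast
    have z: "?f q = 0" if "q \<in> ?N" for q
      using that b(2)[of "\<kappa> q"] chart_inv[OF U] by force
    have "smooth_on (\<psi> ` (V \<inter> ?N)) (?f \<circ> inv_into V \<psi>)"
    proof (rule smooth_on_cong[OF chart_open_image[OF V(1) o Int_lower1] _
          smooth_on_const[OF chart_open_image[OF V(1) o Int_lower1], of 0]])
      fix x assume "x \<in> \<psi> ` (V \<inter> ?N)"
      then obtain q where q: "q \<in> V" "q \<in> ?N" "x = \<psi> q" by blast
      show "0 = (?f \<circ> inv_into V \<psi>) x"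
        unfolding comp_apply q(3) chart_inv[OF V(1) q(1)] by (rule z[OF q(2), symmetric])
    qed
    then show ?thesis using V o pN by (intro bexI[OF _ V(1)]) auto
  qed
qed

lemma smooth_on_cutoff:
  fixes \<rho> a :: "'e \<Rightarrow> real"
  assumes "smooth_on UNIV \<rho>" "\<And>x. x \<notin> K \<Longrightarrow> \<rho> x = 0" "closed K" "open S" "K \<subseteq> S" "smooth_on S a"
  shows "smooth_on UNIV (\<lambda>x. \<rho> x * a x)"
proof (rule smooth_on_local)
  fix x :: 'e
  show "\<exists>T. open T \<and> x \<in> T \<and> smooth_on T (\<lambda>x. \<rho> x * a x)"
  proof (cases "x \<in> S")
    case True
    then show ?thesis
      using smooth_on_mult[OF assms(4) smooth_on_subset[OF assms(1) subset_UNIV] assms(6)] assms(4)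
      by (intro exI[of _ S] conjI)
  next
    case False
    have "open (- K)" using assms(3) by blast
    moreover have "smooth_on (- K) (\<lambda>x. \<rho> x * a x)"
      by (rule smooth_on_cong[OF \<open>open (- K)\<close> _ smooth_on_const[OF \<open>open (- K)\<close>, of 0]])
        (use assms(2) in auto)
    ultimately show ?thesis using False assms(5) by (intro exI[of _ "- K"] conjI) auto
  qed
qed

lemma exists_bump:
  assumes "open W" "p \<in> W"
  obtains \<psi> N where "\<psi> \<in> smooth_fun A" "open N" "p \<in> N" "\<And>q. q \<in> N \<Longrightarrow> \<psi> q = 1"
    and "\<And>q. q \<notin> W \<Longrightarrow> \<psi> q = 0"
proof -
  obtain U \<kappa> where U: "(U, \<kappa>) \<in> A" "p \<in> U" by (rule chart_at)
  have "open (\<kappa> ` (U \<inter> W))" using chart_open_image[OF U(1)] assms(1) chart_homeo(1)[OF U(1)] by blast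
  then obtain s where s: "s > 0" "ball (\<kappa> p) s \<subseteq> \<kappa> ` (U \<inter> W)"
    using U(2) assms(2) open_contains_ball[of "\<kappa> ` (U \<inter> W)"] by blast
  define r where "r = s / 3"
  have r: "r > 0" "cball (\<kappa> p) (2 * r) \<subseteq> ball (\<kappa> p) s" using s(1) by (auto simp: r_def)
  obtain \<rho> :: "'e \<Rightarrow> real" where \<rho>: "smooth_on UNIV \<rho>" "\<forall>x\<in>ball (\<kappa> p) r. \<rho> x = 1"
      "\<forall>x. x \<notin> ball (\<kappa> p) (2 * r) \<longrightarrow> \<rho> x = 0"
    using exists_plateau[OF r(1)] by blast
  let ?\<psi> = "\<lambda>q. if q \<in> U then \<rho> (\<kappa> q) else 0"
  show thesis
  proof
    show "?\<psi> \<in> smooth_fun A"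
    proof (rule smooth_fun_extend[OF U(1) compact_cball[of "\<kappa> p" "2 * r"]])
      show "cball (\<kappa> p) (2 * r) \<subseteq> \<kappa> ` U" using r s by auto
      show "smooth_on (\<kappa> ` U) \<rho>" by (rule smooth_on_subset[OF \<rho>(1) subset_UNIV])
      show "\<rho> x = 0" if "x \<in> \<kappa> ` U - cball (\<kappa> p) (2 * r)" for x using \<rho>(3) that by simp
    qed
    show "open (U \<inter> \<kappa> -` ball (\<kappa> p) r)" using chart_open_preimage[OF U(1)] by blast
    show "p \<in> U \<inter> \<kappa> -` ball (\<kappa> p) r" using U(2) r(1) by simp
    show "?\<psi> q = 1" if "q \<in> U \<inter> \<kappa> -` ball (\<kappa> p) r" for q using that \<rho>(2) by auto
    show "?\<psi> q = 0" if "q \<notin> W" for q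
    proof -
      have "\<kappa> q \<notin> ball (\<kappa> p) (2 * r)" if "q \<in> U"
      proof
        assume "\<kappa> q \<in> ball (\<kappa> p) (2 * r)"
        then have "\<kappa> q \<in> \<kappa> ` (U \<inter> W)"
          using r(2) s(2) ball_subset_cball[of "\<kappa> p" "2 * r"] by blast
        then obtain z where "z \<in> U \<inter> W" "\<kappa> z = \<kappa> q" by auto
        then show False using \<open>q \<notin> W\<close> that chart_inv[OF U(1)] by (metis IntE)
      qed
      then show ?thesis using \<rho>(3) by simp
    qed
  qed
qed

subsection \<open>Tangent vectors\<close>

lemma tangent_add: "w \<in> T p \<Longrightarrow> f \<in> smooth_fun A \<Longrightarrow> h \<in> smooth_fun A \<Longrightarrow> w (\<lambda>q. f q + h q) = w f + w h"
  unfolding tangent_space_def by blast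

lemma tangent_cmult: "w \<in> T p \<Longrightarrow> f \<in> smooth_fun A \<Longrightarrow> w (\<lambda>q. c * f q) = c * w f"
  unfolding tangent_space_def by blast

lemma tangent_mult:
  "w \<in> T p \<Longrightarrow> f \<in> smooth_fun A \<Longrightarrow> h \<in> smooth_fun A \<Longrightarrow> w (\<lambda>q. f q * h q) = f p * w h + h p * w f"
  unfolding tangent_space_def by blast

lemma tangent_nonsmooth: "w \<in> T p \<Longrightarrow> f \<notin> smooth_fun A \<Longrightarrow> w f = 0"
  unfolding tangent_space_def by blast

lemma tangent_const: assumes "w \<in> T p" shows "w (\<lambda>q. c) = 0"
proof -
  have "w (\<lambda>q. 1) = 0" using tangent_mult[OF assms, of "\<lambda>q. 1" "\<lambda>q. 1"] by simp
  then show ?thesis using tangent_cmult[OF assms, of "\<lambda>q. 1" c] by simp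
qed

lemma tangent_minus: "w \<in> T p \<Longrightarrow> f \<in> smooth_fun A \<Longrightarrow> w (\<lambda>q. - f q) = - w f"
  using tangent_cmult[of w p f "-1"] by simp

lemma tangent_diff:
  "w \<in> T p \<Longrightarrow> f \<in> smooth_fun A \<Longrightarrow> h \<in> smooth_fun A \<Longrightarrow> w (\<lambda>q. f q - h q) = w f - w h"
  using tangent_add[of w p f "\<lambda>q. - h q"] tangent_minus smooth_fun_minus by simp

lemma tangent_sum:
  assumes "w \<in> T p" "\<And>i. i \<in> I \<Longrightarrow> f i \<in> smooth_fun A"
  shows "w (\<lambda>q. \<Sum>i\<in>I. f i q) = (\<Sum>i\<in>I. w (f i))"
  using assms(2)
  by (induction I rule: infinite_finite_induct)
    (simp_all add: tangent_const[OF assms(1)] tangent_add[OF assms(1)] smooth_fun_sum)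

text \<open>Apply \<open>w\<close> to \<open>\<psi> (f - h) = 0\<close> for a bump function \<open>\<psi>\<close> supported in \<open>W\<close>.\<close>

lemma tangent_local:
  assumes w: "w \<in> T p" and fh: "f \<in> smooth_fun A" "h \<in> smooth_fun A"
    and W: "open W" "p \<in> W" "\<And>q. q \<in> W \<Longrightarrow> f q = h q"
  shows "w f = w h"
proof -
  obtain \<psi> N where \<psi>: "\<psi> \<in> smooth_fun A" "p \<in> N" "\<And>q. q \<in> N \<Longrightarrow> \<psi> q = 1"
    "\<And>q. q \<notin> W \<Longrightarrow> \<psi> q = 0"
    using exists_bump[OF W(1,2)] by metis
  have "(\<lambda>q. \<psi> q * (f q - h q)) = (\<lambda>q. 0)" using \<psi>(4) W(3) by fastforce
  then have "w (\<lambda>q. \<psi> q * (f q - h q)) = 0" using tangent_const[OF w, of 0] by simp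
  then show ?thesis
    using tangent_mult[OF w \<psi>(1) smooth_fun_diff[OF fh]] tangent_diff[OF w fh] W(2,3) \<psi>(2,3) by simp
qed

lemma zero_in_T [simp]: "0 \<in> T p"
  by (simp add: tangent_space_def zero_fun_def)

lemma add_in_T: "w \<in> T p \<Longrightarrow> z \<in> T p \<Longrightarrow> w + z \<in> T p"
  by (simp add: tangent_space_def algebra_simps)

lemma scaleR_in_T: "w \<in> T p \<Longrightarrow> c *\<^sub>R w \<in> T p"
  by (simp add: tangent_space_def algebra_simps)

lemma subspace_T: "subspace (T p)"
  by (simp add: subspace_def add_in_T scaleR_in_T)

lemmas diff_in_T = subspace_diff[OF subspace_T] and neg_in_T = subspace_neg[OF subspace_T]

subsection \<open>Vector fields\<close>

lemma vfields_T: "X \<in> vfields A \<Longrightarrow> X p \<in> T p"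
  by (simp add: vfields_def)

lemma vfields_smooth: "X \<in> vfields A \<Longrightarrow> f \<in> smooth_fun A \<Longrightarrow> (\<lambda>p. X p f) \<in> smooth_fun A"
  by (simp add: vfields_def)

lemma zero_vfield [simp]: "0 \<in> vfields A"
  by (simp add: vfields_def)

lemma add_vfield: "X \<in> vfields A \<Longrightarrow> Y \<in> vfields A \<Longrightarrow> X + Y \<in> vfields A"
  by (simp add: vfields_def add_in_T smooth_fun_add)

lemma fscale_vfield: "f \<in> smooth_fun A \<Longrightarrow> X \<in> vfields A \<Longrightarrow> fscale f X \<in> vfields A"
  by (simp add: vfields_def fscale_def scaleR_in_T smooth_fun_mult)

lemma scaleR_vfield: "X \<in> vfields A \<Longrightarrow> c *\<^sub>R X \<in> vfields A"
  using fscale_vfield[OF smooth_fun_const[of c]] by (simp add: fscale_def scaleR_fun_def)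

lemma subspace_vfields: "subspace (vfields A)"
  by (simp add: subspace_def add_vfield scaleR_vfield)

lemma bracket_vfield:
  assumes X: "X \<in> vfields A" and Y: "Y \<in> vfields A"
  shows "bracket X Y \<in> vfields A"
proof -
  note sX = vfields_smooth[OF X] and sY = vfields_smooth[OF Y]
  note tX = vfields_T[OF X] and tY = vfields_T[OF Y]
  have a: "bracket X Y p (\<lambda>q. f q + h q) = bracket X Y p f + bracket X Y p h"
    if "f \<in> smooth_fun A" "h \<in> smooth_fun A" for p f h
    using that by (simp add: bracket_def tangent_add[OF tX] tangent_add[OF tY] sX sY)
  have c: "bracket X Y p (\<lambda>q. c * f q) = c * bracket X Y p f" if "f \<in> smooth_fun A" for p f c
    using that by (simp add: bracket_def tangent_cmult[OF tX] tangent_cmult[OF tY] sX sY algebra_simps)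
  have m: "bracket X Y p (\<lambda>q. f q * h q) = f p * bracket X Y p h + h p * bracket X Y p f"
    if "f \<in> smooth_fun A" "h \<in> smooth_fun A" for p f h
    using that by (simp add: bracket_def tangent_mult[OF tX] tangent_mult[OF tY] tangent_add[OF tX]
        tangent_add[OF tY] sX sY smooth_fun_mult algebra_simps)
  have n: "bracket X Y p f = 0" if "f \<notin> smooth_fun A" for p f
    using that tangent_nonsmooth[OF tX] tangent_nonsmooth[OF tY] tangent_const[OF tX] tangent_const[OF tY]
    by (simp add: bracket_def)
  have "bracket X Y p \<in> T p" for p
    using a c m n by (simp add: tangent_space_def)
  moreover have "(\<lambda>p. bracket X Y p f) \<in> smooth_fun A" if "f \<in> smooth_fun A" for f
    using that by (simp add: bracket_def smooth_fun_diff sX sY)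
  ultimately show ?thesis by (simp add: vfields_def)
qed

subsection \<open>Local frames\<close>

text \<open>Derivations are combinations of partial derivatives. The \<open>y b\<close> are coordinates and the \<open>E b\<close>
  coordinate fields of a chart, made global by a cutoff that equals \<open>1\<close> near \<open>p\<close>. Hadamard's lemma
  writes a smooth \<open>f\<close> near \<open>q\<close> as \<open>f(q) + \<Sum>b. (y b - y b q) H b\<close> with \<open>H b q = \<partial>\<^sub>b f\<close>, and the product
  rule then evaluates \<open>w f\<close>. This gives finite-dimensional tangent spaces, vector fields through a
  given vector, and coefficients depending smoothly on the point.\<close>

lemma local_frame:
  obtains W E y where "open W" "p \<in> W"
    and "\<And>b. b \<in> Basis \<Longrightarrow> E (b::'e) \<in> vfields A" "\<And>b. b \<in> Basis \<Longrightarrow> y b \<in> smooth_fun A"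
    and "\<And>q w. q \<in> W \<Longrightarrow> w \<in> T q \<Longrightarrow> w = (\<Sum>b\<in>Basis. w (y b) *\<^sub>R E b q)"
proof -
  obtain U \<kappa> where U: "(U, \<kappa>) \<in> A" "p \<in> U" by (rule chart_at)
  note oU = chart_homeo(2)[OF U(1)] and inv = chart_inv[OF U(1)]
  obtain s where s: "s > 0" "ball (\<kappa> p) s \<subseteq> \<kappa> ` U"
    using U(2) oU open_contains_ball[of "\<kappa> ` U"] by blast
  define r where "r = s / 3"
  define K where "K = cball (\<kappa> p) (2 * r)"
  have r: "r > 0" "K \<subseteq> \<kappa> ` U" using s by (auto simp: r_def K_def)
  obtain \<rho> :: "'e \<Rightarrow> real" where \<rho>: "smooth_on UNIV \<rho>" "\<And>x. x \<in> ball (\<kappa> p) r \<Longrightarrow> \<rho> x = 1"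
      "\<And>x. x \<notin> ball (\<kappa> p) (2 * r) \<Longrightarrow> \<rho> x = 0"
    using exists_plateau[OF r(1)] by blast
  have \<rho>K: "\<rho> x = 0" if "x \<notin> K" for x using \<rho>(3) that by (simp add: K_def)
  have ext: "(\<lambda>q. if q \<in> U then \<rho> (\<kappa> q) * b (\<kappa> q) else 0) \<in> smooth_fun A"
    if "smooth_on (\<kappa> ` U) b" for b
  proof -
    have "smooth_on (\<kappa> ` U) (\<lambda>x. \<rho> x * b x)"
      by (rule smooth_on_mult[OF oU smooth_on_subset[OF \<rho>(1) subset_UNIV] that])
    from smooth_fun_extend[OF U(1) _ r(2) this] \<rho>K show ?thesis by (simp add: K_def)
  qed
  define y where "y b q = (if q \<in> U then \<rho> (\<kappa> q) * (\<kappa> q \<bullet> b) else 0)" for b q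
  define E where "E b q f = (if f \<in> smooth_fun A \<and> q \<in> U
    then \<rho> (\<kappa> q) * frechet_derivative (f \<circ> inv_into U \<kappa>) (at (\<kappa> q)) b else 0)" for b q f
  have y: "y b \<in> smooth_fun A" for b
    using ext[OF smooth_on_bounded_linear[OF oU bounded_linear_inner_left[of b]]]
    by (simp add: y_def[abs_def])
  have E: "E b \<in> vfields A" for b
  proof -
    have d: "((f \<circ> inv_into U \<kappa>) has_derivative frechet_derivative (f \<circ> inv_into U \<kappa>) (at (\<kappa> q))) (at (\<kappa> q))"
      if "f \<in> smooth_fun A" "q \<in> U" for f q
      using smooth_on_has_derivative[OF smooth_funD[OF U(1) that(1)]] that(2) by blast
    have a: "frechet_derivative ((\<lambda>q. f q + h q) \<circ> inv_into U \<kappa>) (at (\<kappa> q)) b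
        = frechet_derivative (f \<circ> inv_into U \<kappa>) (at (\<kappa> q)) b
        + frechet_derivative (h \<circ> inv_into U \<kappa>) (at (\<kappa> q)) b"
      if "f \<in> smooth_fun A" "h \<in> smooth_fun A" "q \<in> U" for f h q
    proof -
      have "((\<lambda>q. f q + h q) \<circ> inv_into U \<kappa>) = (\<lambda>x. (f \<circ> inv_into U \<kappa>) x + (h \<circ> inv_into U \<kappa>) x)"
        by auto
      then show ?thesis
        using fun_cong[OF frechet_derivative_at[OF has_derivative_add[OF d[OF that(1,3)] d[OF that(2,3)]]], of b]
        by simp
    qed
    have m: "frechet_derivative ((\<lambda>q. f q * h q) \<circ> inv_into U \<kappa>) (at (\<kappa> q)) b
        = f q * frechet_derivative (h \<circ> inv_into U \<kappa>) (at (\<kappa> q)) b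
        + h q * frechet_derivative (f \<circ> inv_into U \<kappa>) (at (\<kappa> q)) b"
      if "f \<in> smooth_fun A" "h \<in> smooth_fun A" "q \<in> U" for f h q
    proof -
      have "((\<lambda>q. f q * h q) \<circ> inv_into U \<kappa>) = (\<lambda>x. (f \<circ> inv_into U \<kappa>) x * (h \<circ> inv_into U \<kappa>) x)"
        by auto
      then show ?thesis
        using fun_cong[OF frechet_derivative_at[OF has_derivative_mult[OF d[OF that(1,3)] d[OF that(2,3)]]], of b]
          inv[OF that(3)] by (simp add: algebra_simps)
    qed
    have c: "frechet_derivative ((\<lambda>q. c) \<circ> inv_into U \<kappa>) (at x) b = 0" for c :: real and x
      by (simp add: comp_def)
    have "E b q \<in> T q" for q
      unfolding tangent_space_def E_def
      using a m m[OF smooth_fun_const] c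
      by (auto simp: algebra_simps smooth_fun_add smooth_fun_mult)
    moreover have "(\<lambda>q. E b q f) \<in> smooth_fun A" if "f \<in> smooth_fun A" for f
      using ext[OF smooth_on_derivative[OF smooth_funD[OF U(1) that], of b]] that
      by (simp add: E_def)
    ultimately show ?thesis by (simp add: vfields_def)
  qed
  let ?W = "U \<inter> \<kappa> -` ball (\<kappa> p) r"
  show thesis
  proof
    show "open ?W" using chart_open_preimage[OF U(1)] by blast
    show "p \<in> ?W" using U(2) r(1) by simp
    show "E b \<in> vfields A" "y b \<in> smooth_fun A" for b by (rule E, rule y)
    fix q w assume q: "q \<in> ?W" and w: "w \<in> T q"
    have qU: "q \<in> U" using q by simp
    let ?F = "\<lambda>f. f \<circ> inv_into U \<kappa>"
    have *: "w f = (\<Sum>b\<in>Basis. w (y b) * frechet_derivative (?F f) (at (\<kappa> q)) b)"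
      if f: "f \<in> smooth_fun A" for f
    proof -
      obtain t' where t': "t' > 0" "ball (\<kappa> q) t' \<subseteq> ball (\<kappa> p) r"
        using q openE[OF open_ball, of "\<kappa> q" "\<kappa> p" r] by blast
      define t where "t = t' / 3"
      have t: "t > 0" "cball (\<kappa> q) (2 * t) \<subseteq> ball (\<kappa> q) t'" "ball (\<kappa> q) t \<subseteq> ball (\<kappa> q) t'"
        using t'(1) by (auto simp: t_def)
      have rU: "ball (\<kappa> p) r \<subseteq> \<kappa> ` U" using s r(1) by (auto simp: r_def)
      have "smooth_on (ball (\<kappa> q) t') (?F f)"
        by (rule smooth_on_subset[OF smooth_funD[OF U(1) f]]) (use t'(2) rU in blast)
      then obtain G where G: "\<And>b. smooth_on (ball (\<kappa> q) t') (G b)"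
        "\<And>b. G b (\<kappa> q) = frechet_derivative (?F f) (at (\<kappa> q)) b"
        "\<And>x. x \<in> ball (\<kappa> q) t' \<Longrightarrow> ?F f x = ?F f (\<kappa> q) + (\<Sum>b\<in>Basis. ((x - \<kappa> q) \<bullet> b) * G b x)"
        by (rule hadamard) (rule that)
      obtain \<sigma> :: "'e \<Rightarrow> real" where \<sigma>: "smooth_on UNIV \<sigma>" "\<And>x. x \<in> ball (\<kappa> q) t \<Longrightarrow> \<sigma> x = 1"
          "\<And>x. x \<notin> ball (\<kappa> q) (2 * t) \<Longrightarrow> \<sigma> x = 0"
        using exists_plateau[OF t(1)] by blast
      \<comment> \<open>\<open>G b\<close> lives only near \<open>\<kappa> q\<close>, hence the second, smaller cutoff.\<close>
      define H where "H b z = (if z \<in> U then \<sigma> (\<kappa> z) * G b (\<kappa> z) else 0)" for b z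
      have H: "H b \<in> smooth_fun A" for b
      proof -
        have "smooth_on UNIV (\<lambda>x. \<sigma> x * G b x)"
          by (rule smooth_on_cutoff[OF \<sigma>(1) _ closed_cball open_ball t(2) G(1)]) (use \<sigma>(3) in auto)
        then have sm: "smooth_on (\<kappa> ` U) (\<lambda>x. \<sigma> x * G b x)" by (rule smooth_on_subset) blast
        have "cball (\<kappa> q) (2 * t) \<subseteq> \<kappa> ` U" using t(2) t'(2) rU by blast
        from smooth_fun_extend[OF U(1) compact_cball this sm]
        have "(\<lambda>z. if z \<in> U then \<sigma> (\<kappa> z) * G b (\<kappa> z) else 0) \<in> smooth_fun A"
          using \<sigma>(3) by simp
        then show ?thesis by (simp add: H_def[abs_def])
      qed
      let ?f = "\<lambda>z. f q + (\<Sum>b\<in>Basis. (y b z - \<kappa> q \<bullet> b) * H b z)"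
      have sm: "(\<lambda>z. (y b z - \<kappa> q \<bullet> b) * H b z) \<in> smooth_fun A" for b
        by (intro smooth_fun_mult smooth_fun_diff y H smooth_fun_const)
      have "w f = w ?f"
      proof (rule tangent_local[OF w f])
        show "?f \<in> smooth_fun A" by (intro smooth_fun_add smooth_fun_sum smooth_fun_const sm)
        show "open (U \<inter> \<kappa> -` ball (\<kappa> q) t)" using chart_open_preimage[OF U(1)] by blast
        show "q \<in> U \<inter> \<kappa> -` ball (\<kappa> q) t" using qU t(1) by simp
        fix z assume z: "z \<in> U \<inter> \<kappa> -` ball (\<kappa> q) t"
        then have z': "z \<in> U" "\<kappa> z \<in> ball (\<kappa> q) t" "\<kappa> z \<in> ball (\<kappa> q) t'" "\<kappa> z \<in> ball (\<kappa> p) r"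
          using t(3) t'(2) by blast+
        show "f z = ?f z"
          using G(3)[OF z'(3)] z'(1) \<sigma>(2)[OF z'(2)] \<rho>(2)[OF z'(4)] inv qU
          by (simp add: y_def H_def inner_diff_left)
      qed
      also have "\<dots> = (\<Sum>b\<in>Basis. w (\<lambda>z. (y b z - \<kappa> q \<bullet> b) * H b z))"
      proof -
        have "(\<lambda>z. \<Sum>b\<in>Basis. (y b z - \<kappa> q \<bullet> b) * H b z) \<in> smooth_fun A"
          by (rule smooth_fun_sum[OF sm])
        moreover have "w (\<lambda>z. \<Sum>b\<in>Basis. (y b z - \<kappa> q \<bullet> b) * H b z)
            = (\<Sum>b\<in>Basis. w (\<lambda>z. (y b z - \<kappa> q \<bullet> b) * H b z))"
          by (rule tangent_sum[OF w sm])
        ultimately show ?thesis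
          using tangent_add[OF w smooth_fun_const, of _ "f q"] tangent_const[OF w] by simp
      qed
      also have "\<dots> = (\<Sum>b\<in>Basis. w (y b) * frechet_derivative (?F f) (at (\<kappa> q)) b)"
      proof (rule sum.cong[OF refl])
        fix b
        have "y b q = \<kappa> q \<bullet> b" using q \<rho>(2) by (simp add: y_def)
        moreover have "H b q = frechet_derivative (?F f) (at (\<kappa> q)) b"
          using qU \<sigma>(2)[of "\<kappa> q"] t(1) G(2) by (simp add: H_def)
        ultimately show "w (\<lambda>z. (y b z - \<kappa> q \<bullet> b) * H b z) = w (y b) * frechet_derivative (?F f) (at (\<kappa> q)) b"
          using tangent_mult[OF w smooth_fun_diff[OF y smooth_fun_const] H, of b "\<kappa> q \<bullet> b" b]
            tangent_diff[OF w y smooth_fun_const, of b "\<kappa> q \<bullet> b"] tangent_const[OF w] by simp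
      qed
      finally show ?thesis .
    qed
    have 1: "\<rho> (\<kappa> q) = 1" using q \<rho>(2) by blast
    show "w = (\<Sum>b\<in>Basis. w (y b) *\<^sub>R E b q)"
    proof
      show "w f = (\<Sum>b\<in>Basis. w (y b) *\<^sub>R E b q) f" for f
        by (cases "f \<in> smooth_fun A")
          (simp_all add: * tangent_nonsmooth[OF w] sum_apply E_def qU 1)
    qed
  qed
qed

lemma exists_vfield: assumes "u \<in> T p" obtains X where "X \<in> vfields A" "X p = u"
proof -
  obtain W E y where "open W" and *: "p \<in> W" "\<And>b. b \<in> Basis \<Longrightarrow> E (b::'e) \<in> vfields A"
    and "\<And>b. b \<in> Basis \<Longrightarrow> y b \<in> smooth_fun A"
    and w: "\<And>q w. q \<in> W \<Longrightarrow> w \<in> T q \<Longrightarrow> w = (\<Sum>b\<in>Basis. w (y b) *\<^sub>R E b q)"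
    by (rule local_frame[of p]) (rule that)
  show thesis
  proof
    show "(\<Sum>b\<in>Basis. u (y b) *\<^sub>R E b) \<in> vfields A"
      using *(2) by (intro subspace_sum[OF subspace_vfields] scaleR_vfield)
    show "(\<Sum>b\<in>Basis. u (y b) *\<^sub>R E b) p = u"
      using w[OF *(1) assms] by (simp add: sum_apply)
  qed
qed

lemma T_subset_span: obtains B where "finite B" "T p \<subseteq> span B"
proof -
  obtain W E y where "open W" and *: "p \<in> W" and "\<And>b. b \<in> Basis \<Longrightarrow> E (b::'e) \<in> vfields A"
    and "\<And>b. b \<in> Basis \<Longrightarrow> y b \<in> smooth_fun A"
    and w: "\<And>q w. q \<in> W \<Longrightarrow> w \<in> T q \<Longrightarrow> w = (\<Sum>b\<in>Basis. w (y b) *\<^sub>R E b q)"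
    by (rule local_frame[of p]) (rule that)
  have "w \<in> span ((\<lambda>b. E b p) ` Basis)" if "w \<in> T p" for w
    by (subst w[OF * that], rule span_sum, rule span_scale, rule span_base, rule imageI)
  then show thesis by (intro that[of "(\<lambda>b. E b p) ` Basis"]) auto
qed

end

section \<open>Riemannian manifolds\<close>

lemma lin_on_add: "lin_on S f \<Longrightarrow> x \<in> S \<Longrightarrow> y \<in> S \<Longrightarrow> f (x + y) = f x + f y"
  and lin_on_scaleR: "lin_on S f \<Longrightarrow> x \<in> S \<Longrightarrow> f (c *\<^sub>R x) = c *\<^sub>R f x"
  by (simp_all add: lin_on_def)

lemma lin_on_zero: "lin_on S f \<Longrightarrow> 0 \<in> S \<Longrightarrow> f 0 = 0"
  using lin_on_scaleR[of S f 0 0] by simp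

lemma lin_on_minus: "lin_on S f \<Longrightarrow> x \<in> S \<Longrightarrow> f (- x) = - f x"
  using lin_on_scaleR[of S f x "-1"] by simp

lemma lin_on_diff: "lin_on S f \<Longrightarrow> subspace S \<Longrightarrow> x \<in> S \<Longrightarrow> y \<in> S \<Longrightarrow> f (x - y) = f x - f y"
  using lin_on_add[of S f x "- y"] lin_on_minus[of S f y] subspace_neg[of S y] by simp

lemma lin_on_sum:
  assumes "lin_on S f" "subspace S" "\<And>i. i \<in> I \<Longrightarrow> x i \<in> S"
  shows "f (\<Sum>i\<in>I. c i *\<^sub>R x i) = (\<Sum>i\<in>I. c i *\<^sub>R f (x i))"
  using assms(3)
proof (induction I rule: infinite_finite_induct)
  case (insert i I)
  have "f (c i *\<^sub>R x i + (\<Sum>i\<in>I. c i *\<^sub>R x i)) = f (c i *\<^sub>R x i) + f (\<Sum>i\<in>I. c i *\<^sub>R x i)"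
    using insert.prems
    by (intro lin_on_add[OF assms(1)] subspace_sum[OF assms(2)] subspace_scale[OF assms(2)]) auto
  then show ?case using insert lin_on_scaleR[OF assms(1)] by simp
qed (use lin_on_zero[OF assms(1)] subspace_0[OF assms(2)] in simp_all)

locale riemannian = manifold A
  for A :: "('a::{t2_space,second_countable_topology}, 'e::euclidean_space) chart set" +
  fixes g :: "'a \<Rightarrow> 'a tvec \<Rightarrow> 'a tvec \<Rightarrow> real"
  assumes metric: "riemannian_metric A g"
begin

lemma g_lin: "x \<in> T p \<Longrightarrow> lin_on (T p) (g p x)"
  and g_sym: "x \<in> T p \<Longrightarrow> y \<in> T p \<Longrightarrow> g p x y = g p y x"
  and g_pos: "x \<in> T p \<Longrightarrow> x \<noteq> 0 \<Longrightarrow> g p x x > 0"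
  and g_smooth: "X \<in> vfields A \<Longrightarrow> Y \<in> vfields A \<Longrightarrow> (\<lambda>p. g p (X p) (Y p)) \<in> smooth_fun A"
  using metric by (simp_all add: riemannian_metric_def)

lemma g_lin_left: "x \<in> T p \<Longrightarrow> lin_on (T p) (\<lambda>y. g p y x)"
  using g_lin[of x p] g_sym[of _ p x] add_in_T scaleR_in_T by (simp add: lin_on_def)

lemmas g_add_right = lin_on_add[OF g_lin] and g_add_left = lin_on_add[OF g_lin_left]
  and g_diff_right = lin_on_diff[OF g_lin subspace_T] and g_diff_left = lin_on_diff[OF g_lin_left subspace_T]
  and g_neg_right = lin_on_minus[OF g_lin] and g_neg_left = lin_on_minus[OF g_lin_left]
  and g_scale_right = lin_on_scaleR[OF g_lin, simplified] and g_scale_left = lin_on_scaleR[OF g_lin_left, simplified]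
  and g_zero_right [simp] = lin_on_zero[OF g_lin zero_in_T] and g_zero_left [simp] = lin_on_zero[OF g_lin_left zero_in_T]

lemmas g_bilinear = g_add_right g_add_left g_diff_right g_diff_left g_neg_right g_neg_left
  g_scale_right g_scale_left

lemma g_span_right:
  assumes "x \<in> T p" "C \<subseteq> T p" "\<And>c. c \<in> C \<Longrightarrow> g p x c = 0" "y \<in> span C"
  shows "g p x y = 0"
proof -
  have "subspace {y \<in> T p. g p x y = 0}"
    using assms(1) by (simp add: subspace_def add_in_T scaleR_in_T g_bilinear)
  moreover have "C \<subseteq> {y \<in> T p. g p x y = 0}" using assms(2,3) by blast
  ultimately have "span C \<subseteq> {y \<in> T p. g p x y = 0}" by (rule span_minimal[rotated])
  then show ?thesis using assms(4) by blast
qed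

text \<open>One step of the Gram--Schmidt process per element of \<open>C\<close>.\<close>

lemma orth_proj_span:
  assumes "finite C" "C \<subseteq> T p" "x \<in> T p"
  shows "\<exists>u\<in>span C. \<forall>c\<in>C. g p (x - u) c = 0"
  using assms
proof (induction C arbitrary: x)
  case empty
  then show ?case by simp
next
  case (insert b C)
  have sub: "span D \<subseteq> T p" if "D \<subseteq> T p" for D
    using span_minimal[OF that subspace_T] .
  have bT: "b \<in> T p" and CT: "C \<subseteq> T p" using insert.prems by auto
  obtain u where u: "u \<in> span C" "\<And>c. c \<in> C \<Longrightarrow> g p (b - u) c = 0"
    using insert.IH[OF CT bT] by blast
  obtain w where w: "w \<in> span C" "\<And>c. c \<in> C \<Longrightarrow> g p (x - w) c = 0"
    using insert.IH[OF CT insert.prems(2)] by blast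
  define d where "d = b - u"
  define z where "z = w + (g p (x - w) d / g p d d) *\<^sub>R d"
  have uT: "u \<in> T p" and wT: "w \<in> T p" using u(1) w(1) sub[OF CT] by blast+
  have dT: "d \<in> T p" using bT uT diff_in_T by (simp add: d_def)
  have xwT: "x - w \<in> T p" using insert.prems(2) wT diff_in_T by blast
  have zT: "z \<in> T p" using wT dT by (simp add: z_def add_in_T scaleR_in_T)
  \<comment> \<open>If \<open>d = 0\<close>, the quotient is \<open>0\<close> and nothing has to be projected away.\<close>
  have dd: "g p (x - w) d / g p d d * g p d d = g p (x - w) d"
    using g_pos[OF dT] xwT by (cases "d = 0") auto
  have dspan: "d \<in> span (insert b C)"
    unfolding d_def using u(1) span_mono[of C "insert b C", OF subset_insertI]
    by (intro span_diff span_base[of b]) auto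
  have "z \<in> span (insert b C)"
    unfolding z_def using w(1) span_mono[of C "insert b C", OF subset_insertI] dspan
    by (intro span_add span_scale) auto
  moreover have xz: "g p (x - z) y = g p (x - w) y - g p (x - w) d / g p d d * g p d y" if "y \<in> T p" for y
  proof -
    have xz: "x - z = (x - w) - (g p (x - w) d / g p d d) *\<^sub>R d" by (simp add: z_def)
    show ?thesis unfolding xz using that xwT dT by (simp add: g_bilinear scaleR_in_T)
  qed
  have zC: "g p (x - z) c = 0" if "c \<in> C" for c
    using xz[of c] w(2)[OF that] u(2)[OF that] CT that by (auto simp: d_def)
  moreover have "g p (x - z) b = 0"
  proof -
    have "g p (x - z) d = 0" using xz[OF dT] dd by simp
    moreover have "g p (x - z) u = 0"
      using g_span_right[OF _ CT zC u(1)] diff_in_T insert.prems(2) zT by blast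
    moreover have "b = d + u" by (simp add: d_def)
    ultimately show ?thesis using g_add_right[of "x - z" p d u] diff_in_T[of x p z] insert.prems(2) zT dT uT by simp
  qed
  ultimately show ?case by blast
qed

text \<open>Tangent spaces have finite dimension by \<open>local_frame\<close>, so a subspace is the span of a finite set.\<close>

lemma orth_proj:
  assumes V: "subspace V" "V \<subseteq> T p" and x: "x \<in> T p"
  obtains u where "u \<in> V" "\<And>c. c \<in> V \<Longrightarrow> g p (x - u) c = 0"
proof -
  obtain B where B: "finite B" "T p \<subseteq> span B" by (rule T_subset_span)
  obtain C where C: "C \<subseteq> V" "independent C" "V \<subseteq> span C"
    using maximal_independent_subset[of V] by blast
  have "finite C" using independent_span_bound[OF B(1) C(2)] C(1) V(2) B(2) by blast
  then obtain u where u: "u \<in> span C" "\<forall>c\<in>C. g p (x - u) c = 0"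
    using orth_proj_span[of C p x] C(1) V(2) x by blast
  have CT: "C \<subseteq> T p" using C(1) V(2) by blast
  have uV: "u \<in> V" using u(1) span_minimal[OF C(1) V(1)] by blast
  then have "x - u \<in> T p" using diff_in_T[OF x] V(2) by blast
  then have "g p (x - u) c = 0" if "c \<in> V" for c
    using g_span_right[OF _ CT] u(2) C(3) that by blast
  then show thesis using that uV by blast
qed

end

section \<open>Almost contact metric manifolds\<close>

locale contact_manifold = riemannian A g
  for A :: "('a::{t2_space,second_countable_topology}, 'e::euclidean_space) chart set"
    and g :: "'a \<Rightarrow> 'a tvec \<Rightarrow> 'a tvec \<Rightarrow> real" +
  fixes \<phi> :: "'a \<Rightarrow> 'a tvec \<Rightarrow> 'a tvec" and \<xi> :: "'a vfield" and \<eta> :: "'a \<Rightarrow> 'a tvec \<Rightarrow> real"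
  assumes acm: "almost_contact_metric A \<phi> \<xi> \<eta> g"
begin

lemma phi_lin: "lin_on (T p) (\<phi> p)"
  and phi_in_T: "x \<in> T p \<Longrightarrow> \<phi> p x \<in> T p"
  and app_vfield: "X \<in> vfields A \<Longrightarrow> app \<phi> X \<in> vfields A"
  using acm by (auto simp: almost_contact_metric_def endo_field_def app_def)

lemma xi_vfield: "\<xi> \<in> vfields A"
  and eta_lin: "lin_on (T p) (\<eta> p)"
  and eta_smooth: "X \<in> vfields A \<Longrightarrow> (\<lambda>p. \<eta> p (X p)) \<in> smooth_fun A"
  and phi_phi: "x \<in> T p \<Longrightarrow> \<phi> p (\<phi> p x) = - x + \<eta> p x *\<^sub>R \<xi> p"
  and eta_xi: "\<eta> p (\<xi> p) = 1"
  and g_phi_phi: "x \<in> T p \<Longrightarrow> y \<in> T p \<Longrightarrow> g p (\<phi> p x) (\<phi> p y) = g p x y - \<eta> p x * \<eta> p y"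
  using acm by (simp_all add: almost_contact_metric_def one_form_def)

lemma xi_T: "\<xi> p \<in> T p"
  using vfields_T[OF xi_vfield] .

text \<open>From \<open>\<phi>\<^sup>2 \<xi> = 0\<close> follows \<open>\<phi>\<xi> = c \<xi>\<close> with \<open>c = \<eta>(\<phi>\<xi>)\<close>, and then \<open>0 = \<phi>\<^sup>2 \<xi> = c \<phi>\<xi>\<close>.\<close>

lemma phi_xi: "\<phi> p (\<xi> p) = 0"
proof -
  let ?x = "\<phi> p (\<xi> p)"
  have x: "?x \<in> T p" using phi_in_T[OF xi_T] .
  have 0: "\<phi> p ?x = 0" using phi_phi[OF xi_T] eta_xi by simp
  have 1: "?x = \<eta> p ?x *\<^sub>R \<xi> p" 
    using phi_phi[OF x] 0 lin_on_zero[OF phi_lin zero_in_T] by simp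
  have "\<eta> p ?x *\<^sub>R ?x = \<phi> p (\<eta> p ?x *\<^sub>R \<xi> p)"
    using lin_on_scaleR[OF phi_lin xi_T] by simp
  also have "\<dots> = 0" using 0 1 by simp
  finally have "\<eta> p ?x = 0 \<or> ?x = 0" by simp
  then show ?thesis using 1 by auto
qed

lemma eta_phi: assumes "x \<in> T p" shows "\<eta> p (\<phi> p x) = 0"
proof -
  have f: "\<phi> p x \<in> T p" using phi_in_T[OF assms] .
  have "\<phi> p (\<phi> p (\<phi> p x)) = \<phi> p (- x + \<eta> p x *\<^sub>R \<xi> p)" using phi_phi[OF assms] by simp
  also have "\<dots> = - \<phi> p x"
    using assms xi_T phi_xi
    by (simp add: lin_on_diff[OF phi_lin subspace_T] lin_on_scaleR[OF phi_lin] scaleR_in_T)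
  finally have "\<eta> p (\<phi> p x) *\<^sub>R \<xi> p = 0" using phi_phi[OF f] by simp
  then show ?thesis
    using lin_on_zero[OF eta_lin zero_in_T, of p] eta_xi[of p] by (cases "\<xi> p = 0") auto
qed

lemma g_xi: "x \<in> T p \<Longrightarrow> g p x (\<xi> p) = \<eta> p x"
  using g_phi_phi[of x p "\<xi> p"] xi_T phi_xi eta_xi g_zero_right[OF phi_in_T] by simp

lemma phi_skew: assumes "x \<in> T p" "y \<in> T p" shows "g p (\<phi> p x) y = - g p x (\<phi> p y)"
proof -
  have "g p x (\<phi> p y) = g p (\<phi> p x) (\<phi> p (\<phi> p y))"
    using g_phi_phi[OF assms(1) phi_in_T[OF assms(2)]] eta_phi[OF assms(2)] by simp
  also have "\<dots> = - g p (\<phi> p x) y"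
    using assms xi_T phi_in_T[OF assms(1)] g_xi[OF phi_in_T[OF assms(1)]] eta_phi[OF assms(1)]
    by (simp add: phi_phi g_bilinear neg_in_T scaleR_in_T)
  finally show ?thesis by simp
qed

lemma app_apply: "app \<phi> X p = \<phi> p (X p)"
  by (simp add: app_def)

lemma app_xi: "app \<phi> \<xi> = 0"
  by (simp add: fun_eq_iff app_apply phi_xi)

lemma app_app: "X \<in> vfields A \<Longrightarrow> app \<phi> (app \<phi> X) = - X + fscale (\<lambda>p. \<eta> p (X p)) \<xi>"
  by (rule ext) (simp only: app_apply phi_phi[OF vfields_T] plus_fun_apply fun_Compl_def fscale_def)

end

section \<open>The Levi-Civita connection\<close>

locale contact_connection = contact_manifold A g \<phi> \<xi> \<eta>
  for A :: "('a::{t2_space,second_countable_topology}, 'e::euclidean_space) chart set"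
    and g \<phi> \<xi> \<eta> +
  fixes D :: "'a vfield \<Rightarrow> 'a vfield \<Rightarrow> 'a vfield"
  assumes levi_civita: "levi_civita A g D"
begin

lemma D_vfield: "X \<in> vfields A \<Longrightarrow> Y \<in> vfields A \<Longrightarrow> D X Y \<in> vfields A"
  and D_add_left: "X \<in> vfields A \<Longrightarrow> X' \<in> vfields A \<Longrightarrow> Y \<in> vfields A \<Longrightarrow> D (X + X') Y = D X Y + D X' Y"
  and D_fscale_left: "f \<in> smooth_fun A \<Longrightarrow> X \<in> vfields A \<Longrightarrow> Y \<in> vfields A
    \<Longrightarrow> D (fscale f X) Y = fscale f (D X Y)"
  and D_add_right: "X \<in> vfields A \<Longrightarrow> Y \<in> vfields A \<Longrightarrow> Y' \<in> vfields A \<Longrightarrow> D X (Y + Y') = D X Y + D X Y'"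
  and D_fscale_right: "f \<in> smooth_fun A \<Longrightarrow> X \<in> vfields A \<Longrightarrow> Y \<in> vfields A
    \<Longrightarrow> D X (fscale f Y) = fscale f (D X Y) + fscale (\<lambda>p. X p f) Y"
  using levi_civita unfolding levi_civita_def connection_def by blast+

lemma torsion_free:
  assumes "X \<in> vfields A" "Y \<in> vfields A" shows "bracket X Y p = D X Y p - D Y X p"
proof -
  have "bracket X Y = D X Y - D Y X"
    using levi_civita assms unfolding levi_civita_def by simp
  then show ?thesis by (simp only: fun_diff_def)
qed

lemma metric_compatible:
  "X \<in> vfields A \<Longrightarrow> Y \<in> vfields A \<Longrightarrow> Z \<in> vfields A \<Longrightarrow>
    X p (\<lambda>q. g q (Y q) (Z q)) = g p (D X Y p) (Z p) + g p (Y p) (D X Z p)"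
  using levi_civita unfolding levi_civita_def by blast

lemma uminus_fscale: "- X = fscale (\<lambda>p. - 1) X"
  by (simp add: fun_eq_iff fscale_def)

lemma D_zero_right: "X \<in> vfields A \<Longrightarrow> D X 0 = 0"
  using D_add_right[of X 0 0] by simp

lemma D_zero_left: "X \<in> vfields A \<Longrightarrow> D 0 X = 0"
  using D_add_left[of 0 0 X] by simp

lemma D_T: "X \<in> vfields A \<Longrightarrow> Y \<in> vfields A \<Longrightarrow> D X Y p \<in> T p"
  using D_vfield vfields_T by blast

text \<open>Insert \<open>\<phi>\<^sup>2 V = - V + \<eta>(V) \<xi>\<close>. In the second slot of \<open>D\<close> the derivative of \<open>\<eta>(V)\<close> contributes a
  multiple of \<open>\<xi>\<close>, which disappears when paired with a horizontal vector.\<close>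

lemma D_phi_phi_left:
  assumes "V \<in> vfields A" "Y \<in> vfields A"
  shows "D (app \<phi> (app \<phi> V)) Y p = - D V Y p + \<eta> p (V p) *\<^sub>R D \<xi> Y p"
proof -
  have "D (app \<phi> (app \<phi> V)) Y = fscale (\<lambda>p. - 1) (D V Y) + fscale (\<lambda>p. \<eta> p (V p)) (D \<xi> Y)"
    using assms xi_vfield
    by (simp add: app_app uminus_fscale D_add_left fscale_vfield D_fscale_left eta_smooth)
  then show ?thesis by (simp add: fscale_def)
qed

lemma D_phi_phi_right:
  assumes "X \<in> vfields A" "V \<in> vfields A"
  shows "D X (app \<phi> (app \<phi> V)) p
    = - D X V p + \<eta> p (V p) *\<^sub>R D X \<xi> p + X p (\<lambda>q. \<eta> q (V q)) *\<^sub>R \<xi> p"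
proof -
  have "X p (\<lambda>q. - 1) = 0" for p using tangent_const[OF vfields_T[OF assms(1)]] .
  then have "D X (app \<phi> (app \<phi> V)) = fscale (\<lambda>p. - 1) (D X V) + fscale (\<lambda>p. \<eta> p (V p)) (D X \<xi>)
      + fscale (\<lambda>p. X p (\<lambda>q. \<eta> q (V q))) \<xi>"
    using assms xi_vfield
    by (simp add: app_app uminus_fscale D_add_right fscale_vfield D_fscale_right eta_smooth)
      (simp add: fscale_def fun_eq_iff algebra_simps)
  then show ?thesis by (simp add: fscale_def)
qed

lemma cov_endo_apply: "cov_endo D \<phi> X Y p = D X (app \<phi> Y) p - \<phi> p (D X Y p)"
  by (simp add: cov_endo_def app_def fun_diff_def)

lemma cov_endo_T: "X \<in> vfields A \<Longrightarrow> Y \<in> vfields A \<Longrightarrow> cov_endo D \<phi> X Y p \<in> T p"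
  unfolding cov_endo_apply by (intro diff_in_T D_T phi_in_T app_vfield)

text \<open>Differentiating \<open>g(\<phi>Y, Z) = - g(Y, \<phi>Z)\<close> shows that \<open>\<nabla>\<^sub>X \<phi>\<close> is skew like \<open>\<phi>\<close>.\<close>

lemma cov_endo_skew:
  assumes X: "X \<in> vfields A" and Y: "Y \<in> vfields A" and Z: "Z \<in> vfields A"
  shows "g p (cov_endo D \<phi> X Y p) (Z p) = - g p (Y p) (cov_endo D \<phi> X Z p)"
proof -
  note T = vfields_T[OF X] vfields_T[OF Y] vfields_T[OF Z] D_T[OF X Y] D_T[OF X Z]
    D_T[OF X app_vfield[OF Y]] D_T[OF X app_vfield[OF Z]]
  have "(\<lambda>q. g q (app \<phi> Y q) (Z q)) = (\<lambda>q. - g q (Y q) (app \<phi> Z q))"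
    using phi_skew T by (simp add: app_apply fun_eq_iff)
  then have "X p (\<lambda>q. g q (app \<phi> Y q) (Z q)) = - X p (\<lambda>q. g q (Y q) (app \<phi> Z q))"
    using tangent_minus[OF T(1) g_smooth[OF Y app_vfield[OF Z]]] by simp
  then have "g p (D X (app \<phi> Y) p) (Z p) + g p (\<phi> p (Y p)) (D X Z p)
      = - g p (D X Y p) (\<phi> p (Z p)) - g p (Y p) (D X (app \<phi> Z) p)"
    using metric_compatible[OF X app_vfield[OF Y] Z, of p] metric_compatible[OF X Y app_vfield[OF Z], of p]
    by (simp add: app_apply)
  then show ?thesis
    using T phi_in_T by (simp add: cov_endo_apply g_bilinear phi_skew)
qed

text \<open>As \<open>D\<close> is torsion free, the brackets in the exterior derivative turn the directional derivatives
  into a cyclic sum of covariant ones.\<close>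

lemma ext_deriv_fundamental_form:
  assumes X: "X \<in> vfields A" and U: "U \<in> vfields A" and V: "V \<in> vfields A"
  shows "ext_deriv2 (fundamental_form g \<phi>) X U V p = g p (U p) (cov_endo D \<phi> X V p)
    + g p (V p) (cov_endo D \<phi> U X p) + g p (X p) (cov_endo D \<phi> V U p)"
proof -
  note F = X U V app_vfield[OF X] app_vfield[OF U] app_vfield[OF V]
  note T = F[THEN vfields_T, of p]
  have m: "Y p (\<lambda>q. g q (Z q) (\<phi> q (W q))) = g p (D Y Z p) (\<phi> p (W p)) + g p (Z p) (D Y (app \<phi> W) p)"
    if "Y \<in> vfields A" "Z \<in> vfields A" "W \<in> vfields A" for Y Z W
    using metric_compatible[OF that(1,2) app_vfield[OF that(3)], of p] by (simp add: app_apply)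
  show ?thesis
    unfolding ext_deriv2_def fundamental_form_def cov_endo_apply
    using F T D_T phi_in_T
    by (simp add: m torsion_free g_bilinear phi_skew
        g_sym[of "U p" p "\<phi> p (D X V p)"] g_sym[of "V p" p "\<phi> p (D U X p)"] g_sym[of "X p" p "\<phi> p (D V U p)"])
qed

end

section \<open>Contact-complex Riemannian submersions\<close>

lemma push_add: "push A' \<pi> (x + y) = push A' \<pi> x + push A' \<pi> y"
  by (simp add: push_def fun_eq_iff)

lemma push_diff: "push A' \<pi> (x - y) = push A' \<pi> x - push A' \<pi> y"
  by (simp add: push_def fun_eq_iff)

lemma push_scaleR: "push A' \<pi> (c *\<^sub>R x) = c *\<^sub>R push A' \<pi> x"
  by (simp add: push_def fun_eq_iff)

lemma push_zero: "push A' \<pi> 0 = 0"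
  by (simp add: push_def fun_eq_iff)

lemma push_apply: "f \<in> smooth_fun A' \<Longrightarrow> push A' \<pi> x f = x (f \<circ> \<pi>)"
  by (simp add: push_def)

locale submersion = contact_connection A g \<phi> \<xi> \<eta> D
  for A :: "('a::{t2_space,second_countable_topology}, 'e::euclidean_space) chart set"
    and g \<phi> \<xi> \<eta> D +
  fixes A' :: "('b::{t2_space,second_countable_topology}, 'f::euclidean_space) chart set"
    and J :: "'b \<Rightarrow> 'b tvec \<Rightarrow> 'b tvec" and g' :: "'b \<Rightarrow> 'b tvec \<Rightarrow> 'b tvec \<Rightarrow> real" and \<pi> :: "'a \<Rightarrow> 'b"
  assumes submersion: "contact_complex_submersion A \<phi> \<xi> \<eta> g A' J g' \<pi>"
begin

lemma hermitian: "almost_hermitian A' J g'"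
  and riemannian_submersion: "riemannian_submersion A g A' g' \<pi>"
  and J_push: "x \<in> T p \<Longrightarrow> J (\<pi> p) (push A' \<pi> x) = push A' \<pi> (\<phi> p x)"
  using submersion by (simp_all add: contact_complex_submersion_def)

sublocale base: riemannian A' g'
  using hermitian by unfold_locales (simp_all add: almost_hermitian_def)

abbreviation "Ver \<equiv> vert A A' \<pi>"
abbreviation "Hor \<equiv> horiz A A' g \<pi>"
abbreviation "ver \<equiv> vproj A A' g \<pi>"
abbreviation "hor \<equiv> hproj A A' g \<pi>"
abbreviation "VF \<equiv> vertical_fields A A' \<pi>"
abbreviation "HF \<equiv> horizontal_fields A A' g \<pi>"
abbreviation "TT \<equiv> oneill_T A A' g \<pi> D"

lemma J_lin: "lin_on (base.T q) (J q)"
  and J_vfield: "Y \<in> vfields A' \<Longrightarrow> (\<lambda>q. J q (Y q)) \<in> vfields A'"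
  and J_J: "x \<in> base.T q \<Longrightarrow> J q (J q x) = - x"
  using hermitian by (auto simp: almost_hermitian_def endo_field_def)

lemma pi_smooth_map: "smooth_map A A' \<pi>"
  and push_onto: "push A' \<pi> ` T p = base.T (\<pi> p)"
  and push_isometry: "x \<in> Hor p \<Longrightarrow> y \<in> Hor p \<Longrightarrow> g' (\<pi> p) (push A' \<pi> x) (push A' \<pi> y) = g p x y"
  using riemannian_submersion by (simp_all add: riemannian_submersion_def)

lemma push_T: "x \<in> T p \<Longrightarrow> push A' \<pi> x \<in> base.T (\<pi> p)"
  using push_onto by blast

lemma open_pi_vimage: "open V \<Longrightarrow> open (\<pi> -` V)"
  using pi_smooth_map continuous_on_open_vimage[of UNIV \<pi>] by (auto simp: smooth_map_def)

text \<open>In charts this is the composition of \<open>f\<close> with the coordinate expression of \<open>\<pi>\<close>.\<close>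

lemma smooth_fun_pullback:
  assumes f: "f \<in> smooth_fun A'" shows "f \<circ> \<pi> \<in> smooth_fun A"
proof (rule smooth_fun_local_chart)
  fix p
  obtain V \<psi> where V: "(V, \<psi>) \<in> A'" "\<pi> p \<in> V" by (rule base.chart_at)
  obtain U \<kappa> where U: "(U, \<kappa>) \<in> A" "p \<in> U" by (rule chart_at)
  let ?W = "U \<inter> \<pi> -` V"
  have W: "open ?W"
    using open_Int[OF chart_homeo(1)[OF U(1)] open_pi_vimage[OF base.chart_homeo(1)[OF V(1)]]] .
  note oS = chart_open_image[OF U(1) W Int_lower1]
  have "\<forall>(V, \<psi>)\<in>A'. smooth_on (\<kappa> ` (U \<inter> \<pi> -` V)) (\<psi> \<circ> \<pi> \<circ> inv_into U \<kappa>)"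
    using bspec[OF pi_smooth_map[unfolded smooth_map_def, THEN conjunct2] U(1)]
    by (simp only: prod.case)
  from bspec[OF this V(1)] have s: "smooth_on (\<kappa> ` ?W) (\<psi> \<circ> \<pi> \<circ> inv_into U \<kappa>)"
    by (simp only: prod.case)
  have "(\<psi> \<circ> \<pi> \<circ> inv_into U \<kappa>) ` (\<kappa> ` ?W) \<subseteq> \<psi> ` V" using chart_inv[OF U(1)] by auto
  from smooth_on_compose[OF oS base.chart_homeo(2)[OF V(1)] this base.smooth_funD[OF V(1) f] s]
  have "smooth_on (\<kappa> ` ?W) (\<lambda>x. (f \<circ> inv_into V \<psi>) ((\<psi> \<circ> \<pi> \<circ> inv_into U \<kappa>) x))" .
  then have "smooth_on (\<kappa> ` ?W) (f \<circ> \<pi> \<circ> inv_into U \<kappa>)"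
    by (rule smooth_on_cong[OF oS, rotated])
      (use chart_inv[OF U(1)] base.chart_inv[OF V(1)] in auto)
  then show "\<exists>(U, \<kappa>)\<in>A. \<exists>W. open W \<and> p \<in> W \<and> W \<subseteq> U \<and> smooth_on (\<kappa> ` W) (f \<circ> \<pi> \<circ> inv_into U \<kappa>)"
    using U W V by (intro bexI[OF _ U(1)]) auto
qed

subsection \<open>Vertical and horizontal vectors\<close>

lemma VerD: "x \<in> Ver p \<Longrightarrow> x \<in> T p"
  and HorD: "x \<in> Hor p \<Longrightarrow> x \<in> T p"
  and Ver_push: "x \<in> Ver p \<Longrightarrow> push A' \<pi> x = 0"
  and g_Hor_Ver: "x \<in> Hor p \<Longrightarrow> u \<in> Ver p \<Longrightarrow> g p x u = 0"
  by (simp_all add: vert_def horiz_def)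

lemma g_Ver_Hor: "x \<in> Hor p \<Longrightarrow> u \<in> Ver p \<Longrightarrow> g p u x = 0"
  using g_Hor_Ver g_sym VerD HorD by metis

lemma subspace_Ver: "subspace (Ver p)"
  by (simp add: subspace_def vert_def push_add push_scaleR push_zero add_in_T scaleR_in_T)

lemma subspace_Hor: "subspace (Hor p)"
  by (simp add: subspace_def horiz_def vert_def g_bilinear add_in_T scaleR_in_T)

lemma Ver_Hor_zero: "x \<in> Ver p \<Longrightarrow> x \<in> Hor p \<Longrightarrow> x = 0"
  using g_Hor_Ver[of x p x] g_pos[of x p] VerD by fastforce

text \<open>This justifies the definite descriptions in the two projections.\<close>

lemma decompose:
  assumes "x \<in> T p" obtains u where "u \<in> Ver p" "x - u \<in> Hor p"
proof -
  obtain u where u: "u \<in> Ver p" "\<And>c. c \<in> Ver p \<Longrightarrow> g p (x - u) c = 0"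
    using orth_proj[OF subspace_Ver _ assms] VerD by blast
  then have "x - u \<in> Hor p" using diff_in_T[OF assms VerD] by (simp add: horiz_def)
  then show thesis using that u(1) by blast
qed

lemma decompose_unique:
  assumes "u \<in> Ver p" "x - u \<in> Hor p" "w \<in> Ver p" "x - w \<in> Hor p"
  shows "u = w"
proof -
  have "u - w \<in> Ver p" using subspace_diff[OF subspace_Ver] assms by blast
  moreover have "(x - w) - (x - u) \<in> Hor p" using subspace_diff[OF subspace_Hor] assms by blast
  ultimately show ?thesis using Ver_Hor_zero[of "u - w"] by simp
qed

lemma ver_eqI: "u \<in> Ver p \<Longrightarrow> X p - u \<in> Hor p \<Longrightarrow> ver X p = u"
  unfolding vproj_def using decompose_unique by blast

lemma hor_eqI: assumes "x \<in> Hor p" "X p - x \<in> Ver p" shows "hor X p = x"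
  unfolding hproj_def
proof (rule the_equality)
  fix y assume y: "y \<in> Hor p \<and> X p - y \<in> Ver p"
  have "X p - x = X p - y" by (rule decompose_unique[of _ _ "X p"]) (use y assms in auto)
  then show "y = x" by simp
qed (use assms in simp)

lemma ver_in: assumes "X p \<in> T p" shows "ver X p \<in> Ver p" "X p - ver X p \<in> Hor p"
proof -
  obtain u where u: "u \<in> Ver p" "X p - u \<in> Hor p" using decompose[OF assms] .
  then show "ver X p \<in> Ver p" "X p - ver X p \<in> Hor p" using ver_eqI[of u p X, OF u] u by simp_all
qed

lemma hor_in: assumes "X p \<in> T p" shows "hor X p \<in> Hor p" "X p - hor X p \<in> Ver p"
proof -
  obtain u where u: "u \<in> Ver p" "X p - u \<in> Hor p" using decompose[OF assms] .
  then have "hor X p = X p - u" using hor_eqI[of "X p - u" p X] by simp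
  then show "hor X p \<in> Hor p" "X p - hor X p \<in> Ver p" using u by simp_all
qed

lemma g_ver: assumes "X p \<in> T p" "u \<in> Ver p" shows "g p (ver X p) u = g p (X p) u"
  using g_Hor_Ver[OF ver_in(2)[of X p, OF assms(1)] assms(2)] ver_in(1)[of X p, OF assms(1)] assms VerD
  by (simp add: g_bilinear)

lemma g_hor: assumes "X p \<in> T p" "x \<in> Hor p" shows "g p (hor X p) x = g p (X p) x"
  using g_Ver_Hor[OF assms(2) hor_in(2)[of X p, OF assms(1)]] hor_in(1)[of X p, OF assms(1)] assms HorD
  by (simp add: g_bilinear)

text \<open>\<open>J\<close> is injective and kills the image of \<open>\<xi>\<close>, as \<open>J \<pi>\<^sub>* \<xi> = \<pi>\<^sub>* \<phi>\<xi> = 0\<close>.\<close>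

lemma push_xi: "push A' \<pi> (\<xi> p) = 0"
proof -
  have "J (\<pi> p) (push A' \<pi> (\<xi> p)) = 0" using J_push[OF xi_T] by (simp add: phi_xi push_zero)
  then have "- push A' \<pi> (\<xi> p) = J (\<pi> p) 0" using J_J[OF push_T[OF xi_T[of p]]] by simp
  then show ?thesis using lin_on_zero[OF J_lin base.zero_in_T] by simp
qed

lemma xi_Ver: "\<xi> p \<in> Ver p"
  by (simp add: vert_def xi_T push_xi)

lemma phi_Ver: "u \<in> Ver p \<Longrightarrow> \<phi> p u \<in> Ver p"
  using J_push[of u p] lin_on_zero[OF J_lin base.zero_in_T] by (simp add: vert_def phi_in_T)

lemma phi_Hor: "x \<in> Hor p \<Longrightarrow> \<phi> p x \<in> Hor p"
  using phi_Ver[of _ p] by (auto simp: horiz_def vert_def phi_in_T phi_skew)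

lemma VF_vfield: "U \<in> VF \<Longrightarrow> U \<in> vfields A"
  and VF_Ver: "U \<in> VF \<Longrightarrow> U p \<in> Ver p"
  and HF_vfield: "X \<in> HF \<Longrightarrow> X \<in> vfields A"
  and HF_Hor: "X \<in> HF \<Longrightarrow> X p \<in> Hor p"
  by (simp_all add: vertical_fields_def horizontal_fields_def)

lemma xi_VF: "\<xi> \<in> VF"
  by (simp add: vertical_fields_def xi_vfield xi_Ver)

lemma app_VF: "U \<in> VF \<Longrightarrow> app \<phi> U \<in> VF"
  by (simp add: vertical_fields_def app_vfield app_apply phi_Ver)

lemma app_HF: "X \<in> HF \<Longrightarrow> app \<phi> X \<in> HF"
  by (simp add: horizontal_fields_def app_vfield app_apply phi_Hor)

lemma ver_VF: "U \<in> VF \<Longrightarrow> ver U = U"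
  by (rule ext, rule ver_eqI) (simp_all add: VF_Ver subspace_0[OF subspace_Hor])

lemma hor_VF: "U \<in> VF \<Longrightarrow> hor U = 0"
  by (rule ext, rule hor_eqI) (simp_all add: VF_Ver subspace_0[OF subspace_Hor])

lemma ver_HF: "X \<in> HF \<Longrightarrow> ver X = 0"
  by (rule ext, rule ver_eqI) (simp_all add: HF_Hor subspace_0[OF subspace_Ver])

lemma hor_HF: "X \<in> HF \<Longrightarrow> hor X = X"
  by (rule ext, rule hor_eqI) (simp_all add: HF_Hor subspace_0[OF subspace_Ver])

lemma zero_VF: "0 \<in> VF"
  by (simp add: vertical_fields_def subspace_0[OF subspace_Ver])

lemma zero_HF: "0 \<in> HF"
  by (simp add: horizontal_fields_def subspace_0[OF subspace_Hor])

text \<open>Between fields that are vertical or horizontal, each value of the O'Neill invariant needed below is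
  one projection of a covariant derivative.\<close>

lemma oneill_T_VF_VF: "U \<in> VF \<Longrightarrow> V \<in> VF \<Longrightarrow> TT U V p = hor (D U V) p"
  by (simp add: oneill_T_def ver_VF hor_VF D_zero_right VF_vfield ver_HF[OF zero_HF])

lemma oneill_T_VF_HF: "U \<in> VF \<Longrightarrow> X \<in> HF \<Longrightarrow> TT U X p = ver (D U X) p"
  by (simp add: oneill_T_def ver_VF ver_HF hor_HF D_zero_right VF_vfield hor_VF[OF zero_VF])

subsection \<open>Brackets with vertical fields\<close>

lemma VF_pullback: assumes "U \<in> VF" "f \<in> smooth_fun A'" shows "U q (f \<circ> \<pi>) = 0"
  using fun_cong[OF Ver_push[OF VF_Ver[OF assms(1), of q]], of f] push_apply[OF assms(2), of \<pi> "U q"] by simp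

lemma bracket_VF: assumes "U \<in> VF" "V \<in> VF" shows "bracket U V p \<in> Ver p"
proof -
  note UV = VF_vfield[OF assms(1)] VF_vfield[OF assms(2)]
  have "push A' \<pi> (bracket U V p) f = 0" for f
  proof (cases "f \<in> smooth_fun A'")
    case True
    have "(\<lambda>q. U q (f \<circ> \<pi>)) = (\<lambda>q. 0)" "(\<lambda>q. V q (f \<circ> \<pi>)) = (\<lambda>q. 0)"
      using VF_pullback[OF assms(1) True] VF_pullback[OF assms(2) True] by simp_all
    then show ?thesis
      using tangent_const[OF vfields_T[OF UV(1)], of p 0] tangent_const[OF vfields_T[OF UV(2)], of p 0] True
      by (simp add: push_def bracket_def)
  qed (simp add: push_def)
  then show ?thesis
    using vfields_T[OF bracket_vfield[OF UV]] by (simp add: vert_def fun_eq_iff)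
qed

text \<open>As \<open>\<phi>\<close> projects to \<open>J\<close>, the Lie derivative of \<open>\<phi>\<close> along \<open>W\<close> projects to zero: for \<open>f\<close> on the base,
  the 1-form \<open>df \<circ> J\<close> is a combination of the \<open>d(y b)\<close> with smooth coefficients in a local frame of the
  base. With \<open>a b\<close> the pullbacks of these coefficients, \<open>(\<phi>X)(f \<circ> \<pi>) = \<Sum>b. X(y b \<circ> \<pi>) \<cdot> a b\<close> near \<open>p\<close>,
  and \<open>W\<close> does not differentiate the \<open>a b\<close>, which are constant along the fibres.\<close>

lemma phi_bracket_Ver:
  assumes X: "X \<in> vfields A" and W: "W \<in> VF"
  shows "bracket (app \<phi> X) W p - \<phi> p (bracket X W p) \<in> Ver p"
proof -
  note Wv = VF_vfield[OF W] and Wp = vfields_T[OF VF_vfield[OF W], of p]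
  obtain N E y where N: "open N" "\<pi> p \<in> N"
    and E: "\<And>b. b \<in> Basis \<Longrightarrow> E (b::'f) \<in> vfields A'"
    and y: "\<And>b. b \<in> Basis \<Longrightarrow> y b \<in> smooth_fun A'"
    and w: "\<And>q w. q \<in> N \<Longrightarrow> w \<in> base.T q \<Longrightarrow> w = (\<Sum>b\<in>Basis. w (y b) *\<^sub>R E b q)"
    by (rule base.local_frame[of "\<pi> p"]) (rule that)
  have push_phi: "\<phi> q z (f \<circ> \<pi>) = (\<Sum>b\<in>Basis. z (y b \<circ> \<pi>) * J (\<pi> q) (E b (\<pi> q)) f)"
    if "\<pi> q \<in> N" "z \<in> T q" "f \<in> smooth_fun A'" for q z f
  proof -
    have "\<phi> q z (f \<circ> \<pi>) = J (\<pi> q) (push A' \<pi> z) f"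
      using J_push[OF that(2)] push_apply[OF that(3), of \<pi> "\<phi> q z"] by simp
    also have "push A' \<pi> z = (\<Sum>b\<in>Basis. z (y b \<circ> \<pi>) *\<^sub>R E b (\<pi> q))"
      by (subst w[OF that(1) push_T[OF that(2)]]) (simp add: push_apply y)
    also have "J (\<pi> q) \<dots> = (\<Sum>b\<in>Basis. z (y b \<circ> \<pi>) *\<^sub>R J (\<pi> q) (E b (\<pi> q)))"
      by (rule lin_on_sum[OF J_lin base.subspace_T]) (simp add: base.vfields_T E)
    finally show ?thesis by (simp add: sum_apply comp_def)
  qed
  have "push A' \<pi> (bracket (app \<phi> X) W p) f = push A' \<pi> (\<phi> p (bracket X W p)) f" for f
  proof (cases "f \<in> smooth_fun A'")
    case True
    define a where "a b = (\<lambda>q. J q (E b q) f) \<circ> \<pi>" for b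
    have a': "(\<lambda>q. J q (E b q) f) \<in> smooth_fun A'" if "b \<in> Basis" for b
      using base.vfields_smooth[OF J_vfield[OF E[OF that]] True] .
    have a: "a b \<in> smooth_fun A" if "b \<in> Basis" for b
      unfolding a_def by (rule smooth_fun_pullback[OF a'[OF that]])
    have Wa: "W p (a b) = 0" if "b \<in> Basis" for b
      unfolding a_def by (rule VF_pullback[OF W a'[OF that]])
    have yp: "y b \<circ> \<pi> \<in> smooth_fun A" if "b \<in> Basis" for b
      by (rule smooth_fun_pullback[OF y[OF that]])
    have Xy: "(\<lambda>q. X q (y b \<circ> \<pi>)) \<in> smooth_fun A" if "b \<in> Basis" for b
      by (rule vfields_smooth[OF X yp[OF that]])
    have s: "(\<lambda>q. X q (y b \<circ> \<pi>) * a b q) \<in> smooth_fun A" if "b \<in> Basis" for b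
      by (rule smooth_fun_mult[OF Xy[OF that] a[OF that]])
    have "W p (\<lambda>q. app \<phi> X q (f \<circ> \<pi>)) = W p (\<lambda>q. \<Sum>b\<in>Basis. X q (y b \<circ> \<pi>) * a b q)"
    proof (rule tangent_local[OF Wp])
      show "(\<lambda>q. app \<phi> X q (f \<circ> \<pi>)) \<in> smooth_fun A"
        by (rule vfields_smooth[OF app_vfield[OF X] smooth_fun_pullback[OF True]])
      show "(\<lambda>q. \<Sum>b\<in>Basis. X q (y b \<circ> \<pi>) * a b q) \<in> smooth_fun A"
        by (rule smooth_fun_sum[OF s])
      show "open (\<pi> -` N)" by (rule open_pi_vimage[OF N(1)])
      show "p \<in> \<pi> -` N" using N(2) by simp
      show "app \<phi> X q (f \<circ> \<pi>) = (\<Sum>b\<in>Basis. X q (y b \<circ> \<pi>) * a b q)" if "q \<in> \<pi> -` N" for q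
        using push_phi[OF _ vfields_T[OF X] True, of q] that by (simp add: app_apply a_def)
    qed
    also have "\<dots> = (\<Sum>b\<in>Basis. W p (\<lambda>q. X q (y b \<circ> \<pi>) * a b q))"
      by (rule tangent_sum[OF Wp s])
    also have "\<dots> = (\<Sum>b\<in>Basis. W p (\<lambda>q. X q (y b \<circ> \<pi>)) * a b p)"
      by (rule sum.cong[OF refl]) (simp add: tangent_mult[OF Wp Xy a] Wa)
    finally have 1: "W p (\<lambda>q. app \<phi> X q (f \<circ> \<pi>)) = \<dots>" .
    have W0: "(\<lambda>q. W q (h \<circ> \<pi>)) = (\<lambda>q. 0)" if "h \<in> smooth_fun A'" for h
      using VF_pullback[OF W that] by simp
    have "bracket (app \<phi> X) W p (f \<circ> \<pi>) = - W p (\<lambda>q. app \<phi> X q (f \<circ> \<pi>))"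
      unfolding bracket_def W0[OF True]
      using tangent_const[OF vfields_T[OF app_vfield[OF X]], of p 0] by simp
    moreover have "\<phi> p (bracket X W p) (f \<circ> \<pi>)
        = (\<Sum>b\<in>Basis. bracket X W p (y b \<circ> \<pi>) * a b p)"
      using push_phi[OF N(2) vfields_T[OF bracket_vfield[OF X Wv]] True] by (simp add: a_def)
    moreover have "bracket X W p (y b \<circ> \<pi>) = - W p (\<lambda>q. X q (y b \<circ> \<pi>))" if "b \<in> Basis" for b
      unfolding bracket_def W0[OF y[OF that]]
      using tangent_const[OF vfields_T[OF X], of p 0] by simp
    ultimately show ?thesis using 1 True by (simp add: push_apply sum_negf)
  qed (simp add: push_def)
  then have "push A' \<pi> (bracket (app \<phi> X) W p - \<phi> p (bracket X W p)) = 0"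
    by (simp add: push_diff ext)
  moreover have "bracket (app \<phi> X) W p - \<phi> p (bracket X W p) \<in> T p"
    by (intro diff_in_T phi_in_T vfields_T bracket_vfield app_vfield X Wv)
  ultimately show ?thesis by (simp add: vert_def)
qed

text \<open>The terms of the Nijenhuis tensor pair up into two instances of \<open>phi_bracket_Ver\<close>.\<close>

lemma nijenhuis_Ver:
  assumes X: "X \<in> vfields A" and W: "W \<in> VF"
  shows "nijenhuis \<phi> X W p \<in> Ver p"
proof -
  note Wv = VF_vfield[OF W]
  have T: "bracket (app \<phi> X) W p \<in> T p" "\<phi> p (bracket X W p) \<in> T p"
    by (intro phi_in_T vfields_T bracket_vfield app_vfield X Wv)+
  have "nijenhuis \<phi> X W p = (bracket (app \<phi> X) (app \<phi> W) p - \<phi> p (bracket X (app \<phi> W) p))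
      - \<phi> p (bracket (app \<phi> X) W p - \<phi> p (bracket X W p))"
    by (simp add: nijenhuis_def app_apply lin_on_diff[OF phi_lin subspace_T T])
  moreover have "\<dots> \<in> Ver p"
    by (intro subspace_diff[OF subspace_Ver] phi_bracket_Ver phi_Ver X W app_VF)
  ultimately show ?thesis by simp
qed

text \<open>Near \<open>p\<close> the 1-form dual to \<open>X\<close> is \<open>\<Sum>b. c b \<cdot> d(y b \<circ> \<pi>)\<close>, because on horizontal vectors \<open>g\<close> is the
  pullback of the metric of the base. Such a form has no exterior derivative on pairs of vertical
  vectors. Only the value of \<open>V\<close> at \<open>p\<close> has to be vertical, so that \<open>V\<close> can be any extension of a
  given vertical vector.\<close>

lemma g_HF_bracket:
  assumes X: "X \<in> HF" and U: "U \<in> VF" and V: "V \<in> vfields A" and Vp: "V p \<in> Ver p"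
  shows "g p (X p) (bracket U V p) = U p (\<lambda>q. g q (X q) (V q))"
proof -
  note Uv = VF_vfield[OF U] and Up = vfields_T[OF VF_vfield[OF U], of p] and Xv = HF_vfield[OF X]
  obtain N E y where N: "open N" "\<pi> p \<in> N"
    and E: "\<And>b. b \<in> Basis \<Longrightarrow> E (b::'f) \<in> vfields A'"
    and y: "\<And>b. b \<in> Basis \<Longrightarrow> y b \<in> smooth_fun A'"
    and w: "\<And>q w. q \<in> N \<Longrightarrow> w \<in> base.T q \<Longrightarrow> w = (\<Sum>b\<in>Basis. w (y b) *\<^sub>R E b q)"
    by (rule base.local_frame[of "\<pi> p"]) (rule that)
  have yp: "y b \<circ> \<pi> \<in> smooth_fun A" if "b \<in> Basis" for b
    by (rule smooth_fun_pullback[OF y[OF that]])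
  define c where "c b q = (\<Sum>d\<in>Basis. X q (y d \<circ> \<pi>) * ((\<lambda>q. g' q (E d q) (E b q)) \<circ> \<pi>) q)" for b q
  have c: "c b \<in> smooth_fun A" if "b \<in> Basis" for b
    unfolding c_def
    by (intro smooth_fun_sum smooth_fun_mult vfields_smooth[OF Xv yp] smooth_fun_pullback base.g_smooth E that)
  have gX: "g q (X q) z = (\<Sum>b\<in>Basis. c b q * z (y b \<circ> \<pi>))" if q: "\<pi> q \<in> N" and z: "z \<in> T q" for q z
  proof -
    have Eq: "E b (\<pi> q) \<in> base.T (\<pi> q)" if "b \<in> Basis" for b
      using base.vfields_T[OF E[OF that]] .
    have p': "push A' \<pi> x = (\<Sum>b\<in>Basis. x (y b \<circ> \<pi>) *\<^sub>R E b (\<pi> q))" if "x \<in> T q" for x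
      by (subst w[OF q push_T[OF that]]) (simp add: push_apply y)
    obtain u where u: "u \<in> Ver q" "z - u \<in> Hor q" using decompose[OF z] .
    have "push A' \<pi> z = push A' \<pi> ((z - u) + u)" by simp
    then have pz: "push A' \<pi> (z - u) = push A' \<pi> z"
      unfolding push_add Ver_push[OF u(1)] by simp
    have "g q (X q) z = g q (X q) (z - u)"
      using g_Hor_Ver[OF HF_Hor[OF X] u(1)] z VerD[OF u(1)] HorD[OF HF_Hor[OF X]] by (simp add: g_bilinear)
    also have "\<dots> = g' (\<pi> q) (push A' \<pi> (X q)) (push A' \<pi> z)"
      using push_isometry[OF HF_Hor[OF X] u(2)] pz by simp
    also have "push A' \<pi> z = (\<Sum>b\<in>Basis. z (y b \<circ> \<pi>) *\<^sub>R E b (\<pi> q))" by (rule p'[OF z])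
    also have "g' (\<pi> q) (push A' \<pi> (X q)) \<dots> = (\<Sum>b\<in>Basis. z (y b \<circ> \<pi>) *\<^sub>R g' (\<pi> q) (push A' \<pi> (X q)) (E b (\<pi> q)))"
      by (rule lin_on_sum[OF base.g_lin[OF push_T[OF vfields_T[OF Xv]]] base.subspace_T Eq])
    also have "\<dots> = (\<Sum>b\<in>Basis. c b q * z (y b \<circ> \<pi>))"
    proof (rule sum.cong[OF refl])
      fix b :: 'f assume b: "b \<in> Basis"
      have "g' (\<pi> q) (push A' \<pi> (X q)) (E b (\<pi> q)) = (\<Sum>d\<in>Basis. X q (y d \<circ> \<pi>) *\<^sub>R g' (\<pi> q) (E d (\<pi> q)) (E b (\<pi> q)))"
        unfolding p'[OF vfields_T[OF Xv]]
        by (rule lin_on_sum[OF base.g_lin_left[OF Eq[OF b]] base.subspace_T Eq])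
      then show "z (y b \<circ> \<pi>) *\<^sub>R g' (\<pi> q) (push A' \<pi> (X q)) (E b (\<pi> q)) = c b q * z (y b \<circ> \<pi>)"
        by (simp add: c_def)
    qed
    finally show ?thesis .
  qed
  have Vy: "(\<lambda>q. V q (y b \<circ> \<pi>)) \<in> smooth_fun A" if "b \<in> Basis" for b
    by (rule vfields_smooth[OF V yp[OF that]])
  have s: "(\<lambda>q. c b q * V q (y b \<circ> \<pi>)) \<in> smooth_fun A" if "b \<in> Basis" for b
    by (rule smooth_fun_mult[OF c[OF that] Vy[OF that]])
  have V0: "V p (y b \<circ> \<pi>) = 0" if "b \<in> Basis" for b
    using fun_cong[OF Ver_push[OF Vp], of "y b"] push_apply[OF y[OF that], of \<pi> "V p"] by simp
  have "U p (\<lambda>q. g q (X q) (V q)) = U p (\<lambda>q. \<Sum>b\<in>Basis. c b q * V q (y b \<circ> \<pi>))"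
  proof (rule tangent_local[OF Up])
    show "(\<lambda>q. g q (X q) (V q)) \<in> smooth_fun A" by (rule g_smooth[OF Xv V])
    show "(\<lambda>q. \<Sum>b\<in>Basis. c b q * V q (y b \<circ> \<pi>)) \<in> smooth_fun A" by (rule smooth_fun_sum[OF s])
    show "open (\<pi> -` N)" by (rule open_pi_vimage[OF N(1)])
    show "p \<in> \<pi> -` N" using N(2) by simp
    show "g q (X q) (V q) = (\<Sum>b\<in>Basis. c b q * V q (y b \<circ> \<pi>))" if "q \<in> \<pi> -` N" for q
      using gX[OF _ vfields_T[OF V], of q] that by simp
  qed
  also have "\<dots> = (\<Sum>b\<in>Basis. U p (\<lambda>q. c b q * V q (y b \<circ> \<pi>)))"
    by (rule tangent_sum[OF Up s])
  also have "\<dots> = (\<Sum>b\<in>Basis. c b p * bracket U V p (y b \<circ> \<pi>))"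
  proof (rule sum.cong[OF refl])
    fix b :: 'f assume b: "b \<in> Basis"
    have "(\<lambda>q. U q (y b \<circ> \<pi>)) = (\<lambda>q. 0)" using VF_pullback[OF U y[OF b]] by simp
    then have "bracket U V p (y b \<circ> \<pi>) = U p (\<lambda>q. V q (y b \<circ> \<pi>))"
      using tangent_const[OF vfields_T[OF V], of p 0] by (simp add: bracket_def)
    then show "U p (\<lambda>q. c b q * V q (y b \<circ> \<pi>)) = c b p * bracket U V p (y b \<circ> \<pi>)"
      using tangent_mult[OF Up c[OF b] Vy[OF b]] V0[OF b] by simp
  qed
  also have "\<dots> = g p (X p) (bracket U V p)"
    using gX[OF N(2) vfields_T[OF bracket_vfield[OF Uv V]]] by simp
  finally show ?thesis by simp
qed

text \<open>Symmetry of the second fundamental form of the fibres, in a form that allows \<open>V\<close> to be vertical at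
  the single point \<open>p\<close>.\<close>

lemma D_VF_HF:
  assumes X: "X \<in> HF" and U: "U \<in> VF" and V: "V \<in> vfields A" and Vp: "V p \<in> Ver p"
  shows "g p (D U X p) (V p) = - g p (X p) (D V U p)"
proof -
  note Uv = VF_vfield[OF U] and Xv = HF_vfield[OF X]
  have "g p (X p) (D U V p) - g p (X p) (D V U p) = g p (D U X p) (V p) + g p (X p) (D U V p)"
    using g_HF_bracket[OF X U V Vp] metric_compatible[OF Uv Xv V, of p] torsion_free[OF Uv V]
    by (simp add: g_bilinear vfields_T[OF Xv] D_T Uv V)
  then show ?thesis by simp
qed

end

section \<open>The mixed components of \<open>\<nabla>\<phi>\<close>\<close>

context submersion
begin

text \<open>Identities between vertical vectors are tested against arbitrary vertical vectors, those between
  horizontal ones against arbitrary horizontal vectors; a test vector is extended to a field by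
  \<open>exists_vfield\<close> without control over the extension. So one of the two fields may be of the right
  type only at \<open>p\<close>. The third field in the lemmas below is always a vertical one.\<close>

definition adapted :: "'a \<Rightarrow> 'a vfield \<Rightarrow> 'a vfield \<Rightarrow> bool" where
  "adapted p X V \<longleftrightarrow> X \<in> vfields A \<and> V \<in> vfields A \<and> X p \<in> Hor p \<and> V p \<in> Ver p \<and> (X \<in> HF \<or> V \<in> VF)"

lemma adapted_app_right: "adapted p X V \<Longrightarrow> adapted p X (app \<phi> V)"
  and adapted_xi: "adapted p X V \<Longrightarrow> adapted p X \<xi>"
  by (auto simp: adapted_def app_vfield app_VF app_HF app_apply phi_Ver phi_Hor xi_VF xi_vfield xi_Ver)

lemma D_commute_VF:
  assumes "x \<in> Hor p" "U \<in> VF" "V \<in> VF"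
  shows "g p x (D U V p) = g p x (D V U p)"
  using g_Hor_Ver[OF assms(1) bracket_VF[OF assms(2,3)]] torsion_free[of U V p] assms
  by (simp add: g_bilinear D_T VF_vfield HorD)

text \<open>If \<open>X\<close> is a horizontal field, this is \<open>D_VF_HF\<close> applied to \<open>\<phi>X\<close> and to \<open>X\<close>. If \<open>V\<close> is a vertical
  field, \<open>\<nabla>\<^sub>U \<phi>\<close> is moved to \<open>V\<close> by skewness and the fields are interchanged by \<open>D_commute_VF\<close>.\<close>

lemma cov_endo_Ver_Hor:
  assumes ad: "adapted p X V" and U: "U \<in> VF"
  shows "g p (V p) (cov_endo D \<phi> U X p) = - g p (\<phi> p (X p)) (D V U p) - g p (X p) (D (app \<phi> V) U p)"
proof -
  have X: "X \<in> vfields A" "X p \<in> Hor p" and V: "V \<in> vfields A" "V p \<in> Ver p"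
    using ad by (auto simp: adapted_def)
  note Uv = VF_vfield[OF U]
  note T = X(1)[THEN vfields_T, of p] V(1)[THEN vfields_T, of p] D_T phi_in_T app_vfield X(1) V(1) Uv
  show ?thesis
  proof (cases "X \<in> HF")
    case True
    have "g p (D U (app \<phi> X) p) (V p) = - g p (\<phi> p (X p)) (D V U p)"
      using D_VF_HF[OF app_HF[OF True] U V] by (simp add: app_apply)
    moreover have "g p (D U X p) (\<phi> p (V p)) = - g p (X p) (D (app \<phi> V) U p)"
      using D_VF_HF[OF True U app_vfield[OF V(1)]] phi_Ver[OF V(2)] by (simp add: app_apply)
    ultimately show ?thesis
      using T by (simp add: cov_endo_apply g_bilinear phi_skew g_sym[of "V p" p])
  next
    case False
    then have VF: "V \<in> VF" using ad by (simp add: adapted_def)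
    have "g p (V p) (cov_endo D \<phi> U X p) = - g p (X p) (cov_endo D \<phi> U V p)"
      using cov_endo_skew[OF Uv V(1) X(1), of p] g_sym[OF T(1) cov_endo_T[OF Uv V(1)]] by simp
    also have "\<dots> = - g p (X p) (D U (app \<phi> V) p) + g p (X p) (\<phi> p (D U V p))"
      using T by (simp add: cov_endo_apply g_bilinear)
    also have "g p (X p) (\<phi> p (D U V p)) = - g p (\<phi> p (X p)) (D U V p)"
      using T by (simp add: phi_skew)
    also have "g p (\<phi> p (X p)) (D U V p) = g p (\<phi> p (X p)) (D V U p)"
      by (rule D_commute_VF[OF phi_Hor[OF X(2)] U VF])
    also have "g p (X p) (D U (app \<phi> V) p) = g p (X p) (D (app \<phi> V) U p)"
      by (rule D_commute_VF[OF X(2) U app_VF[OF VF]])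
    finally show ?thesis by simp
  qed
qed

end

section \<open>Submersions with \<open>d\<Phi> = - 2 \<omega> \<and> \<Phi>\<close>\<close>

locale lee_submersion = submersion +
  fixes \<omega> :: "'a vfield \<Rightarrow> 'a \<Rightarrow> real"
  assumes ext_deriv: "\<And>X Y Z p. X \<in> vfields A \<Longrightarrow> Y \<in> vfields A \<Longrightarrow> Z \<in> vfields A \<Longrightarrow>
    ext_deriv2 (fundamental_form g \<phi>) X Y Z p = - 2 * wedge12 \<omega> (fundamental_form g \<phi>) X Y Z p"
begin

text \<open>Of the wedge product only the term with \<open>\<omega> X\<close> survives, since \<open>\<phi>\<close> preserves the vertical and the
  horizontal spaces, which are orthogonal.\<close>

lemma ext_deriv_adapted:
  assumes ad: "adapted p X V" and U: "U \<in> VF"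
  shows "g p (U p) (cov_endo D \<phi> X V p) = g p (X p) (D (app \<phi> V) U p) - g p (X p) (D V (app \<phi> U) p)
    - 2 * \<omega> X p * g p (U p) (\<phi> p (V p))"
proof -
  have X: "X \<in> vfields A" "X p \<in> Hor p" and V: "V \<in> vfields A" "V p \<in> Ver p"
    using ad by (auto simp: adapted_def)
  note Uv = VF_vfield[OF U]
  note T = X(1)[THEN vfields_T, of p] D_T phi_in_T app_vfield X(1) V(1) Uv
  have "g p (V p) (\<phi> p (X p)) = 0" "g p (X p) (\<phi> p (U p)) = 0"
    using g_Ver_Hor[OF phi_Hor[OF X(2)] V(2)] g_Hor_Ver[OF X(2) phi_Ver[OF VF_Ver[OF U]]] by auto
  then have "ext_deriv2 (fundamental_form g \<phi>) X U V p = - 2 * \<omega> X p * g p (U p) (\<phi> p (V p))"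
    using ext_deriv[OF X(1) Uv V(1)] by (simp add: wedge12_def fundamental_form_def)
  moreover have "g p (X p) (cov_endo D \<phi> V U p) = g p (X p) (D V (app \<phi> U) p) + g p (\<phi> p (X p)) (D V U p)"
    using T by (simp add: cov_endo_apply g_bilinear phi_skew)
  ultimately show ?thesis
    using ext_deriv_fundamental_form[OF X(1) Uv V(1), of p] cov_endo_Ver_Hor[OF ad U] by simp
qed

text \<open>Write \<open>P(V, U)\<close> for the left-hand side. The value \<open>d\<Phi>(X, U, V)\<close> does not change if \<open>\<phi>U\<close>, \<open>\<phi>V\<close> replace
  \<open>U\<close>, \<open>V\<close>; by \<open>ext_deriv_adapted\<close> this determines \<open>P(\<phi>V, \<phi>U) - P(V, U)\<close>. On the other hand
  \<open>\<phi> \<circ> \<nabla>\<phi> + \<nabla>\<phi> \<circ> \<phi> = \<nabla>(\<phi>\<^sup>2)\<close> determines \<open>P(\<phi>V, \<phi>U) + P(V, U)\<close>. The two relations together give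
  \<open>P(V, U)\<close>, and \<open>\<omega>\<close> cancels.\<close>

lemma cov_endo_Hor_Ver:
  assumes ad: "adapted p X V" and U: "U \<in> VF"
  shows "g p (U p) (cov_endo D \<phi> X V p) =
    \<eta> p (U p) * g p (X p) (D (app \<phi> V) \<xi> p) - \<eta> p (V p) * g p (X p) (D \<xi> (app \<phi> U) p)"
proof -
  have X: "X \<in> vfields A" "X p \<in> Hor p" and V: "V \<in> vfields A" "V p \<in> Ver p"
    using ad by (auto simp: adapted_def)
  note Uv = VF_vfield[OF U]
  note fields = X(1) V(1) Uv xi_vfield app_vfield
  note T = fields(1-4)[THEN vfields_T, of p] phi_in_T D_T fields
  let ?c = "cov_endo D \<phi> X V p"
  have cT: "?c \<in> T p" by (rule cov_endo_T[OF X(1) V(1)])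
  let ?x1 = "g p (X p) (D \<xi> (app \<phi> U) p)" and ?x2 = "g p (X p) (D (app \<phi> V) \<xi> p)"
  have X\<xi>: "g p (X p) (\<xi> p) = 0" by (rule g_Hor_Ver[OF X(2) xi_Ver])
  \<comment> \<open>Both facts are the vanishing of \<open>d\<Phi>\<close> when one argument is \<open>\<xi>\<close> and the others are \<open>X\<close> and
    a vertical vector.\<close>
  have 1: "g p (\<xi> p) ?c = ?x2"
    using ext_deriv_adapted[OF ad xi_VF] T g_sym[of "\<xi> p" p "\<phi> p (V p)"] g_xi[of "\<phi> p (V p)" p] eta_phi[of "V p" p]
    by (simp add: app_xi D_zero_right)
  have 2: "g p (\<phi> p (U p)) (D X \<xi> p) = - ?x1"
    using ext_deriv_adapted[OF adapted_xi[OF ad] U] T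
    by (simp add: app_xi D_zero_left phi_xi cov_endo_apply D_zero_right g_bilinear phi_skew)
  have "g p (\<phi> p (U p)) (cov_endo D \<phi> X (app \<phi> V) p)
      = g p (X p) (D (app \<phi> (app \<phi> V)) (app \<phi> U) p) - g p (X p) (D (app \<phi> V) (app \<phi> (app \<phi> U)) p)
        - 2 * \<omega> X p * g p (\<phi> p (U p)) (\<phi> p (\<phi> p (V p)))"
    using ext_deriv_adapted[OF adapted_app_right[OF ad] app_VF[OF U]] by (simp add: app_apply)
  also have "\<dots> = - g p (X p) (D V (app \<phi> U) p) + \<eta> p (V p) * ?x1
      + g p (X p) (D (app \<phi> V) U p) - \<eta> p (U p) * ?x2 - 2 * \<omega> X p * g p (U p) (\<phi> p (V p))"
    using T X\<xi> g_phi_phi[of "U p" p "\<phi> p (V p)"] eta_phi[of "V p" p]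
    by (simp add: D_phi_phi_left D_phi_phi_right g_bilinear add_in_T diff_in_T neg_in_T scaleR_in_T)
  finally have 3: "g p (\<phi> p (U p)) (cov_endo D \<phi> X (app \<phi> V) p)
      = g p (U p) ?c + \<eta> p (V p) * ?x1 - \<eta> p (U p) * ?x2"
    using ext_deriv_adapted[OF ad U] by simp
  have "cov_endo D \<phi> X (app \<phi> V) p = D X (app \<phi> (app \<phi> V)) p - \<phi> p (?c + \<phi> p (D X V p))"
    by (simp add: cov_endo_apply)
  also have "\<dots> = \<eta> p (V p) *\<^sub>R D X \<xi> p + (X p (\<lambda>q. \<eta> q (V q)) - \<eta> p (D X V p)) *\<^sub>R \<xi> p - \<phi> p ?c"
    using T cT by (simp add: D_phi_phi_right lin_on_add[OF phi_lin] phi_phi algebra_simps)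
  finally have "g p (\<phi> p (U p)) (cov_endo D \<phi> X (app \<phi> V) p)
      = \<eta> p (V p) * g p (\<phi> p (U p)) (D X \<xi> p) - g p (\<phi> p (U p)) (\<phi> p ?c)"
    using T cT g_xi[of "\<phi> p (U p)" p] eta_phi[of "U p" p]
    by (simp add: g_bilinear add_in_T diff_in_T scaleR_in_T)
  also have "g p (\<phi> p (U p)) (\<phi> p ?c) = g p (U p) ?c - \<eta> p (U p) * g p (\<xi> p) ?c"
    using T cT g_phi_phi[of "U p" p ?c] g_xi[OF cT] g_sym[of "\<xi> p" p ?c] by simp
  finally show ?thesis using 1 2 3 by (simp add: algebra_simps)
qed

text \<open>The identity for the O'Neill invariant, paired with \<open>X\<close>.\<close>

lemma D_app_swap:
  assumes ad: "adapted p X V" and U: "U \<in> VF"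
  shows "g p (X p) (D (app \<phi> V) U p) - g p (X p) (D V (app \<phi> U) p) =
    \<eta> p (U p) * g p (X p) (D (app \<phi> V) \<xi> p) - \<eta> p (V p) * g p (X p) (D \<xi> (app \<phi> U) p)
    + 2 * \<omega> X p * g p (U p) (\<phi> p (V p))"
  using ext_deriv_adapted[OF ad U] cov_endo_Hor_Ver[OF ad U] by simp

text \<open>With \<open>W = \<phi>U\<close>, each bracket of a horizontal with a vertical field is written as a difference of
  covariant derivatives by \<open>D_VF_HF\<close>. The covariant derivatives of \<open>W\<close> in the horizontal directions
  \<open>X\<close> and \<open>\<phi>X\<close> cancel up to \<open>\<nabla>\<phi>\<close>, whose values \<open>cov_endo_Hor_Ver\<close> provides. What remains involves
  vertical derivatives only, and \<open>D_app_swap\<close> for the pairs \<open>(X, U)\<close> and \<open>(\<phi>X, \<phi>U)\<close> reduces it to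
  derivatives of \<open>U\<close> and \<open>\<xi>\<close>.\<close>

lemma g_nijenhuis:
  assumes X: "X \<in> HF" and U: "U \<in> VF" and V: "V \<in> vfields A" and Vp: "V p \<in> Ver p"
  shows "g p (nijenhuis \<phi> X (app \<phi> U) p) (V p) =
    - 2 * g p (X p) (D (app \<phi> V) U p) - 2 * g p (\<phi> p (X p)) (D V U p)
    + 2 * \<eta> p (U p) * (g p (X p) (D (app \<phi> V) \<xi> p) + g p (\<phi> p (X p)) (D V \<xi> p))
    + 2 * \<omega> X p * g p (U p) (\<phi> p (V p)) + 2 * \<omega> (app \<phi> X) p * g p (\<phi> p (U p)) (\<phi> p (V p))"
proof -
  define W where "W = app \<phi> U"
  define Y where "Y = app \<phi> X"
  have W: "W \<in> VF" unfolding W_def by (rule app_VF[OF U])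
  have Y: "Y \<in> HF" unfolding Y_def by (rule app_HF[OF X])
  have ad: "adapted p Z V" if "Z \<in> HF" for Z
    using that V Vp by (simp add: adapted_def HF_vfield HF_Hor)
  note fields = HF_vfield[OF X] HF_vfield[OF Y] VF_vfield[OF U] VF_vfield[OF W] V xi_vfield app_vfield
  note T = fields(1-6)[THEN vfields_T, of p] phi_in_T D_T fields
  have br: "g p (bracket Z S p) (R p) = g p (D Z S p) (R p) + g p (Z p) (D R S p)"
    if "Z \<in> HF" "S \<in> VF" "R \<in> vfields A" "R p \<in> Ver p" for Z S R
    using D_VF_HF[OF that] torsion_free[of Z S p] that
    by (simp add: g_bilinear D_T VF_vfield HF_vfield vfields_T)
  have \<eta>W: "\<eta> p (W p) = 0" using eta_phi T by (simp add: W_def app_apply)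
  have \<eta>V: "\<eta> p (\<phi> p (V p)) = 0" using eta_phi T by simp
  have D\<phi>: "g p (D Z (app \<phi> W) p) (R p) = \<eta> p (R p) * g p (Z p) (D \<xi> (app \<phi> W) p) - g p (D Z W p) (\<phi> p (R p))"
    if Z: "Z \<in> HF" and R: "R \<in> vfields A" "R p \<in> Ver p" for Z R
  proof -
    have a: "adapted p Z R" using Z R by (simp add: adapted_def HF_vfield HF_Hor)
    have "g p (cov_endo D \<phi> Z W p) (R p) = - g p (W p) (cov_endo D \<phi> Z R p)"
      by (rule cov_endo_skew[OF HF_vfield[OF Z] VF_vfield[OF W] R(1)])
    also have "\<dots> = \<eta> p (R p) * g p (Z p) (D \<xi> (app \<phi> W) p)"
      using cov_endo_Hor_Ver[OF a W] \<eta>W by simp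
    finally show ?thesis
      using T Z R by (simp add: cov_endo_apply g_bilinear phi_skew HF_vfield vfields_T)
  qed
  have bT: "bracket X W p \<in> T p" "bracket X (app \<phi> W) p \<in> T p" "bracket Y W p \<in> T p" "bracket Y (app \<phi> W) p \<in> T p"
    by (intro vfields_T bracket_vfield fields)+
  \<comment> \<open>Expand the Nijenhuis tensor, then the brackets, then \<open>\<nabla>\<^sub>Y \<phi>W\<close> and \<open>\<nabla>\<^sub>X \<phi>W\<close>.\<close>
  have n0: "g p (nijenhuis \<phi> X W p) (V p)
      = g p (\<phi> p (\<phi> p (bracket X W p))) (V p) + g p (bracket Y (app \<phi> W) p) (V p)
        - g p (\<phi> p (bracket X (app \<phi> W) p)) (V p) - g p (\<phi> p (bracket Y W p)) (V p)"
    using T bT by (simp add: nijenhuis_def app_apply Y_def[symmetric] g_bilinear add_in_T diff_in_T)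
  have n1: "g p (\<phi> p (\<phi> p (bracket X W p))) (V p)
      = - g p (bracket X W p) (V p) + \<eta> p (V p) * g p (bracket X W p) (\<xi> p)"
    using T bT g_xi[of "V p" p] g_sym[of "\<xi> p" p "V p"]
    by (simp add: phi_phi g_bilinear neg_in_T scaleR_in_T g_xi)
  have n2: "g p (\<phi> p (bracket X (app \<phi> W) p)) (V p) = - g p (bracket X (app \<phi> W) p) (app \<phi> V p)"
    using T bT by (simp add: phi_skew app_apply)
  have n3: "g p (\<phi> p (bracket Y W p)) (V p) = - g p (bracket Y W p) (app \<phi> V p)"
    using T bT by (simp add: phi_skew app_apply)
  have n4: "g p (bracket X W p) (V p) = g p (D X W p) (V p) + g p (X p) (D V W p)"
    by (rule br[OF X W V Vp])
  have n5: "g p (bracket X W p) (\<xi> p) = g p (D X W p) (\<xi> p) + g p (X p) (D \<xi> W p)"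
    by (rule br[OF X W xi_vfield xi_Ver])
  have n6: "g p (bracket Y (app \<phi> W) p) (V p) = g p (D Y (app \<phi> W) p) (V p) + g p (Y p) (D V (app \<phi> W) p)"
    by (rule br[OF Y app_VF[OF W] V Vp])
  have n7: "g p (bracket X (app \<phi> W) p) (app \<phi> V p)
      = g p (D X (app \<phi> W) p) (app \<phi> V p) + g p (X p) (D (app \<phi> V) (app \<phi> W) p)"
    by (rule br[OF X app_VF[OF W] app_vfield[OF V]]) (simp add: app_apply phi_Ver Vp)
  have n8: "g p (bracket Y W p) (app \<phi> V p) = g p (D Y W p) (app \<phi> V p) + g p (Y p) (D (app \<phi> V) W p)"
    by (rule br[OF Y W app_vfield[OF V]]) (simp add: app_apply phi_Ver Vp)
  have n9: "g p (D Y (app \<phi> W) p) (V p) = \<eta> p (V p) * g p (Y p) (D \<xi> (app \<phi> W) p) - g p (D Y W p) (app \<phi> V p)"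
    using D\<phi>[OF Y V Vp] by (simp add: app_apply)
  have n10: "g p (D X (app \<phi> W) p) (app \<phi> V p) = g p (D X W p) (V p) - \<eta> p (V p) * g p (D X W p) (\<xi> p)"
  proof -
    have "g p (D X (app \<phi> W) p) (app \<phi> V p) = - g p (D X W p) (\<phi> p (\<phi> p (V p)))"
      using D\<phi>[OF X app_vfield[OF V]] \<eta>V phi_Ver[OF Vp] by (simp add: app_apply)
    then show ?thesis using T by (simp add: phi_phi g_bilinear neg_in_T scaleR_in_T)
  qed
  have N: "g p (nijenhuis \<phi> X W p) (V p) = - g p (X p) (D V W p) + \<eta> p (V p) * g p (X p) (D \<xi> W p)
      + \<eta> p (V p) * g p (Y p) (D \<xi> (app \<phi> W) p) + g p (Y p) (D V (app \<phi> W) p)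
      + g p (X p) (D (app \<phi> V) (app \<phi> W) p) + g p (Y p) (D (app \<phi> V) W p)"
    using n0 n1[unfolded n5 distrib_left] n2 n3 n4 n6 n7 n8 n9 n10 by linarith
  have DW: "g p (Z p) (D R (app \<phi> W) p) = - g p (Z p) (D R U p) + \<eta> p (U p) * g p (Z p) (D R \<xi> p)"
    if "Z \<in> HF" "R \<in> vfields A" for Z R
    using T that HF_vfield[OF that(1)] g_Hor_Ver[OF HF_Hor[OF that(1)] xi_Ver, of p]
    by (simp add: W_def D_phi_phi_right g_bilinear vfields_T add_in_T diff_in_T neg_in_T scaleR_in_T)
  have KX: "g p (X p) (D (app \<phi> V) U p) - g p (X p) (D V W p) =
      \<eta> p (U p) * g p (X p) (D (app \<phi> V) \<xi> p) - \<eta> p (V p) * g p (X p) (D \<xi> W p)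
      + 2 * \<omega> X p * g p (U p) (\<phi> p (V p))"
    using D_app_swap[OF ad[OF X] U] by (simp add: W_def)
  have KY: "g p (Y p) (D (app \<phi> V) W p) - g p (Y p) (D V (app \<phi> W) p) =
      - \<eta> p (V p) * g p (Y p) (D \<xi> (app \<phi> W) p) + 2 * \<omega> Y p * g p (W p) (\<phi> p (V p))"
    using D_app_swap[OF ad[OF Y] W] \<eta>W by simp
  have "g p (nijenhuis \<phi> X W p) (V p) =
    - 2 * g p (X p) (D (app \<phi> V) U p) - 2 * g p (Y p) (D V U p)
    + 2 * \<eta> p (U p) * (g p (X p) (D (app \<phi> V) \<xi> p) + g p (Y p) (D V \<xi> p))
    + 2 * \<omega> X p * g p (U p) (\<phi> p (V p)) + 2 * \<omega> Y p * g p (W p) (\<phi> p (V p))"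
    using N KX KY DW[OF Y V] DW[OF X app_vfield[OF V]] unfolding distrib_left by linarith
  then show ?thesis by (simp add: W_def Y_def app_apply)
qed

text \<open>In \<open>cov_endo_Hor_Ver\<close> the second fundamental form is turned into \<open>T\<^sub>\<xi> X\<close> by \<open>D_VF_HF\<close>.\<close>

lemma ver_cov_endo_Hor_Ver:
  assumes X: "X \<in> HF" and U: "U \<in> VF"
  shows "ver (cov_endo D \<phi> X U) p
    = - (\<eta> p (U p) *\<^sub>R \<phi> p (TT \<xi> X p)) - g p (TT \<xi> X p) (\<phi> p (U p)) *\<^sub>R \<xi> p" (is "_ = ?r")
proof (rule ver_eqI)
  note Xv = HF_vfield[OF X] and Uv = VF_vfield[OF U]
  note T = Xv[THEN vfields_T, of p] Uv[THEN vfields_T, of p] xi_T phi_in_T D_T[OF xi_vfield Xv, of p]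
  have t: "TT \<xi> X p = ver (D \<xi> X) p" by (rule oneill_T_VF_HF[OF xi_VF X])
  have tV: "TT \<xi> X p \<in> Ver p" unfolding t by (rule ver_in(1)[of "D \<xi> X" p, OF T(5)])
  show r: "?r \<in> Ver p"
    by (intro subspace_diff[OF subspace_Ver] subspace_neg[OF subspace_Ver] subspace_scale[OF subspace_Ver]
        phi_Ver xi_Ver tV)
  have "g p (cov_endo D \<phi> X U p - ?r) u = 0" if u: "u \<in> Ver p" for u
  proof -
    obtain V where V: "V \<in> vfields A" "V p = u" using exists_vfield[OF VerD[OF u]] .
    have Vp: "V p \<in> Ver p" using V(2) u by simp
    have ad: "adapted p X V" using X V(1) Vp by (simp add: adapted_def Xv HF_Hor)
    have gt: "g p (TT \<xi> X p) (R p) = - g p (X p) (D R \<xi> p)" if "R \<in> vfields A" "R p \<in> Ver p" for R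
      unfolding t using g_ver[of "D \<xi> X" p, OF T(5) that(2)] D_VF_HF[OF X xi_VF that] by simp
    have "g p (cov_endo D \<phi> X U p) (V p) = - g p (U p) (cov_endo D \<phi> X V p)"
      by (rule cov_endo_skew[OF Xv Uv V(1)])
    also have "\<dots> = - \<eta> p (U p) * g p (X p) (D (app \<phi> V) \<xi> p) + \<eta> p (V p) * g p (X p) (D \<xi> (app \<phi> U) p)"
      using cov_endo_Hor_Ver[OF ad U] by simp
    also have "g p (X p) (D (app \<phi> V) \<xi> p) = - g p (TT \<xi> X p) (\<phi> p u)"
      using gt[OF app_vfield[OF V(1)]] phi_Ver[OF u] V(2) by (simp add: app_apply)
    also have "g p (X p) (D \<xi> (app \<phi> U) p) = - g p (TT \<xi> X p) (\<phi> p (U p))"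
      using gt[OF app_vfield[OF Uv]] phi_Ver[OF VF_Ver[OF U]] D_commute_VF[OF HF_Hor[OF X] xi_VF app_VF[OF U]]
      by (simp add: app_apply)
    also have "- \<eta> p (U p) * - g p (TT \<xi> X p) (\<phi> p u) + \<eta> p (V p) * - g p (TT \<xi> X p) (\<phi> p (U p)) = g p ?r u"
      using T VerD[OF tV] VerD[OF u] V(2) g_xi[OF VerD[OF u]] g_sym[of "\<xi> p" p u]
      by (simp add: g_bilinear phi_skew neg_in_T scaleR_in_T diff_in_T)
    finally show ?thesis
      using V(2) VerD[OF r] VerD[OF u] cov_endo_T[OF Xv Uv] by (simp add: g_diff_left)
  qed
  then show "cov_endo D \<phi> X U p - ?r \<in> Hor p"
    using diff_in_T[OF cov_endo_T[OF Xv Uv] VerD[OF r]] by (simp add: horiz_def)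
qed

text \<open>The formula of \<open>g_nijenhuis\<close>, solved for the two terms that make up \<open>\<nabla>\<^sub>U \<phi>\<close> in \<open>cov_endo_Ver_Hor\<close>.
  That the right-hand side is vertical at all rests on \<open>nijenhuis_Ver\<close>.\<close>

lemma ver_cov_endo_Ver_Hor:
  assumes X: "X \<in> HF" and U: "U \<in> VF"
  shows "ver (cov_endo D \<phi> U X) p
    = \<eta> p (U p) *\<^sub>R (TT \<xi> (app \<phi> X) p - \<phi> p (TT \<xi> X p))
      + \<omega> X p *\<^sub>R \<phi> p (U p) + \<omega> (app \<phi> X) p *\<^sub>R \<phi> p (\<phi> p (U p))
      + (1 / 2) *\<^sub>R nijenhuis \<phi> X (app \<phi> U) p" (is "_ = ?r")
proof (rule ver_eqI)
  note Xv = HF_vfield[OF X] and Uv = VF_vfield[OF U]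
  note UV = VF_Ver[OF U, of p]
  have DT: "D \<xi> Z p \<in> T p" if "Z \<in> HF" for Z by (rule D_T[OF xi_vfield HF_vfield[OF that]])
  have t: "TT \<xi> Z p = ver (D \<xi> Z) p" if "Z \<in> HF" for Z by (rule oneill_T_VF_HF[OF xi_VF that])
  have tV: "TT \<xi> Z p \<in> Ver p" if "Z \<in> HF" for Z unfolding t[OF that] by (rule ver_in(1)[of "D \<xi> Z" p, OF DT[OF that]])
  note S = tV[OF X] tV[OF app_HF[OF X]] phi_Ver[OF tV[OF X]] phi_Ver[OF UV] phi_Ver[OF phi_Ver[OF UV]]
    nijenhuis_Ver[OF Xv app_VF[OF U], of p]
  show r: "?r \<in> Ver p"
    by (intro subspace_add[OF subspace_Ver] subspace_diff[OF subspace_Ver] subspace_scale[OF subspace_Ver] S)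
  have "g p (cov_endo D \<phi> U X p - ?r) u = 0" if u: "u \<in> Ver p" for u
  proof -
    obtain V where V: "V \<in> vfields A" "V p = u" using exists_vfield[OF VerD[OF u]] .
    have Vp: "V p \<in> Ver p" using V(2) u by simp
    have ad: "adapted p X V" using X V(1) Vp by (simp add: adapted_def Xv HF_Hor)
    have gt: "g p (TT \<xi> Z p) (R p) = - g p (Z p) (D R \<xi> p)" if "Z \<in> HF" "R \<in> vfields A" "R p \<in> Ver p" for R Z
      unfolding t[OF that(1)] using g_ver[of "D \<xi> Z" p, OF DT[OF that(1)] that(3)] D_VF_HF[OF that(1) xi_VF that(2,3)] by simp
    have 1: "g p (TT \<xi> (app \<phi> X) p) u = - g p (\<phi> p (X p)) (D V \<xi> p)"
      using gt[OF app_HF[OF X] V(1) Vp] V(2) by (simp add: app_apply)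
    have 2: "g p (\<phi> p (TT \<xi> X p)) u = g p (X p) (D (app \<phi> V) \<xi> p)"
      using gt[OF X app_vfield[OF V(1)]] phi_Ver[OF u] V(2) phi_skew[OF VerD[OF S(1)] VerD[OF u]]
      by (simp add: app_apply)
    have 3: "g p (\<phi> p (U p)) u = - g p (U p) (\<phi> p u)" "g p (\<phi> p (\<phi> p (U p))) u = - g p (\<phi> p (U p)) (\<phi> p u)"
      using phi_skew VerD u UV phi_in_T by auto
    have "g p (cov_endo D \<phi> U X p) u = - g p (\<phi> p (X p)) (D V U p) - g p (X p) (D (app \<phi> V) U p)"
      using cov_endo_Ver_Hor[OF ad U] V(2) g_sym[OF VerD[OF u] cov_endo_T[OF Uv Xv]] by simp
    also have "\<dots> = \<eta> p (U p) * (g p (TT \<xi> (app \<phi> X) p) u - g p (\<phi> p (TT \<xi> X p)) u)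
        + \<omega> X p * g p (\<phi> p (U p)) u + \<omega> (app \<phi> X) p * g p (\<phi> p (\<phi> p (U p))) u
        + 1 / 2 * g p (nijenhuis \<phi> X (app \<phi> U) p) u"
      using g_nijenhuis[OF X U V(1) Vp] V(2) unfolding 1 2 3 by (simp add: algebra_simps)
    also have "\<dots> = g p ?r u"
      using S[THEN VerD] VerD[OF u] by (simp add: g_add_left g_diff_left g_scale_left add_in_T diff_in_T scaleR_in_T)
    finally show ?thesis
      using VerD[OF r] VerD[OF u] cov_endo_T[OF Uv Xv] by (simp add: g_diff_left)
  qed
  then show "cov_endo D \<phi> U X p - ?r \<in> Hor p"
    using diff_in_T[OF cov_endo_T[OF Uv Xv] VerD[OF r]] by (simp add: horiz_def)
qed

lemma oneill_T_app_swap: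
  assumes U: "U \<in> VF" and V: "V \<in> VF" and B: "metric_dual A g \<omega> B"
  shows "TT U (app \<phi> V) p - TT (app \<phi> U) V p
    = \<eta> p (U p) *\<^sub>R TT (app \<phi> V) \<xi> p - \<eta> p (V p) *\<^sub>R TT (app \<phi> U) \<xi> p
      + (2 * fundamental_form g \<phi> p (U p) (V p)) *\<^sub>R hor B p" (is "?l = ?r")
proof -
  note Uv = VF_vfield[OF U] and Vv = VF_vfield[OF V] and aU = app_VF[OF U] and aV = app_VF[OF V]
  have Bv: "B \<in> vfields A" and B\<omega>: "g p (B p) (X p) = \<omega> X p" if "X \<in> vfields A" for X
    using B that by (simp_all add: metric_dual_def)
  note DT = D_T[OF VF_vfield VF_vfield, of _ _ p]
  have tH: "TT R S p \<in> Hor p" if "R \<in> VF" "S \<in> VF" for R S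
    unfolding oneill_T_VF_VF[OF that] by (rule hor_in(1)[of "D R S" p, OF DT[OF that]])
  have BT: "B p \<in> T p" using B vfields_T by (auto simp: metric_dual_def)
  note S = tH[OF U aV] tH[OF aU V] tH[OF aV xi_VF] tH[OF aU xi_VF] hor_in(1)[of B p, OF BT]
  have l: "?l \<in> Hor p" by (intro subspace_diff[OF subspace_Hor] S)
  have r: "?r \<in> Hor p"
    by (intro subspace_add[OF subspace_Hor] subspace_diff[OF subspace_Hor] subspace_scale[OF subspace_Hor] S)
  have lr: "?l - ?r \<in> Hor p" by (rule subspace_diff[OF subspace_Hor l r])
  have "g p (?l - ?r) x = 0" if x: "x \<in> Hor p" for x
  proof -
    obtain X where X: "X \<in> vfields A" "X p = x" using exists_vfield[OF HorD[OF x]] .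
    have ad: "adapted p X V" using X x V by (simp add: adapted_def Vv VF_Ver)
    have gt: "g p (TT R S p) x = g p x (D R S p)" if "R \<in> VF" "S \<in> VF" for R S
      unfolding oneill_T_VF_VF[OF that] using g_hor[of "D R S" p, OF DT[OF that] x] g_sym[OF HorD[OF x] DT[OF that]] by simp
    have gB: "g p (hor B p) x = \<omega> X p"
      using g_hor[of B p, OF BT x] B\<omega>[OF X(1)] X(2) by simp
    have "g p ?l x = g p x (D U (app \<phi> V) p) - g p x (D (app \<phi> U) V p)"
      using S[THEN HorD] HorD[OF x] gt[OF U aV] gt[OF aU V] by (simp add: g_diff_left)
    also have "\<dots> = g p x (D (app \<phi> V) U p) - g p x (D V (app \<phi> U) p)"
      using D_commute_VF[OF x U aV] D_commute_VF[OF x aU V] by simp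
    also have "\<dots> = \<eta> p (U p) * g p x (D (app \<phi> V) \<xi> p) - \<eta> p (V p) * g p x (D \<xi> (app \<phi> U) p)
        + 2 * \<omega> X p * g p (U p) (\<phi> p (V p))"
      using D_app_swap[OF ad U] X(2) by simp
    also have "g p x (D \<xi> (app \<phi> U) p) = g p x (D (app \<phi> U) \<xi> p)"
      by (rule D_commute_VF[OF x xi_VF aU])
    also have "\<eta> p (U p) * g p x (D (app \<phi> V) \<xi> p) - \<eta> p (V p) * g p x (D (app \<phi> U) \<xi> p)
        + 2 * \<omega> X p * g p (U p) (\<phi> p (V p)) = g p ?r x"
      using S[THEN HorD] HorD[OF x] gt[OF aV xi_VF] gt[OF aU xi_VF] gB
      by (simp add: g_add_left g_diff_left g_scale_left add_in_T diff_in_T scaleR_in_T fundamental_form_def)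
    finally have "g p ?l x = g p ?r x" .
    then show ?thesis
      unfolding g_diff_left[OF HorD[OF x] HorD[OF l] HorD[OF r]] by simp
  qed
  from this[OF lr] have "?l - ?r = 0"
    using g_pos[OF HorD[OF lr]] by fastforce
  then show ?thesis by simp
qed

end

theorem proposition2p5:
  fixes A :: "('a::{t2_space,second_countable_topology}, 'e::euclidean_space) chart set"
    and \<phi> :: "'a \<Rightarrow> 'a tvec \<Rightarrow> 'a tvec"
    and \<xi> :: "'a vfield"
    and \<eta> :: "'a \<Rightarrow> 'a tvec \<Rightarrow> real"
    and g :: "'a \<Rightarrow> 'a tvec \<Rightarrow> 'a tvec \<Rightarrow> real"
    and A' :: "('b::{t2_space,second_countable_topology}, 'f::euclidean_space) chart set"
    and J :: "'b \<Rightarrow> 'b tvec \<Rightarrow> 'b tvec"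
    and g' :: "'b \<Rightarrow> 'b tvec \<Rightarrow> 'b tvec \<Rightarrow> real"
    and \<pi> :: "'a \<Rightarrow> 'b"
    and m n :: nat
    and D :: "'a vfield \<Rightarrow> 'a vfield \<Rightarrow> 'a vfield"
    and \<omega> :: "'a vfield \<Rightarrow> 'a \<Rightarrow> real"
    and B :: "'a vfield"
    and v h :: "'a vfield \<Rightarrow> 'a vfield"
    and T :: "'a vfield \<Rightarrow> 'a vfield \<Rightarrow> 'a vfield"
  assumes "contact_complex_submersion A \<phi> \<xi> \<eta> g A' J g' \<pi>"
    and "DIM('e) = 2 * m + 1" and "2 * m + 1 \<ge> 5"
    and "DIM('f) = 2 * n" and "2 * n \<ge> 2"
    and "levi_civita A g D"
    and "\<omega> = lee_form m A \<phi> \<xi> \<eta> g D"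
    and "metric_dual A g \<omega> B"
    and "\<forall>X\<in>vfields A. \<forall>Y\<in>vfields A. \<forall>Z\<in>vfields A. \<forall>p.
           ext_deriv2 (fundamental_form g \<phi>) X Y Z p
             = - 2 * wedge12 \<omega> (fundamental_form g \<phi>) X Y Z p"
    and "v = vproj A A' g \<pi>"
    and "h = hproj A A' g \<pi>"
    and "T = oneill_T A A' g \<pi> D"
  shows "(\<forall>X\<in>horizontal_fields A A' g \<pi>. \<forall>U\<in>vertical_fields A A' \<pi>. \<forall>p.
            v (cov_endo D \<phi> X U) p
              = - (\<eta> p (U p) *\<^sub>R \<phi> p (T \<xi> X p)) - g p (T \<xi> X p) (\<phi> p (U p)) *\<^sub>R \<xi> p \<and>
            v (cov_endo D \<phi> U X) p
              = \<eta> p (U p) *\<^sub>R (T \<xi> (app \<phi> X) p - \<phi> p (T \<xi> X p))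
                + \<omega> X p *\<^sub>R \<phi> p (U p) + \<omega> (app \<phi> X) p *\<^sub>R \<phi> p (\<phi> p (U p))
                + (1 / 2) *\<^sub>R nijenhuis \<phi> X (app \<phi> U) p) \<and>
         (\<forall>U\<in>vertical_fields A A' \<pi>. \<forall>V\<in>vertical_fields A A' \<pi>. \<forall>p.
            T U (app \<phi> V) p - T (app \<phi> U) V p
              = \<eta> p (U p) *\<^sub>R T (app \<phi> V) \<xi> p - \<eta> p (V p) *\<^sub>R T (app \<phi> U) \<xi> p
                + (2 * fundamental_form g \<phi> p (U p) (V p)) *\<^sub>R h B p)"
proof -
  have acm: "almost_contact_metric A \<phi> \<xi> \<eta> g"
    using assms(1) by (simp add: contact_complex_submersion_def)
  interpret lee_submersion A g \<phi> \<xi> \<eta> D A' J g' \<pi> \<omega>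
    using acm assms(1,6,9) by unfold_locales (auto simp: almost_contact_metric_def)
  show ?thesis
    unfolding assms(10-12)
    using ver_cov_endo_Hor_Ver ver_cov_endo_Ver_Hor oneill_T_app_swap[OF _ _ assms(8)] by blast
qed

end
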